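(* Let $\Omega\subset\mathbb{R}^n$ be open, let $\mathcal{N}\subset\mathbb{R}^p$ be a $C^k$-submanifold with $k\ge 3$, and let $u\in W^{1,2}(\Omega;\mathcal{N})$ be a critical point of the Dirichlet energy under outer variations, i.e. $$\frac{d}{ds}\Big|_{s=0}\mathcal{E}_{\mathbf{B}_\rho(y)}\big[\Pi(u+s\zeta)\big]=0\qquad\text{for every ball }\mathbf{B}_\rho(y)\Subset\Omega\text{ and every }\zeta\in C_0^\infty(\mathbf{B}_\rho(y);\mathbb{R}^p).$$ Then, in the weak sense, $$(\Delta u)^T=0\quad\text{on }\Omega,$$ where $(\Delta u)^T$ is the orthogonal projection of $\Delta u$ to $T\mathcal{N}$ (at the point $u$). This is equivalent to $$-\sum_{i=1}^n\partial_i\partial_i u+\sum_{i=1}^n\mathrm{Hess}_u\Pi(\partial_i u,\partial_i u)=0\quad\text{on }\Omega,$$ and also to $$\sum_{i=1}^n\partial_i\partial_i u+\sum_{i=1}^n A_u(\partial_i u,\partial_i u)=0\quad\text{on }\Omega,$$ where $A$ is the second fundamental form of $\mathcal{N}\subset\mathbb{R}^p$.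
   Context: $W^{1,2}(\Omega;\mathcal{N})=\{u\in W^{1,2}(\Omega;\mathbb{R}^p):u(x)\in\mathcal{N}\text{ for a.e. }x\in\Omega\}$. The Dirichlet energy is $\mathcal{E}_{\Omega'}[u]=\frac12\int_{\Omega'}|\nabla u|^2\,dx$ for $\Omega'\subset\Omega$. Let $\delta=\delta(\mathcal{N})>0$ be such that the nearest point projection $\Pi$ onto $\mathcal{N}$ is well defined and of class $C^{k-1}$ on the tubular neighbourhood $\mathcal{T}_\delta(\mathcal{N})=\{x\in\mathbb{R}^p:\mathrm{dist}(x,\mathcal{N})<\delta\}$, with $\Pi(x)$ the unique point of $\mathcal{N}$ satisfying $|x-\Pi(x)|=\mathrm{dist}(x,\mathcal{N})$. In the outer variation $\Pi(u+s\zeta)$, $|s|$ is taken so small that $u+s\zeta$ takes values in $\mathcal{T}_\delta(\mathcal{N})$. For a vector $v$ at a point of $\mathcal{N}$, $v=v^T+v^\perp$ is the orthogonal decomposition into parts tangent and normal to $\mathcal{N}$; in particular $v^T=d\Pi(v)$. With $D$ the flat connection on $\mathbb{R}^p$, $\mathrm{Hess}_y\Pi(v,w)=(D_vD_w\Pi)|_y-(D_{D_vw}\Pi)|_y$, i.e. the second derivative $D^2\Pi(y)$ applied to $(v,w)$. The sign convention for the second fundamental form is $A_y(v,w)=-(D_vw)^\perp$ for $v,w$ tangent to $\mathcal{N}$. All equations are understood in the weak sense, tested against $\zeta\in C_0^\infty(\Omega;\mathbb{R}^p)$: $(\Delta u)^T=0$ means $\int_\Omega\sum_i\partial_iu\cdot\partial_i(d\Pi_u(\zeta))\,dx=0$,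 and $\Delta u=F$ means $-\int_\Omega\sum_i\partial_iu\cdot\partial_i\zeta\,dx=\int_\Omega F\cdot\zeta\,dx$. *)

theory Defs
  imports "HOL-Analysis.Analysis"
begin

text \<open>Intended for open S. In finite dimensions, continuity of all iterated directional derivatives
  is continuity of the iterated Frechet derivatives.\<close>

primrec Ck_on :: "nat \<Rightarrow> ('a::euclidean_space \<Rightarrow> 'b::real_normed_vector) \<Rightarrow> 'a set \<Rightarrow> bool" where
  "Ck_on 0 f S \<longleftrightarrow> continuous_on S f"
| "Ck_on (Suc k) f S \<longleftrightarrow>
     (\<forall>x\<in>S. f differentiable (at x)) \<and> (\<forall>v. Ck_on k (\<lambda>x. frechet_derivative f (at x) v) S)"

text \<open>Test functions on \<Omega> are represented by their extension by zero to the whole space.\<close>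

definition test_functions :: "'a::euclidean_space set \<Rightarrow> ('a \<Rightarrow> 'b::real_normed_vector) set" where
  "test_functions \<Omega> = {\<zeta>. (\<forall>k. Ck_on k \<zeta> UNIV) \<and>
     (\<exists>K. compact K \<and> K \<subseteq> \<Omega> \<and> (\<forall>x. x \<notin> K \<longrightarrow> \<zeta> x = 0))}"

definition partial_deriv :: "'n \<Rightarrow> (real^'n \<Rightarrow> 'b::real_normed_vector) \<Rightarrow> real^'n \<Rightarrow> 'b" where
  "partial_deriv i f x = frechet_derivative f (at x) (axis i 1)"

definition locally_integrable_on ::
    "(real^'n \<Rightarrow> 'b::euclidean_space) \<Rightarrow> (real^'n) set \<Rightarrow> bool" (infix \<open>locally'_integrable'_on\<close> 50) where
  "f locally_integrable_on \<Omega> \<longleftrightarrow> (\<forall>K. compact K \<and> K \<subseteq> \<Omega> \<longrightarrow> integrable (lebesgue_on K) f)"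

definition has_weak_partial ::
    "(real^'n) set \<Rightarrow> 'n \<Rightarrow> (real^'n \<Rightarrow> 'b::euclidean_space) \<Rightarrow> (real^'n \<Rightarrow> 'b) \<Rightarrow> bool" where
  "has_weak_partial \<Omega> i u g \<longleftrightarrow>
     u locally_integrable_on \<Omega> \<and> g locally_integrable_on \<Omega> \<and>
     (\<forall>\<phi> :: real^'n \<Rightarrow> real. \<phi> \<in> test_functions \<Omega> \<longrightarrow>
        (LINT x|lebesgue_on \<Omega>. partial_deriv i \<phi> x *\<^sub>R u x) = - (LINT x|lebesgue_on \<Omega>. \<phi> x *\<^sub>R g x))"

text \<open>A representative of the weak partial derivative, which on open \<Omega> is unique up to null sets;
  unspecified if there is none.\<close>

definition weak_partial ::
    "(real^'n) set \<Rightarrow> 'n \<Rightarrow> (real^'n \<Rightarrow> 'b::euclidean_space) \<Rightarrow> real^'n \<Rightarrow> 'b" where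
  "weak_partial \<Omega> i u = (SOME g. has_weak_partial \<Omega> i u g)"

definition square_integrable_on ::
    "(real^'n \<Rightarrow> 'b::euclidean_space) \<Rightarrow> (real^'n) set \<Rightarrow> bool" (infix \<open>square'_integrable'_on\<close> 50) where
  "f square_integrable_on \<Omega> \<longleftrightarrow>
     f \<in> borel_measurable (lebesgue_on \<Omega>) \<and> integrable (lebesgue_on \<Omega>) (\<lambda>x. (norm (f x))\<^sup>2)"

definition W12 :: "(real^'n) set \<Rightarrow> (real^'n \<Rightarrow> 'b::euclidean_space) set" where
  "W12 \<Omega> = {u. u square_integrable_on \<Omega> \<and>
     (\<forall>i. \<exists>g. has_weak_partial \<Omega> i u g \<and> g square_integrable_on \<Omega>)}"

definition W12_into :: "(real^'n) set \<Rightarrow> (real^'p) set \<Rightarrow> (real^'n \<Rightarrow> real^'p) set" where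
  "W12_into \<Omega> N = {u \<in> W12 \<Omega>. AE x in lebesgue_on \<Omega>. u x \<in> N}"

definition dirichlet_energy :: "(real^'n) set \<Rightarrow> (real^'n \<Rightarrow> real^'p) \<Rightarrow> real" where
  "dirichlet_energy \<Omega> u = 1/2 * (LINT x|lebesgue_on \<Omega>. (\<Sum>i\<in>UNIV. (norm (weak_partial \<Omega> i u x))\<^sup>2))"

definition Ck_submanifold :: "nat \<Rightarrow> (real^'p) set \<Rightarrow> bool" where
  "Ck_submanifold k N \<longleftrightarrow> (\<exists>m. \<forall>y\<in>N. \<exists>U V \<phi> \<psi> (L :: (real^'p) set).
     open U \<and> y \<in> U \<and> open V \<and> homeomorphism U V \<phi> \<psi> \<and> Ck_on k \<phi> U \<and> Ck_on k \<psi> V \<and>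
     subspace L \<and> dim L = m \<and> \<phi> ` (N \<inter> U) = L \<inter> V)"

definition tubular_nbhd :: "(real^'p) set \<Rightarrow> real \<Rightarrow> (real^'p) set" where
  "tubular_nbhd N \<delta> = {x. infdist x N < \<delta>}"

text \<open>\<^const>\<open>closest_point\<close> picks some nearest point; on the neighbourhood the pick is the unique one.\<close>

definition Ck_nearest_point_projection :: "nat \<Rightarrow> (real^'p) set \<Rightarrow> real \<Rightarrow> bool" where
  "Ck_nearest_point_projection k N \<delta> \<longleftrightarrow>
     (\<forall>x\<in>tubular_nbhd N \<delta>. \<exists>!y. y \<in> N \<and> dist x y = infdist x N) \<and>
     Ck_on k (closest_point N) (tubular_nbhd N \<delta>)"

definition tangent_space :: "(real^'p) set \<Rightarrow> real^'p \<Rightarrow> (real^'p) set" where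
  "tangent_space N y = {v. \<exists>\<epsilon>>0. \<exists>\<gamma> :: real \<Rightarrow> real^'p.
     Ck_on 1 \<gamma> {-\<epsilon><..<\<epsilon>} \<and> \<gamma> ` {-\<epsilon><..<\<epsilon>} \<subseteq> N \<and> \<gamma> 0 = y \<and> (\<gamma> has_vector_derivative v) (at 0)}"

definition tangential_part :: "(real^'p) set \<Rightarrow> real^'p \<Rightarrow> real^'p \<Rightarrow> real^'p" where
  "tangential_part N y v =
     (THE t. t \<in> tangent_space N y \<and> (\<forall>w\<in>tangent_space N y. (v - t) \<bullet> w = 0))"

definition normal_part :: "(real^'p) set \<Rightarrow> real^'p \<Rightarrow> real^'p \<Rightarrow> real^'p" where
  "normal_part N y v = v - tangential_part N y v"

text \<open>The Hessian with respect to the flat connection, evaluated on constant vector fields,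
  for which the term involving the covariant derivative of w vanishes.\<close>

definition Hess :: "(real^'p \<Rightarrow> real^'p) \<Rightarrow> real^'p \<Rightarrow> real^'p \<Rightarrow> real^'p \<Rightarrow> real^'p" where
  "Hess f y v w = frechet_derivative (\<lambda>z. frechet_derivative f (at z) w) (at y) v"

text \<open>Minus the normal part of the derivative in direction v of any local extension W of w that is
  tangent along N. The value does not depend on W; it is only meaningful for v, w tangent at y.\<close>

definition second_fundamental_form ::
    "(real^'p) set \<Rightarrow> real^'p \<Rightarrow> real^'p \<Rightarrow> real^'p \<Rightarrow> real^'p" where
  "second_fundamental_form N y v w = (THE a. \<exists>U W.
     open U \<and> y \<in> U \<and> Ck_on 1 W U \<and> (\<forall>z\<in>N \<inter> U. W z \<in> tangent_space N z) \<and> W y = w \<and>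
     a = - normal_part N y (frechet_derivative W (at y) v))"

text \<open>The derivative at 0 only involves small s, for which u + s \<zeta> takes values in the tubular
  neighbourhood almost everywhere.\<close>

definition outer_critical :: "(real^'n) set \<Rightarrow> (real^'p) set \<Rightarrow> (real^'n \<Rightarrow> real^'p) \<Rightarrow> bool" where
  "outer_critical \<Omega> N u \<longleftrightarrow>
     (\<forall>y \<rho>. 0 < \<rho> \<and> cball y \<rho> \<subseteq> \<Omega> \<longrightarrow>
       (\<forall>\<zeta>\<in>test_functions (ball y \<rho>).
         ((\<lambda>s. dirichlet_energy (ball y \<rho>) (\<lambda>x. closest_point N (u x + s *\<^sub>R \<zeta> x)))
            has_real_derivative 0) (at 0)))"

text \<open>The weak form of vanishing tangential part of the Laplacian. Existence of the weak derivatives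
  of the tangential test field and integrability are part of the assertion, so that the
  integral is meaningful.\<close>

definition weak_tangential_laplacian_zero ::
    "(real^'n) set \<Rightarrow> (real^'p) set \<Rightarrow> (real^'n \<Rightarrow> real^'p) \<Rightarrow> bool" where
  "weak_tangential_laplacian_zero \<Omega> N u \<longleftrightarrow>
     (\<forall>\<zeta>\<in>test_functions \<Omega>.
        let w = (\<lambda>x. frechet_derivative (closest_point N) (at (u x)) (\<zeta> x));
            f = (\<lambda>x. \<Sum>i\<in>UNIV. weak_partial \<Omega> i u x \<bullet> weak_partial \<Omega> i w x)
        in (\<forall>i. \<exists>g. has_weak_partial \<Omega> i w g) \<and>
           integrable (lebesgue_on \<Omega>) f \<and> (LINT x|lebesgue_on \<Omega>. f x) = 0)"

definition weak_laplacian_eq ::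
    "(real^'n) set \<Rightarrow> (real^'n \<Rightarrow> real^'p) \<Rightarrow> (real^'n \<Rightarrow> real^'p) \<Rightarrow> bool" where
  "weak_laplacian_eq \<Omega> u F \<longleftrightarrow>
     (\<forall>\<zeta>\<in>test_functions \<Omega>.
        integrable (lebesgue_on \<Omega>) (\<lambda>x. \<Sum>i\<in>UNIV. weak_partial \<Omega> i u x \<bullet> partial_deriv i \<zeta> x) \<and>
        integrable (lebesgue_on \<Omega>) (\<lambda>x. F x \<bullet> \<zeta> x) \<and>
        - (LINT x|lebesgue_on \<Omega>. (\<Sum>i\<in>UNIV. weak_partial \<Omega> i u x \<bullet> partial_deriv i \<zeta> x)) =
          (LINT x|lebesgue_on \<Omega>. F x \<bullet> \<zeta> x))"

end

theory Submission
  imports Defs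
begin

text \<open>Write \<open>\<pi>\<close> for the nearest point projection and \<open>D\<close>, \<open>Hess \<pi>\<close> for its first and second
  derivative. On the set N the map \<open>D y\<close> is the orthogonal projection onto the tangent space, and the
  function \<open>D u \<zeta>\<close> has the weak derivatives \<open>Hess \<pi> u (\<partial>\<^sub>i u, \<zeta>) + D u (\<partial>\<^sub>i \<zeta>)\<close>. Since u takes values in N,
  differentiating \<open>\<pi> u = u\<close> gives \<open>D u (\<partial>\<^sub>i u) = \<partial>\<^sub>i u\<close>. As \<open>D y\<close> and, for tangent v, \<open>Hess \<pi> y (v, _)\<close>
  are symmetric operators,
  \[ \sum_i \partial_i u \cdot \partial_i (D u\,\zeta)
     = \sum_i \partial_i u \cdot \partial_i \zeta + \sum_i Hess\,\pi_u(\partial_i u, \partial_i u) \cdot \zeta \]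
  almost everywhere, test function by test function. This is the equivalence with the equation for the
  Hessian (\<open>tangential_iff_Hess\<close>). The equation for the second fundamental form has the same right hand
  side, because differentiating \<open>D z (W z) = W z\<close> for a tangent field W identifies \<open>Hess \<pi>\<close> on
  tangent vectors with minus the second fundamental form (\<open>second_fundamental_form_eq\<close>).

  Two kinds of tools are needed. The first is the chain rule for a Sobolev map with values in a
  closed set C and a function F that is Lipschitz on C and differentiable at its points
  (\<open>has_weak_partial_chain\<close>). Its proof compares values of F at points of C only: difference quotients of u
  converge in the mean to its weak derivative (\<open>difference_quotient_tendsto\<close>), and those of \<open>F u\<close> are
  controlled by those of u.

  The second is a set of bounds that hold uniformly on N, which may be unbounded. They come from the
  positive reach of N. A point x keeps its foot q when it moves along the normal ray up to distance
  \<open>\<delta>\<close> (\<open>projection_normal_ray\<close>), so the open ball of radius \<open>\<delta>\<close> around the end of that ray contains no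
  point of N, which gives \<open>(x - q) \<bullet> (y - q) \<le> norm (x - q) (norm (y - q))\<^sup>2 / (2 \<delta>)\<close> for all y in N. Hence \<open>\<pi>\<close> is
  Lipschitz on smaller tubes with a constant that tends to 1 as the tube shrinks
  (\<open>projection_lipschitz\<close>), and \<open>Hess \<pi>\<close> is bounded on N by \<open>2 / \<delta>\<close> in tangent directions
  (\<open>norm_Hess_tangent_le\<close>), so that D is Lipschitz on N (\<open>D_lipschitz_on_N\<close>).

  For the outer variations the energy densities of \<open>\<pi> (u + s \<zeta>)\<close> have difference quotients in s that
  converge almost everywhere to the first variation. Away from N the second derivative of \<open>\<pi>\<close> need
  not be bounded uniformly, so it provides no majorant. The Lipschitz constant \<open>1 / (1 - r / \<delta>)\<close>
  at distance r from N provides an integrable upper bound for \<open>s > 0\<close>, and one side suffices: by the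
  reverse Fatou lemma the first variation of a critical u in direction \<open>\<zeta>\<close> is nonnegative, and the same
  for \<open>- \<zeta>\<close> shows that it is zero. A general test function is split by cut-off functions into finitely many test functions supported in balls.\<close>

section \<open>Calculus of continuously differentiable functions\<close>

lemma Ck_on_SucD: "Ck_on (Suc k) f S \<Longrightarrow> Ck_on k f S"
proof (induction k arbitrary: f)
  case 0
  then show ?case
    by (auto simp: continuous_on_eq_continuous_within intro!: differentiable_imp_continuous_within
        intro: differentiable_at_withinI)
next
  case (Suc k)
  then show ?case
    by (metis Ck_on.simps(2))
qed

lemma Ck_on_le: "Ck_on k f S \<Longrightarrow> j \<le> k \<Longrightarrow> Ck_on j f S"
  by (induction k) (metis le_zero_eq, metis Ck_on_SucD le_Suc_eq)

lemma Ck_on_cong_open: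
  assumes "open S" "\<And>x. x \<in> S \<Longrightarrow> f x = g x" "Ck_on k f S"
  shows "Ck_on k g S"
  using assms(2,3)
proof (induction k arbitrary: f g)
  case 0
  then show ?case by (metis Ck_on.simps(1) continuous_on_eq)
next
  case (Suc k)
  have d: "(g has_derivative frechet_derivative f (at x)) (at x)" if "x \<in> S" for x
  proof (rule has_derivative_transform_within_open[OF _ \<open>open S\<close> that])
    show "(f has_derivative frechet_derivative f (at x)) (at x)"
      using Suc.prems(2) that frechet_derivative_works by auto
  qed (use Suc.prems(1) in auto)
  then have "frechet_derivative g (at x) = frechet_derivative f (at x)" if "x \<in> S" for x
    using frechet_derivative_at that by metis
  then have "Ck_on k (\<lambda>x. frechet_derivative g (at x) v) S" for v
    using Suc.IH[of "\<lambda>x. frechet_derivative f (at x) v" "\<lambda>x. frechet_derivative g (at x) v"] Suc.prems(2)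
    by auto
  then show ?case using d unfolding Ck_on.simps differentiable_def by blast
qed

text \<open>Any family of derivatives serves to establish the property, because derivatives on an open set
  are unique and the property only depends on the values there.\<close>

lemma Ck_on_SucI:
  assumes "open S" "\<And>x. x \<in> S \<Longrightarrow> (f has_derivative f' x) (at x)" "\<And>v. Ck_on k (\<lambda>x. f' x v) S"
  shows "Ck_on (Suc k) f S"
proof -
  have "frechet_derivative f (at x) = f' x" if "x \<in> S" for x
    using frechet_derivative_at assms(2) that by metis
  then have "Ck_on k (\<lambda>x. frechet_derivative f (at x) v) S" for v
    using Ck_on_cong_open[OF assms(1) _ assms(3)[of v]] by auto
  then show ?thesis using assms(2) unfolding Ck_on.simps differentiable_def by blast
qed

lemma Ck_on_has_derivative:
  "Ck_on (Suc k) f S \<Longrightarrow> x \<in> S \<Longrightarrow> (f has_derivative frechet_derivative f (at x)) (at x)"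
  using frechet_derivative_works by auto

lemma Ck_on_const: "open S \<Longrightarrow> Ck_on k (\<lambda>x. c) S"
proof (induction k arbitrary: c)
  case (Suc k)
  show ?case by (rule Ck_on_SucI[where f'="\<lambda>x v. 0"]) (use Suc in auto)
qed auto

lemma Ck_on_linear:
  assumes "bounded_linear L" "open S" shows "Ck_on k L S"
proof (cases k)
  case 0
  then show ?thesis using assms by (simp add: linear_continuous_on)
next
  case (Suc j)
  show ?thesis unfolding Suc
    by (rule Ck_on_SucI[where f'="\<lambda>x. L"])
      (use assms Ck_on_const in \<open>auto intro: bounded_linear_imp_has_derivative\<close>)
qed

lemma Ck_on_add:
  assumes "open S" shows "Ck_on k f S \<Longrightarrow> Ck_on k g S \<Longrightarrow> Ck_on k (\<lambda>x. f x + g x) S"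
proof (induction k arbitrary: f g)
  case (Suc k)
  show ?case
    by (rule Ck_on_SucI[where f'="\<lambda>x v. frechet_derivative f (at x) v + frechet_derivative g (at x) v"])
      (use Suc assms in \<open>auto intro!: has_derivative_add Ck_on_has_derivative\<close>)
qed (auto intro: continuous_on_add)

lemma Ck_on_bilinear:
  assumes "bounded_bilinear B" "open S"
  shows "Ck_on k f S \<Longrightarrow> Ck_on k g S \<Longrightarrow> Ck_on k (\<lambda>x. B (f x) (g x)) S"
proof (induction k arbitrary: f g)
  case 0
  then show ?case using bounded_bilinear.continuous_on[OF assms(1)] by auto
next
  case (Suc k)
  show ?case
  proof (rule Ck_on_SucI[OF assms(2)])
    fix x assume "x \<in> S"
    then show "((\<lambda>x. B (f x) (g x)) has_derivative
        (\<lambda>v. B (f x) (frechet_derivative g (at x) v) + B (frechet_derivative f (at x) v) (g x))) (at x)"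
      using bounded_bilinear.FDERIV[OF assms(1)] Ck_on_has_derivative[OF Suc.prems(1)] Ck_on_has_derivative[OF Suc.prems(2)]
      by blast
  next
    fix v
    have "Ck_on k f S" "Ck_on k g S" using Suc.prems Ck_on_SucD by auto
    then show "Ck_on k (\<lambda>x. B (f x) (frechet_derivative g (at x) v) + B (frechet_derivative f (at x) v) (g x)) S"
      using Suc by (intro Ck_on_add[OF assms(2)] Suc.IH) auto
  qed
qed

lemma Ck_on_linear_compose:
  assumes "bounded_linear L" "open S"
  shows "Ck_on k f S \<Longrightarrow> Ck_on k (\<lambda>x. L (f x)) S"
proof (induction k arbitrary: f)
  case 0
  then show ?case using bounded_linear.continuous_on[OF assms(1)] by auto
next
  case (Suc k)
  show ?case
  proof (rule Ck_on_SucI[OF assms(2)])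
    show "((\<lambda>x. L (f x)) has_derivative (\<lambda>v. L (frechet_derivative f (at x) v))) (at x)" if "x \<in> S" for x
      by (rule bounded_linear.has_derivative[OF assms(1) Ck_on_has_derivative[OF Suc.prems that]])
    show "Ck_on k (\<lambda>x. L (frechet_derivative f (at x) v)) S" for v
      using Suc by simp
  qed
qed

lemma Ck_on_scaleR: 
  "open S \<Longrightarrow> Ck_on k f S \<Longrightarrow> Ck_on k g S \<Longrightarrow> Ck_on k (\<lambda>x. f x *\<^sub>R g x) S"
  by (rule Ck_on_bilinear[OF bounded_bilinear_scaleR])

lemma Ck_on_mult: 
  fixes f g :: "'a::euclidean_space \<Rightarrow> real"
  shows "open S \<Longrightarrow> Ck_on k f S \<Longrightarrow> Ck_on k g S \<Longrightarrow> Ck_on k (\<lambda>x. f x * g x) S"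
  by (rule Ck_on_bilinear[OF bounded_bilinear_mult])

lemma Ck_on_prod: 
  fixes f :: "'i \<Rightarrow> 'a::euclidean_space \<Rightarrow> real"
  assumes "finite I" "open S" "\<And>i. i \<in> I \<Longrightarrow> Ck_on k (f i) S"
  shows "Ck_on k (\<lambda>x. \<Prod>i\<in>I. f i x) S"
  using assms by (induction rule: finite_induct) (auto intro: Ck_on_const Ck_on_mult)

text \<open>The outer function has one variable, so its derivative in direction r is r times its derivative
  in direction 1. The chain rule then expresses the derivative of the composition by scalar
  multiplication and a composition of the same kind, and the induction closes.\<close>

lemma Ck_on_compose_real:
  fixes f :: "real \<Rightarrow> 'b::real_normed_vector" and q :: "'a::euclidean_space \<Rightarrow> real"
  assumes "open S"
  shows "Ck_on k f UNIV \<Longrightarrow> Ck_on k q S \<Longrightarrow> Ck_on k (\<lambda>x. f (q x)) S"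
proof (induction k arbitrary: f)
  case 0
  then show ?case by (auto intro: continuous_on_compose2)
next
  case (Suc k)
  show ?case
  proof (rule Ck_on_SucI[OF assms])
    fix x assume x: "x \<in> S"
    have D: "((\<lambda>x. f (q x)) has_derivative (\<lambda>v. frechet_derivative f (at (q x)) (frechet_derivative q (at x) v))) (at x)"
      by (rule has_derivative_compose[OF Ck_on_has_derivative[OF Suc.prems(2) x] Ck_on_has_derivative[OF Suc.prems(1)]]) simp
    have "frechet_derivative f (at t) s = s *\<^sub>R frechet_derivative f (at t) 1" for t s
      using linear_scale[OF has_derivative_linear[OF Ck_on_has_derivative[OF Suc.prems(1), of t]], of s 1] by simp
    from D[unfolded this[of _ "frechet_derivative q (at x) _"]]
    show "((\<lambda>x. f (q x)) has_derivative
       (\<lambda>v. frechet_derivative q (at x) v *\<^sub>R frechet_derivative f (at (q x)) 1)) (at x)" .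
  next
    fix v
    show "Ck_on k (\<lambda>x. frechet_derivative q (at x) v *\<^sub>R frechet_derivative f (at (q x)) 1) S"
    proof (rule Ck_on_scaleR[OF assms])
      show "Ck_on k (\<lambda>x. frechet_derivative q (at x) v) S" using Suc.prems(2) by simp
      show "Ck_on k (\<lambda>x. frechet_derivative f (at (q x)) 1) S"
        by (rule Suc.IH) (use Suc.prems(1) Ck_on_SucD[OF Suc.prems(2)] in simp_all)
    qed
  qed
qed

section \<open>Smooth cut-off functions\<close>

text \<open>The family \<open>p (1 / t) exp (- 1 / t)\<close>, extended by zero to \<open>t \<le> 0\<close>, is closed under
  differentiation when p ranges over the polynomials. Smoothness of all members follows by one
  induction.\<close>

definition flat_exp :: "real poly \<Rightarrow> real \<Rightarrow> real" where
  "flat_exp p t = (if t > 0 then poly p (1 / t) * exp (- 1 / t) else 0)"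

lemma poly_exp_decay: "((\<lambda>t::real. poly p (1/t) * exp (-1/t)) \<longlongrightarrow> 0) (at_right 0)"
proof -
  have "((\<lambda>s. poly p s * exp (- s)) \<longlongrightarrow> (0::real)) at_top"
  proof (induction p)
    case (pCons a p)
    have "((\<lambda>s. \<Sum>i\<le>degree (pCons a p). coeff (pCons a p) i * (s ^ i / exp s)) \<longlongrightarrow> (\<Sum>i\<le>degree (pCons a p). coeff (pCons a p) i * 0)) at_top"
      by (intro tendsto_intros tendsto_power_div_exp_0)
    then show ?case unfolding poly_altdef by (simp add: exp_minus field_simps sum_divide_distrib)
  qed auto
  then have "((\<lambda>t. poly p (inverse t) * exp (- inverse t)) \<longlongrightarrow> (0::real)) (at_right 0)"
    using filterlim_compose[OF _ filterlim_inverse_at_top_right] by fastforce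
  then show ?thesis by (simp add: inverse_eq_divide)
qed

lemma flat_exp_derivative:
  "(flat_exp p has_real_derivative flat_exp ([:0,0,1:] * (p - pderiv p)) t) (at t)"
proof (cases t "0::real" rule: linorder_cases)
  case less
  have "((\<lambda>_. 0) has_real_derivative 0) (at t)" by simp
  moreover have "\<forall>\<^sub>F s in nhds t. flat_exp p s = 0"
    using order_tendstoD(2)[OF tendsto_ident_at less, of UNIV] less
    unfolding eventually_nhds by (intro exI[of _ "{..<0}"]) (auto simp: flat_exp_def)
  ultimately show ?thesis using less
    by (subst DERIV_cong_ev[OF refl _ refl, where g="\<lambda>_. 0"]) (auto simp: flat_exp_def)
next
  case greater
  have "((\<lambda>t. poly p (1/t) * exp (-1/t)) has_real_derivative
      (poly (pderiv p) (1/t) * (- 1/t^2)) * exp (-1/t) + exp (-1/t) * (1/t^2) * poly p (1/t)) (at t)"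
    using greater by (auto intro!: derivative_eq_intros DERIV_chain2[OF poly_DERIV] simp: power2_eq_square)
  also have "(poly (pderiv p) (1/t) * (- 1/t^2)) * exp (-1/t) + exp (-1/t) * (1/t^2) * poly p (1/t)
    = flat_exp ([:0,0,1:] * (p - pderiv p)) t"
    using greater by (simp add: flat_exp_def field_simps power2_eq_square)
  finally have *: "((\<lambda>t. poly p (1/t) * exp (-1/t)) has_real_derivative flat_exp ([:0,0,1:] * (p - pderiv p)) t) (at t)" .
  have "\<forall>\<^sub>F s in nhds t. flat_exp p s = poly p (1/s) * exp (-1/s)"
    unfolding eventually_nhds using greater by (intro exI[of _ "{0<..}"]) (auto simp: flat_exp_def)
  then show ?thesis using * by (subst DERIV_cong_ev[OF refl _ refl]) auto
next
  case equal
  have "((\<lambda>h. flat_exp p h / h) \<longlongrightarrow> 0) (at 0)"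
    unfolding filterlim_at_split
  proof
    show "((\<lambda>h. flat_exp p h / h) \<longlongrightarrow> 0) (at_left 0)"
      by (rule tendsto_eventually) (auto simp: flat_exp_def eventually_at_filter)
    have "((\<lambda>t::real. poly (pCons 0 p) (1/t) * exp (-1/t)) \<longlongrightarrow> 0) (at_right 0)"
      by (rule poly_exp_decay)
    moreover have "\<forall>\<^sub>F h in at_right 0. poly (pCons 0 p) (1/h) * exp (-1/h) = flat_exp p h / h"
      by (auto simp: flat_exp_def eventually_at_filter)
    ultimately show "((\<lambda>h. flat_exp p h / h) \<longlongrightarrow> 0) (at_right 0)"
      by (rule Lim_transform_eventually)
  qed
  then show ?thesis using equal by (simp add: DERIV_def flat_exp_def)
qed

lemma Ck_on_flat_exp: "Ck_on k (flat_exp p) UNIV"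
proof (induction k arbitrary: p)
  case 0
  show ?case using DERIV_isCont[OF flat_exp_derivative] by (auto simp: continuous_on_eq_continuous_at)
next
  case (Suc k)
  show ?case
  proof (rule Ck_on_SucI)
    show "(flat_exp p has_derivative (\<lambda>v. v * flat_exp ([:0,0,1:] * (p - pderiv p)) t)) (at t)" for t
      using flat_exp_derivative[of p t] by (simp add: has_field_derivative_def mult_commute_abs)
    show "Ck_on k (\<lambda>x. v * flat_exp ([:0, 0, 1:] * (p - pderiv p)) x) UNIV" for v
      by (intro Ck_on_mult Ck_on_const Suc.IH) auto
  qed auto
qed

definition smooth_ramp :: "real \<Rightarrow> real" where "smooth_ramp = flat_exp 1"

lemma smooth_ramp:
  "Ck_on k smooth_ramp UNIV" "t \<le> 0 \<Longrightarrow> smooth_ramp t = 0" "t > 0 \<Longrightarrow> smooth_ramp t = exp (-1/t)"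
  "0 \<le> smooth_ramp t" "smooth_ramp t \<le> 1"
  unfolding smooth_ramp_def by (auto simp: Ck_on_flat_exp flat_exp_def)

text \<open>The ramp vanishes on \<open>t \<le> 0\<close> and is increasing. For \<open>t \<ge> 1\<close> the inner ramp is zero, so the value is
  constant; for \<open>t \<le> 0\<close> the inner ramp is at least \<open>exp (- 1)\<close>, so the outer argument is not positive.
  This obtains a smooth function with both plateaus by composition alone.\<close>

definition smooth_step :: "real \<Rightarrow> real" where
  "smooth_step t = smooth_ramp (exp (-1) - smooth_ramp (1 - t)) / smooth_ramp (exp (-1))"

lemma smooth_ramp_mono: "s \<le> t \<Longrightarrow> smooth_ramp s \<le> smooth_ramp t"
  by (cases "s \<le> 0") (auto simp: smooth_ramp frac_le)

lemma smooth_step: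
  "Ck_on k smooth_step UNIV" "t \<le> 0 \<Longrightarrow> smooth_step t = 0" "t \<ge> 1 \<Longrightarrow> smooth_step t = 1"
proof -
  have "Ck_on k (\<lambda>t::real. 1 + (-1) * t) UNIV"
    by (rule Ck_on_add[where f="\<lambda>t. 1" and g="(*) (-1)", OF open_UNIV Ck_on_const[OF open_UNIV]
          Ck_on_linear[OF bounded_linear_mult_right open_UNIV]])
  then have "Ck_on k (\<lambda>t. exp (-1) + (-1) * smooth_ramp (1 + (-1) * t)) UNIV"
    by (intro Ck_on_add Ck_on_mult Ck_on_const) (auto intro: Ck_on_compose_real smooth_ramp)
  then have "Ck_on k (\<lambda>t. (1 / smooth_ramp (exp (-1))) * smooth_ramp (exp (-1) + (-1) * smooth_ramp (1 + (-1) * t))) UNIV"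
    by (intro Ck_on_mult Ck_on_const) (auto intro: Ck_on_compose_real smooth_ramp)
  then show "Ck_on k smooth_step UNIV" by (simp add: smooth_step_def[abs_def])
  show "smooth_step t = 0" if "t \<le> 0"
    using smooth_ramp_mono[of 1 "1-t"] that smooth_ramp(3)[of 1] by (simp add: smooth_step_def smooth_ramp)
  show "smooth_step t = 1" if "t \<ge> 1"
    using that by (simp add: smooth_step_def smooth_ramp)
qed

lemma smooth_cutoff:
  fixes c :: "'a::euclidean_space"
  assumes "0 < r" "r < R"
  obtains \<beta> :: "'a \<Rightarrow> real" where "\<And>k. Ck_on k \<beta> UNIV" "\<And>x. x \<in> cball c r \<Longrightarrow> \<beta> x = 1" "\<And>x. x \<notin> ball c R \<Longrightarrow> \<beta> x = 0"
proof
  define q where "q x = (1/(R\<^sup>2 - r\<^sup>2)) * (R\<^sup>2 + (-1) * ((x + - c) \<bullet> (x + - c)))" for x :: 'a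
  have pos: "R\<^sup>2 - r\<^sup>2 > 0" using assms by (simp add: power_strict_mono)
  have "Ck_on k (\<lambda>x. x + - c) UNIV" for k
    by (rule Ck_on_add[where f="\<lambda>x. x" and g="\<lambda>x. - c", OF open_UNIV
          Ck_on_linear[OF bounded_linear_ident open_UNIV] Ck_on_const[OF open_UNIV]])
  then have "Ck_on k (\<lambda>x. (x + - c) \<bullet> (x + - c)) UNIV" for k
    by (rule Ck_on_bilinear[OF bounded_bilinear_inner open_UNIV]) fact
  then have "Ck_on k q UNIV" for k
    unfolding q_def by (intro Ck_on_mult Ck_on_add Ck_on_const) auto
  then show "Ck_on k (\<lambda>x. smooth_step (q x)) UNIV" for k
    by (rule Ck_on_compose_real[OF open_UNIV smooth_step(1)])
  have n: "(x + - c) \<bullet> (x + - c) = (dist c x)\<^sup>2" for x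
    by (metis (no_types) add_uminus_conv_diff dist_commute dist_norm power2_norm_eq_inner)
  show "smooth_step (q x) = 1" if "x \<in> cball c r" for x
  proof (rule smooth_step(3))
    have "(dist c x)\<^sup>2 \<le> r\<^sup>2" using that by (auto intro: power_mono)
    then show "1 \<le> q x" using pos unfolding q_def n by (simp add: field_simps)
  qed
  show "smooth_step (q x) = 0" if "x \<notin> ball c R" for x
  proof (rule smooth_step(2))
    have "R\<^sup>2 \<le> (dist c x)\<^sup>2" using that assms by (intro power_mono) auto
    then show "q x \<le> 0" using pos unfolding q_def n by (simp add: field_simps)
  qed
qed

section \<open>Test functions\<close>

lemma test_functionsI:
  assumes "\<And>k. Ck_on k \<zeta> UNIV" "compact K" "K \<subseteq> \<Omega>" "\<And>x. x \<notin> K \<Longrightarrow> \<zeta> x = 0"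
  shows "\<zeta> \<in> test_functions \<Omega>"
  using assms unfolding test_functions_def by blast

lemma test_functions_smooth: "\<zeta> \<in> test_functions \<Omega> \<Longrightarrow> Ck_on k \<zeta> UNIV"
  unfolding test_functions_def by blast

lemma test_functions_mono: "\<zeta> \<in> test_functions \<Omega> \<Longrightarrow> \<Omega> \<subseteq> \<Omega>' \<Longrightarrow> \<zeta> \<in> test_functions \<Omega>'"
  unfolding test_functions_def by blast

lemma test_functions_smooth_scaleR:
  assumes "\<And>k. Ck_on k \<beta> UNIV" "\<zeta> \<in> test_functions \<Omega>"
  shows "(\<lambda>x. \<beta> x *\<^sub>R \<zeta> x) \<in> test_functions \<Omega>"
proof -
  obtain K where "compact K" "K \<subseteq> \<Omega>" "\<And>x. x \<notin> K \<Longrightarrow> \<zeta> x = 0" 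
    using assms(2) unfolding test_functions_def by blast
  then show ?thesis using assms
    by (intro test_functionsI[where K=K] Ck_on_scaleR) (auto intro: test_functions_smooth)
qed

lemma test_functions_scaleR_smooth:
  assumes "\<beta> \<in> test_functions \<Omega>" "\<And>k. Ck_on k \<zeta> UNIV"
  shows "(\<lambda>x. \<beta> x *\<^sub>R \<zeta> x) \<in> test_functions \<Omega>"
proof -
  obtain K where "compact K" "K \<subseteq> \<Omega>" "\<And>x. x \<notin> K \<Longrightarrow> \<beta> x = 0" 
    using assms(1) unfolding test_functions_def by blast
  then show ?thesis using assms
    by (intro test_functionsI[where K=K] Ck_on_scaleR) (auto intro: test_functions_smooth)
qed

lemma test_functions_linear:
  assumes "bounded_linear L" "\<zeta> \<in> test_functions \<Omega>"
  shows "(\<lambda>x. L (\<zeta> x)) \<in> test_functions \<Omega>"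
proof -
  obtain K where "compact K" "K \<subseteq> \<Omega>" "\<And>x. x \<notin> K \<Longrightarrow> \<zeta> x = 0" 
    using assms(2) unfolding test_functions_def by blast
  then show ?thesis using linear_0[OF bounded_linear.linear[OF assms(1)]]
      Ck_on_linear_compose[OF assms(1) open_UNIV test_functions_smooth[OF assms(2)]]
    by (intro test_functionsI[where K=K]) simp_all
qed

lemma test_functions_has_derivative:
  "\<zeta> \<in> test_functions \<Omega> \<Longrightarrow> (\<zeta> has_derivative frechet_derivative \<zeta> (at x)) (at x)"
  using Ck_on_has_derivative[OF test_functions_smooth] by blast

lemma partial_deriv_eqI: "(f has_derivative f') (at x) \<Longrightarrow> partial_deriv i f x = f' (axis i 1)"
  unfolding partial_deriv_def using frechet_derivative_at by metis

lemma frechet_derivative_off_support: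
  assumes "compact K" "\<And>x. x \<notin> K \<Longrightarrow> \<zeta> x = 0" "x \<notin> K"
  shows "frechet_derivative \<zeta> (at x) v = 0"
proof -
  have "(\<zeta> has_derivative (\<lambda>v. 0)) (at x)"
    by (rule has_derivative_transform_within_open[OF has_derivative_const[of 0], of "- K"])
      (use assms compact_imp_closed in \<open>auto simp: open_Compl\<close>)
  then show ?thesis using frechet_derivative_at by metis
qed

lemma test_functions_partial_deriv:
  assumes "\<zeta> \<in> test_functions \<Omega>" shows "partial_deriv i \<zeta> \<in> test_functions \<Omega>"
proof -
  obtain K where "compact K" "K \<subseteq> \<Omega>" "\<And>x. x \<notin> K \<Longrightarrow> \<zeta> x = 0" 
    using assms unfolding test_functions_def by blast
  moreover have "Ck_on k (partial_deriv i \<zeta>) UNIV" for k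
    using test_functions_smooth[OF assms, of "Suc k"] unfolding partial_deriv_def[abs_def] by simp
  ultimately show ?thesis
    by (intro test_functionsI[where K=K]) (auto simp: partial_deriv_def frechet_derivative_off_support)
qed

lemma test_functions_continuous: "\<zeta> \<in> test_functions \<Omega> \<Longrightarrow> continuous_on S \<zeta>"
  using test_functions_smooth[of \<zeta> \<Omega> 0] continuous_on_subset by auto

lemma test_functions_bounded:
  assumes "\<zeta> \<in> test_functions \<Omega>" obtains B where "B > 0" "\<And>x. norm (\<zeta> x) \<le> B"
proof -
  obtain K where K: "compact K" "\<And>x. x \<notin> K \<Longrightarrow> \<zeta> x = 0" 
    using assms unfolding test_functions_def by blast
  have "bounded (\<zeta> ` K)"
    by (intro compact_imp_bounded compact_continuous_image test_functions_continuous[OF assms] K(1))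
  then obtain B where "B > 0" "\<And>x. x \<in> K \<Longrightarrow> norm (\<zeta> x) \<le> B"
    by (metis bounded_pos imageI)
  then show ?thesis using that[of B] K(2) by (metis less_imp_le norm_zero)
qed

lemma test_functions_measurable [measurable (raw)]:
  fixes \<zeta> :: "real^'n \<Rightarrow> 'b::euclidean_space"
  shows "\<zeta> \<in> test_functions \<Omega> \<Longrightarrow> \<zeta> \<in> borel_measurable borel"
  by (intro borel_measurable_continuous_onI test_functions_continuous)

lemma borel_measurable_lebesgue: "f \<in> borel_measurable borel \<Longrightarrow> f \<in> borel_measurable lebesgue"
  by (simp add: measurable_completion)

lemma partial_deriv_scaleR:
  assumes "Ck_on 1 \<beta> UNIV" "Ck_on 1 \<zeta> UNIV"
  shows "partial_deriv i (\<lambda>x. \<beta> x *\<^sub>R \<zeta> x) x = \<beta> x *\<^sub>R partial_deriv i \<zeta> x + partial_deriv i \<beta> x *\<^sub>R \<zeta> x"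
proof -
  have "((\<lambda>x. \<beta> x *\<^sub>R \<zeta> x) has_derivative 
     (\<lambda>v. \<beta> x *\<^sub>R frechet_derivative \<zeta> (at x) v + frechet_derivative \<beta> (at x) v *\<^sub>R \<zeta> x)) (at x)"
    using assms by (intro has_derivative_scaleR Ck_on_has_derivative[where S=UNIV and k=0]) simp_all
  from partial_deriv_eqI[OF this] show ?thesis by (simp add: partial_deriv_def)
qed

section \<open>The fundamental lemma of the calculus of variations\<close>

lemma integral_lebesgue_on_eq:
  fixes f :: "'a::euclidean_space \<Rightarrow> 'b::euclidean_space"
  assumes "S \<in> sets lebesgue" "\<And>x. x \<notin> S \<Longrightarrow> f x = 0"
  shows "integral\<^sup>L (lebesgue_on S) f = integral\<^sup>L lebesgue f"
    and "integrable (lebesgue_on S) f \<longleftrightarrow> integrable lebesgue f"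
proof -
  have "(\<lambda>x. indicator S x *\<^sub>R f x) = f" using assms(2) by (auto simp: indicator_def)
  then show "integral\<^sup>L (lebesgue_on S) f = integral\<^sup>L lebesgue f"
    and "integrable (lebesgue_on S) f \<longleftrightarrow> integrable lebesgue f"
    using assms(1) by (simp_all add: integral_restrict_space integrable_restrict_space)
qed

lemma locally_integrable_subset: "u locally_integrable_on \<Omega> \<Longrightarrow> \<Omega>' \<subseteq> \<Omega> \<Longrightarrow> u locally_integrable_on \<Omega>'"
  unfolding locally_integrable_on_def by blast

lemma integrable_bilinear_compact_support:
  fixes \<phi> :: "'a::euclidean_space \<Rightarrow> 'b::euclidean_space" and u :: "'a \<Rightarrow> 'c::euclidean_space"
    and h :: "'b \<Rightarrow> 'c \<Rightarrow> 'd::euclidean_space"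
  assumes h: "bounded_bilinear h" and \<phi>: "continuous_on UNIV \<phi>" "\<And>x. x \<notin> K \<Longrightarrow> \<phi> x = 0"
    and K: "compact K" and u: "integrable (lebesgue_on K) u"
  shows "integrable lebesgue (\<lambda>x. h (\<phi> x) (u x))"
proof -
  have KL: "K \<in> sets lebesgue" using K by (simp add: lmeasurable_compact fmeasurableD)
  have "\<phi> \<in> borel_measurable (lebesgue_on K)"
    using \<phi>(1) borel_measurable_continuous_onI borel_measurable_lebesgue measurable_restrict_space1 by blast
  moreover have "bounded (\<phi> ` K)"
    by (intro compact_imp_bounded compact_continuous_image K continuous_on_subset[OF \<phi>(1)]) simp
  moreover have "u absolutely_integrable_on K"
    using u KL by (simp add: set_integrable_def integrable_restrict_space)
  ultimately have "(\<lambda>x. h (\<phi> x) (u x)) absolutely_integrable_on K"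
    by (rule absolutely_integrable_bounded_measurable_product[of h, OF h[folded bilinear_conv_bounded_bilinear] _ KL])
  then have "integrable (lebesgue_on K) (\<lambda>x. h (\<phi> x) (u x))"
    using KL by (simp add: set_integrable_def integrable_restrict_space)
  then show ?thesis
    using integral_lebesgue_on_eq(2)[OF KL, of "\<lambda>x. h (\<phi> x) (u x)"] \<phi>(2) bounded_bilinear.zero_left[OF h] by simp
qed

lemma integrable_bilinear_test:
  fixes \<phi> :: "real^'n \<Rightarrow> 'b::euclidean_space" and u :: "real^'n \<Rightarrow> 'c::euclidean_space"
    and h :: "'b \<Rightarrow> 'c \<Rightarrow> 'd::euclidean_space"
  assumes "bounded_bilinear h" "\<phi> \<in> test_functions \<Omega>" "u locally_integrable_on \<Omega>"
  shows "integrable lebesgue (\<lambda>x. h (\<phi> x) (u x))"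
proof -
  obtain K where "compact K" "K \<subseteq> \<Omega>" "\<And>x. x \<notin> K \<Longrightarrow> \<phi> x = 0" 
    using assms(2) unfolding test_functions_def by blast
  then show ?thesis
    using assms by (intro integrable_bilinear_compact_support[where K=K])
      (auto simp: locally_integrable_on_def intro: test_functions_continuous)
qed

lemmas integrable_test_scaleR = integrable_bilinear_test[OF bounded_bilinear_scaleR]

text \<open>Products of ramps in the coordinates, steepened by the factor m, increase to the indicator of the
  open box, since \<open>exp (- 1 / (m t))\<close> tends to 1 for \<open>t > 0\<close>.\<close>

lemma box_approx_test:
  fixes a b :: "real^'n"
  obtains \<phi> :: "nat \<Rightarrow> real^'n \<Rightarrow> real" where "\<And>m \<Omega>. cbox a b \<subseteq> \<Omega> \<Longrightarrow> \<phi> m \<in> test_functions \<Omega>"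
    "\<And>m x. 0 \<le> \<phi> m x" "\<And>m x. \<phi> m x \<le> 1" "\<And>m x. x \<notin> cbox a b \<Longrightarrow> \<phi> m x = 0" 
    "\<And>x. (\<lambda>m. \<phi> m x) \<longlonglongrightarrow> indicator (box a b) x"
proof
  define \<phi> where "\<phi> m x = (\<Prod>i\<in>Basis. smooth_ramp (real m * (x \<bullet> i + - (a \<bullet> i))) * smooth_ramp (real m * (b \<bullet> i + (-1) * (x \<bullet> i))))"
    for m and x :: "real^'n"
  have lin: "Ck_on k (\<lambda>x. x \<bullet> i) UNIV" for k and i :: "real^'n"
    by (intro Ck_on_linear bounded_linear_inner_left) auto
  have "Ck_on k (\<lambda>x. smooth_ramp (real m * (x \<bullet> i + - (a \<bullet> i)))) UNIV" 
    "Ck_on k (\<lambda>x. smooth_ramp (real m * (b \<bullet> i + (-1) * (x \<bullet> i)))) UNIV" for k m and i :: "real^'n"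
    by (rule Ck_on_compose_real[OF open_UNIV smooth_ramp(1)], 
        (rule Ck_on_mult Ck_on_add lin Ck_on_const open_UNIV)+)+
  then have sm: "Ck_on k (\<phi> m) UNIV" for k m
    unfolding \<phi>_def by (intro Ck_on_prod Ck_on_mult) auto
  show off: "\<phi> m x = 0" if x: "x \<notin> cbox a b" for m x
  proof -
    obtain i where i: "i \<in> Basis" "x \<bullet> i < a \<bullet> i \<or> b \<bullet> i < x \<bullet> i"
      using x by (force simp: mem_box not_le)
    then have "real m * (x \<bullet> i + - (a \<bullet> i)) \<le> 0 \<or> real m * (b \<bullet> i + (-1) * (x \<bullet> i)) \<le> 0"
      by (auto simp: mult_le_0_iff)
    then show ?thesis unfolding \<phi>_def using i(1) smooth_ramp(2)
      by (intro prod_zero) (auto intro!: bexI[of _ i])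
  qed
  show "\<phi> m \<in> test_functions \<Omega>" if "cbox a b \<subseteq> \<Omega>" for m \<Omega>
    by (rule test_functionsI[OF sm compact_cbox that off])
  show "0 \<le> \<phi> m x" for m x unfolding \<phi>_def by (intro prod_nonneg ballI mult_nonneg_nonneg smooth_ramp)
  show "\<phi> m x \<le> 1" for m x unfolding \<phi>_def
    by (intro prod_le_1 conjI mult_nonneg_nonneg mult_le_one smooth_ramp)
  show "(\<lambda>m. \<phi> m x) \<longlonglongrightarrow> indicator (box a b) x" for x
  proof (cases "x \<in> box a b")
    case True
    have lim: "(\<lambda>m. smooth_ramp (real m * t)) \<longlonglongrightarrow> 1" if "t > 0" for t
    proof -
      have "(\<lambda>m. exp (-1 / (real m * t))) \<longlonglongrightarrow> 1"
      proof -
        have "(\<lambda>m. exp (-1 / (t * real m))) \<longlonglongrightarrow> exp 0"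
          using that by (intro tendsto_exp real_tendsto_divide_at_top[OF tendsto_const]
              filterlim_tendsto_pos_mult_at_top[OF tendsto_const _ filterlim_real_sequentially])
        then show ?thesis by (simp add: mult.commute)
      qed
      moreover have "\<forall>\<^sub>F m in sequentially. exp (-1 / (real m * t)) = smooth_ramp (real m * t)"
        using eventually_gt_at_top[of 0] by eventually_elim (use that in \<open>simp add: smooth_ramp\<close>)
      ultimately show ?thesis by (rule Lim_transform_eventually)
    qed
    have "(\<lambda>m. \<phi> m x) \<longlonglongrightarrow> (\<Prod>i\<in>(Basis::(real^'n) set). 1 * 1)"
      unfolding \<phi>_def using True by (intro tendsto_prod tendsto_mult lim) (auto simp: mem_box)
    then show ?thesis using True by simp
  next
    case False
    then obtain i where i: "i \<in> Basis" "x \<bullet> i \<le> a \<bullet> i \<or> b \<bullet> i \<le> x \<bullet> i"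
      by (auto simp: mem_box not_less)
    then have "real m * (x \<bullet> i + - (a \<bullet> i)) \<le> 0 \<or> real m * (b \<bullet> i + (-1) * (x \<bullet> i)) \<le> 0" for m
      by (auto simp: mult_le_0_iff)
    then have "\<phi> m x = 0" for m unfolding \<phi>_def using i(1) smooth_ramp(2)
      by (intro prod_zero) (auto intro!: bexI[of _ i])
    then show ?thesis using False by simp
  qed
qed

lemma integral_box_eq_0:
  fixes W :: "real^'n \<Rightarrow> 'b::euclidean_space"
  assumes "W locally_integrable_on \<Omega>"
    and "\<And>\<phi>::real^'n \<Rightarrow> real. \<phi> \<in> test_functions \<Omega> \<Longrightarrow> (LINT x|lebesgue. \<phi> x *\<^sub>R W x) = 0"
    and "cbox a b \<subseteq> \<Omega>"
  shows "integral (cbox a b) W = 0"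
proof -
  obtain \<phi> :: "nat \<Rightarrow> real^'n \<Rightarrow> real" where \<phi>: "\<And>m \<Omega>. cbox a b \<subseteq> \<Omega> \<Longrightarrow> \<phi> m \<in> test_functions \<Omega>"
    "\<And>m x. 0 \<le> \<phi> m x" "\<And>m x. \<phi> m x \<le> 1" "\<And>m x. x \<notin> cbox a b \<Longrightarrow> \<phi> m x = 0" 
    "\<And>x. (\<lambda>m. \<phi> m x) \<longlonglongrightarrow> indicator (box a b) x"
    using box_approx_test[of a b] by metis
  have int: "integrable (lebesgue_on (cbox a b)) W"
    using assms(1,3) by (auto simp: locally_integrable_on_def)
  then have absW: "integrable lebesgue (\<lambda>x. indicator (cbox a b) x *\<^sub>R W x)"
    by (simp add: integrable_restrict_space)
  have sb: "integrable lebesgue (\<lambda>x. indicator (box a b) x *\<^sub>R W x)"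
  proof -
    have "integrable lebesgue (\<lambda>x. indicator (box a b) x *\<^sub>R (indicator (cbox a b) x *\<^sub>R W x))"
      by (rule integrable_mult_indicator[OF _ absW]) auto
    then show ?thesis using box_subset_cbox[of a b]
      by (elim Bochner_Integration.integrable_cong[THEN iffD1, rotated 2]) (auto simp: indicator_def)
  qed
  have "(\<lambda>m. LINT x|lebesgue. \<phi> m x *\<^sub>R W x) \<longlonglongrightarrow> (LINT x|lebesgue. indicator (box a b) x *\<^sub>R W x)"
  proof (rule integral_dominated_convergence)
    show "integrable lebesgue (\<lambda>x. norm (indicator (cbox a b) x *\<^sub>R W x))" using integrable_norm[OF absW] .
    show "(\<lambda>x. indicat_real (box a b) x *\<^sub>R W x) \<in> borel_measurable lebesgue" using sb by (rule borel_measurable_integrable)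
    show "(\<lambda>x. \<phi> m x *\<^sub>R W x) \<in> borel_measurable lebesgue" for m
      using integrable_test_scaleR[OF \<phi>(1)[OF assms(3)] assms(1)] by (rule borel_measurable_integrable)
    show "AE x in lebesgue. (\<lambda>m. \<phi> m x *\<^sub>R W x) \<longlonglongrightarrow> indicat_real (box a b) x *\<^sub>R W x"
      by (intro AE_I2 tendsto_scaleR \<phi>(5) tendsto_const)
    show "AE x in lebesgue. norm (\<phi> m x *\<^sub>R W x) \<le> norm (indicat_real (cbox a b) x *\<^sub>R W x)" for m
      by (intro AE_I2) (use \<phi>(2-4) in \<open>auto simp: indicator_def mult_left_le_one_le\<close>)
  qed
  moreover have "(LINT x|lebesgue. \<phi> m x *\<^sub>R W x) = 0" for m
    using assms(2) \<phi>(1)[OF assms(3)] by blast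
  ultimately have "(LINT x|lebesgue. indicator (box a b) x *\<^sub>R W x) = 0"
    by (simp add: LIMSEQ_const_iff)
  then have "integral\<^sup>L (lebesgue_on (box a b)) W = 0"
    by (simp add: integral_restrict_space)
  moreover have "integrable (lebesgue_on (box a b)) W"
    using sb by (simp add: integrable_restrict_space)
  ultimately have "integral (box a b) W = 0"
    using lebesgue_integral_eq_integral[of "box a b" W] by simp
  then show ?thesis by (simp add: integral_open_interval)
qed

text \<open>The integrals over all boxes inside the open set vanish by approximation with test functions.
  At almost every point the function is the limit of its averages over small cubes, hence zero. An
  exhaustion by compact sets reduces to integrable functions.\<close>

lemma fundamental_lemma:
  fixes W :: "real^'n \<Rightarrow> 'b::euclidean_space"
  assumes "open \<Omega>" "W locally_integrable_on \<Omega>"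
    and "\<And>\<phi>::real^'n \<Rightarrow> real. \<phi> \<in> test_functions \<Omega> \<Longrightarrow> (LINT x|lebesgue. \<phi> x *\<^sub>R W x) = 0"
  shows "AE x in lebesgue. x \<in> \<Omega> \<longrightarrow> W x = 0"
proof -
  obtain C where C: "\<And>n::nat. compact (C n)" "\<And>n. C n \<subseteq> \<Omega>" "\<And>n. C n \<subseteq> interior (C (Suc n))" "(\<Union>n. C n) = \<Omega>"
    using open_Union_compact_subsets[OF assms(1)] by (metis (no_types))
  have "AE x in lebesgue. x \<in> C n \<longrightarrow> W x = 0" for n
  proof -
    define f where "f x = indicator (C (Suc n)) x *\<^sub>R W x" for x
    have CL: "C (Suc n) \<in> sets lebesgue" using C(1) by (simp add: lmeasurable_compact fmeasurableD)
    have "integrable lebesgue f"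
      using assms(2) C(1,2) CL unfolding f_def locally_integrable_on_def by (simp flip: integrable_restrict_space)
    then have "f integrable_on UNIV"
      using integrable_on_lebesgue by blast
    then have fi: "f integrable_on cbox a b" for a b
      using integrable_on_subcbox by blast
    obtain N where N: "negligible N" "\<And>x e. \<lbrakk>x \<notin> N; 0 < e\<rbrakk> \<Longrightarrow>
               \<exists>d>0. \<forall>h. 0 < h \<and> h < d \<longrightarrow>
                 norm(integral (cbox x (x + h *\<^sub>R One)) f /\<^sub>R h ^ DIM(real^'n) - f x) < e"
      using integrable_ccontinuous_explicit[OF fi] by blast
    have "W x = 0" if x: "x \<in> C n" "x \<notin> N" for x
    proof (rule ccontr)
      assume W: "W x \<noteq> 0"
      have fx: "f x = W x" using x C(3) interior_subset by (force simp: f_def)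
      obtain d where d: "d > 0" "\<And>h. 0 < h \<and> h < d \<Longrightarrow>
          norm(integral (cbox x (x + h *\<^sub>R One)) f /\<^sub>R h ^ DIM(real^'n) - f x) < norm (W x)"
        using N(2)[OF x(2), of "norm (W x)"] W by (meson zero_less_norm_iff)
      obtain e where e: "e > 0" "ball x e \<subseteq> C (Suc n)"
        using x C(3) by (meson interior_subset open_contains_ball open_interior subset_iff subset_trans)
      define h where "h = min (d/2) (e / (2 * (norm (One::real^'n) + 1)))"
      have no: "norm (One::real^'n) + 1 > 0" by (simp add: add_nonneg_pos)
      have h: "0 < h" "h < d" using d(1) e(1) no by (auto simp: h_def)
      have sub: "cbox x (x + h *\<^sub>R One) \<subseteq> C (Suc n)"
      proof
        fix y assume y: "y \<in> cbox x (x + h *\<^sub>R One)"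
        then have "norm (y - x) \<le> norm (h *\<^sub>R One :: real^'n)"
          by (intro norm_le_componentwise) (auto simp: mem_box inner_diff_left inner_add_left algebra_simps)
        also have "\<dots> = h * norm (One::real^'n)" using h by simp
        also have "\<dots> < h * (norm (One::real^'n) + 1)" using h by simp
        also have "\<dots> \<le> (e / (2 * (norm (One::real^'n) + 1))) * (norm (One::real^'n) + 1)"
          using no by (intro mult_right_mono) (auto simp: h_def)
        also have "\<dots> = e / 2"
          using no by (metis mult.commute nonzero_mult_divide_mult_cancel_right times_divide_eq_left less_irrefl)
        also have "\<dots> < e" using e(1) by simp
        finally show "y \<in> C (Suc n)" using e(2) by (auto simp: dist_norm norm_minus_commute)
      qed
      have "integral (cbox x (x + h *\<^sub>R One)) f = integral (cbox x (x + h *\<^sub>R One)) W"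
        by (rule integral_cong) (use sub in \<open>auto simp: f_def\<close>)
      also have "\<dots> = 0"
        using sub C(2) by (intro integral_box_eq_0[OF assms(2,3)]) auto
      finally show False using d(2)[of h] h fx by simp
    qed
    then show ?thesis
      using N(1) by (intro AE_I'[of N]) (auto simp: negligible_iff_null_sets)
  qed
  then have "AE x in lebesgue. \<forall>n. x \<in> C n \<longrightarrow> W x = 0" unfolding AE_all_countable by blast
  then show ?thesis by eventually_elim (use C(4) in blast)
qed

section \<open>Translation invariance of Lebesgue measure\<close>

lemma lebesgue_translation_measurable: "(+) a \<in> lebesgue \<rightarrow>\<^sub>M lebesgue"
  and distr_lebesgue_translation: "distr lebesgue lebesgue ((+) a) = lebesgue"
proof -
  have T: "(\<lambda>x. a + (\<Sum>j\<in>Basis. (1 * (x \<bullet> j)) *\<^sub>R j)) = (+) a"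
    by (auto simp: euclidean_representation)
  show "(+) a \<in> lebesgue \<rightarrow>\<^sub>M lebesgue"
    using lebesgue_affine_measurable[of "\<lambda>_. 1" a] unfolding T by simp
  show "distr lebesgue lebesgue ((+) a) = lebesgue"
    using lebesgue_affine_euclidean[of "\<lambda>_. 1" a] unfolding T by (simp add: density_1)
qed

lemma lebesgue_translation:
  fixes f :: "'a::euclidean_space \<Rightarrow> 'b::{banach,second_countable_topology}"
  assumes "integrable lebesgue f"
  shows integrable_translation: "integrable lebesgue (\<lambda>x. f (a + x))"
    and integral_translation: "(LINT x|lebesgue. f (a + x)) = integral\<^sup>L lebesgue f"
proof -
  show "integrable lebesgue (\<lambda>x. f (a + x))"
    by (rule integrable_distr[OF lebesgue_translation_measurable])
      (simp add: distr_lebesgue_translation assms)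
  show "(LINT x|lebesgue. f (a + x)) = integral\<^sup>L lebesgue f"
    using integral_distr[OF lebesgue_translation_measurable[of a], of f] assms
    by (simp add: distr_lebesgue_translation)
qed

lemma AE_lebesgue_translation:
  "AE x in lebesgue. P x \<Longrightarrow> AE x in lebesgue. P (a + x)"
  using AE_distrD[OF lebesgue_translation_measurable[of a], of P] unfolding distr_lebesgue_translation by blast

section \<open>Weak partial derivatives\<close>

lemma integrable_lebesgue_AE_cong:
  fixes f g :: "'a::euclidean_space \<Rightarrow> 'b::euclidean_space"
  assumes "integrable lebesgue f" "AE x in lebesgue. f x = g x"
  shows "integrable lebesgue g" "integral\<^sup>L lebesgue g = integral\<^sup>L lebesgue f"
proof -
  have m: "f \<in> borel_measurable lebesgue" "g \<in> borel_measurable lebesgue"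
    using borel_measurable_AE[OF _ assms(2)] assms(1) by (auto dest: borel_measurable_integrable)
  show "integrable lebesgue g" using integrable_cong_AE[OF m assms(2)] assms(1) by simp
  show "integral\<^sup>L lebesgue g = integral\<^sup>L lebesgue f" using integral_cong_AE[OF m assms(2)] by simp
qed

lemma sets_lebesgue_compact: "compact K \<Longrightarrow> K \<in> sets lebesgue"
  by (simp add: lmeasurable_compact fmeasurableD)

lemma sets_lebesgue_open: "open U \<Longrightarrow> U \<in> sets lebesgue"
  by (simp add: borel_open)

lemma locally_integrable_on_indicator:
  "u locally_integrable_on \<Omega> \<longleftrightarrow> (\<forall>K. compact K \<and> K \<subseteq> \<Omega> \<longrightarrow> integrable lebesgue (\<lambda>x. indicator K x *\<^sub>R u x))"
  unfolding locally_integrable_on_def by (simp add: integrable_restrict_space sets_lebesgue_compact)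

lemma locally_integrable_on_AE_cong:
  assumes "u locally_integrable_on \<Omega>" "AE x in lebesgue. x \<in> \<Omega> \<longrightarrow> u x = v x"
  shows "v locally_integrable_on \<Omega>"
  unfolding locally_integrable_on_indicator
proof (intro allI impI, elim conjE)
  fix K assume "compact K" "K \<subseteq> \<Omega>"
  then have "integrable lebesgue (\<lambda>x. indicator K x *\<^sub>R u x)"
    using assms(1) by (simp add: locally_integrable_on_indicator)
  moreover have "AE x in lebesgue. indicator K x *\<^sub>R u x = indicator K x *\<^sub>R v x"
    using assms(2) by eventually_elim (use \<open>K \<subseteq> \<Omega>\<close> in \<open>auto simp: indicator_def\<close>)
  ultimately show "integrable lebesgue (\<lambda>x. indicator K x *\<^sub>R v x)"
    by (rule integrable_lebesgue_AE_cong)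
qed

lemma integrable_imp_locally_integrable:
  "integrable lebesgue u \<Longrightarrow> u locally_integrable_on \<Omega>"
  unfolding locally_integrable_on_indicator
  by (auto intro!: integrable_mult_indicator sets_lebesgue_compact)

lemma continuous_imp_locally_integrable: 
  fixes f :: "real^'n \<Rightarrow> 'b::euclidean_space"
  assumes "continuous_on UNIV f" shows "f locally_integrable_on \<Omega>"
  unfolding locally_integrable_on_indicator
proof (intro allI impI, elim conjE)
  fix K :: "(real^'n) set" assume "compact K"
  then have "integrable lborel (\<lambda>x. indicator K x *\<^sub>R f x)"
    by (intro borel_integrable_compact continuous_on_subset[OF assms]) auto
  then show "integrable lebesgue (\<lambda>x. indicator K x *\<^sub>R f x)"
    using integrable_completion borel_measurable_integrable by metis
qed

lemma locally_integrable_on_add: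
  "u locally_integrable_on \<Omega> \<Longrightarrow> v locally_integrable_on \<Omega> \<Longrightarrow> (\<lambda>x. u x + v x) locally_integrable_on \<Omega>"
  unfolding locally_integrable_on_def by auto

lemma locally_integrable_on_scaleR:
  fixes \<beta> :: "real^'n \<Rightarrow> real"
  assumes "continuous_on UNIV \<beta>" "u locally_integrable_on \<Omega>"
  shows "(\<lambda>x. \<beta> x *\<^sub>R u x) locally_integrable_on \<Omega>"
  unfolding locally_integrable_on_indicator
proof (intro allI impI, elim conjE)
  fix K assume K: "compact K" "K \<subseteq> \<Omega>"
  have "bounded (\<beta> ` K)"
    by (intro compact_imp_bounded compact_continuous_image K continuous_on_subset[OF assms(1)]) simp
  then obtain B where B: "\<And>x. x \<in> K \<Longrightarrow> \<bar>\<beta> x\<bar> \<le> B" by (auto simp: bounded_iff)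
  have u: "integrable lebesgue (\<lambda>x. indicator K x *\<^sub>R u x)"
    using assms(2) K by (simp add: locally_integrable_on_indicator)
  have \<beta>: "\<beta> \<in> borel_measurable lebesgue"
    by (intro borel_measurable_lebesgue borel_measurable_continuous_onI assms)
  show "integrable lebesgue (\<lambda>x. indicator K x *\<^sub>R \<beta> x *\<^sub>R u x)"
  proof (rule Bochner_Integration.integrable_bound)
    show "integrable lebesgue (\<lambda>x. B *\<^sub>R (indicator K x *\<^sub>R u x))" using u by (rule integrable_scaleR_right)
    have "(\<lambda>x. \<beta> x *\<^sub>R (indicator K x *\<^sub>R u x)) \<in> borel_measurable lebesgue"
      by (intro borel_measurable_scaleR[OF \<beta>] borel_measurable_integrable[OF u])
    then show "(\<lambda>x. indicator K x *\<^sub>R \<beta> x *\<^sub>R u x) \<in> borel_measurable lebesgue"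
      by (simp add: mult.commute)
    have "\<bar>\<beta> x\<bar> * norm (u x) \<le> \<bar>B\<bar> * norm (u x)" if "x \<in> K" for x
      using B[OF that] by (intro mult_right_mono) auto
    then show "AE x in lebesgue. norm (indicator K x *\<^sub>R \<beta> x *\<^sub>R u x) \<le> norm (B *\<^sub>R (indicator K x *\<^sub>R u x))"
      by (intro AE_I2) (auto simp: indicator_def)
  qed
qed

lemma integral_lebesgue_on_test:
  fixes g :: "real^'n \<Rightarrow> 'b::euclidean_space"
  assumes "open \<Omega>" "\<phi> \<in> test_functions \<Omega>"
  shows "integral\<^sup>L (lebesgue_on \<Omega>) (\<lambda>x. \<phi> x *\<^sub>R g x) = (LINT x|lebesgue. \<phi> x *\<^sub>R g x)"
proof (rule integral_lebesgue_on_eq(1)[OF sets_lebesgue_open[OF assms(1)]])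
  show "\<phi> x *\<^sub>R g x = 0" if "x \<notin> \<Omega>" for x
    using assms(2) that unfolding test_functions_def by auto
qed

lemma has_weak_partial_iff:
  assumes "open \<Omega>"
  shows "has_weak_partial \<Omega> i u g \<longleftrightarrow> u locally_integrable_on \<Omega> \<and> g locally_integrable_on \<Omega> \<and>
     (\<forall>\<phi> :: real^'n \<Rightarrow> real. \<phi> \<in> test_functions \<Omega> \<longrightarrow>
        (LINT x|lebesgue. partial_deriv i \<phi> x *\<^sub>R u x) = - (LINT x|lebesgue. \<phi> x *\<^sub>R g x))"
  unfolding has_weak_partial_def
  by (simp add: integral_lebesgue_on_test[OF assms] test_functions_partial_deriv cong: conj_cong imp_cong)

lemma has_weak_partial_subset:
  assumes "has_weak_partial \<Omega> i u g" "open \<Omega>" "open \<Omega>'" "\<Omega>' \<subseteq> \<Omega>"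
  shows "has_weak_partial \<Omega>' i u g"
  using assms unfolding has_weak_partial_iff[OF assms(2)] has_weak_partial_iff[OF assms(3)]
  by (meson locally_integrable_subset test_functions_mono)

lemma has_weak_partial_unique:
  fixes u :: "real^'n \<Rightarrow> 'b::euclidean_space"
  assumes "open \<Omega>" "has_weak_partial \<Omega> i u g" "has_weak_partial \<Omega> i u g'"
  shows "AE x in lebesgue. x \<in> \<Omega> \<longrightarrow> g x = g' x"
proof -
  note H = assms(2,3)[unfolded has_weak_partial_iff[OF assms(1)]]
  have "AE x in lebesgue. x \<in> \<Omega> \<longrightarrow> g x + (-1) *\<^sub>R g' x = 0"
  proof (rule fundamental_lemma[OF assms(1)])
    show "(\<lambda>x. g x + (-1) *\<^sub>R g' x) locally_integrable_on \<Omega>"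
      using H by (intro locally_integrable_on_add locally_integrable_on_scaleR) auto
    show "(LINT x|lebesgue. \<phi> x *\<^sub>R (g x + (-1) *\<^sub>R g' x)) = 0" if "\<phi> \<in> test_functions \<Omega>" for \<phi> :: "real^'n \<Rightarrow> real"
    proof -
      have "(LINT x|lebesgue. \<phi> x *\<^sub>R (g x + (-1) *\<^sub>R g' x)) = (LINT x|lebesgue. \<phi> x *\<^sub>R g x - \<phi> x *\<^sub>R g' x)"
        by (simp add: algebra_simps)
      also have "\<dots> = (LINT x|lebesgue. \<phi> x *\<^sub>R g x) - (LINT x|lebesgue. \<phi> x *\<^sub>R g' x)"
        using H by (intro Bochner_Integration.integral_diff integrable_test_scaleR[OF that]) auto
      also have "\<dots> = 0"
          using H(1)[THEN conjunct2, THEN conjunct2, rule_format, OF that]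
          H(2)[THEN conjunct2, THEN conjunct2, rule_format, OF that] by simp
      finally show ?thesis .
    qed
  qed
  then show ?thesis by eventually_elim auto
qed

lemma has_weak_partial_AE_cong:
  fixes u :: "real^'n \<Rightarrow> 'b::euclidean_space"
  assumes "open \<Omega>" "has_weak_partial \<Omega> i u g"
    and u: "AE x in lebesgue. x \<in> \<Omega> \<longrightarrow> u x = v x" and g: "AE x in lebesgue. x \<in> \<Omega> \<longrightarrow> g x = h x"
  shows "has_weak_partial \<Omega> i v h"
proof -
  note H = assms(2)[unfolded has_weak_partial_iff[OF assms(1)]]
  have eq: "(LINT x|lebesgue. \<phi> x *\<^sub>R b x) = (LINT x|lebesgue. \<phi> x *\<^sub>R a x)" 
    if "\<phi> \<in> test_functions \<Omega>" "a locally_integrable_on \<Omega>" "AE x in lebesgue. x \<in> \<Omega> \<longrightarrow> a x = b x" for \<phi> a and b :: "real^'n \<Rightarrow> 'b"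
    by (rule integrable_lebesgue_AE_cong(2)[OF integrable_test_scaleR[OF that(1,2)]], use that(3) in eventually_elim)
      (use that(1) in \<open>auto simp: test_functions_def\<close>)
  show ?thesis unfolding has_weak_partial_iff[OF assms(1)]
    using H locally_integrable_on_AE_cong[OF _ u] locally_integrable_on_AE_cong[OF _ g]
    by (auto simp: eq[OF _ _ u] eq[OF _ _ g] test_functions_partial_deriv)
qed

lemma has_weak_partial_weak_partial:
  "has_weak_partial \<Omega> i u g \<Longrightarrow> has_weak_partial \<Omega> i u (weak_partial \<Omega> i u)"
  unfolding weak_partial_def by (rule someI[of "has_weak_partial \<Omega> i u"])

lemma weak_partial_AE_eq:
  assumes "open \<Omega>" "has_weak_partial \<Omega> i u g"
  shows "AE x in lebesgue. x \<in> \<Omega> \<longrightarrow> weak_partial \<Omega> i u x = g x"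
  using has_weak_partial_unique[OF assms(1) has_weak_partial_weak_partial[OF assms(2)] assms(2)] .

lemma has_weak_partial_add:
  fixes u v :: "real^'n \<Rightarrow> 'b::euclidean_space"
  assumes "open \<Omega>" "has_weak_partial \<Omega> i u g" "has_weak_partial \<Omega> i v h"
  shows "has_weak_partial \<Omega> i (\<lambda>x. u x + v x) (\<lambda>x. g x + h x)"
proof -
  note H = assms(2,3)[unfolded has_weak_partial_iff[OF assms(1)]]
  show ?thesis unfolding has_weak_partial_iff[OF assms(1)]
  proof (intro conjI allI impI)
    fix \<phi> :: "real^'n \<Rightarrow> real" assume \<phi>: "\<phi> \<in> test_functions \<Omega>"
    note I = integrable_test_scaleR[OF \<phi>] integrable_test_scaleR[OF test_functions_partial_deriv[OF \<phi>]]
    show "(LINT x|lebesgue. partial_deriv i \<phi> x *\<^sub>R (u x + v x)) = - (LINT x|lebesgue. \<phi> x *\<^sub>R (g x + h x))"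
      unfolding scaleR_add_right
      using H \<phi> by (simp add: Bochner_Integration.integral_add I)
  qed (use H in \<open>auto intro: locally_integrable_on_add\<close>)
qed

text \<open>Apply the defining identity to the test function \<open>\<phi> \<beta>\<close>. The support may come from either factor:
  from \<open>\<phi>\<close> this is the product rule on the given set, from \<open>\<beta>\<close> it localizes a Sobolev function to one
  on the whole space.\<close>

lemma weak_product_rule:
  fixes \<phi> \<beta> :: "real^'n \<Rightarrow> real"
  assumes "open \<Omega>" "has_weak_partial \<Omega> i u g"
    and sm: "\<And>k. Ck_on k \<phi> UNIV" "\<And>k. Ck_on k \<beta> UNIV" and t: "\<phi> \<in> test_functions \<Omega> \<or> \<beta> \<in> test_functions \<Omega>"
  shows "(LINT x|lebesgue. partial_deriv i \<phi> x *\<^sub>R \<beta> x *\<^sub>R u x) = 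
    - (LINT x|lebesgue. \<phi> x *\<^sub>R (\<beta> x *\<^sub>R g x + partial_deriv i \<beta> x *\<^sub>R u x))"
proof -
  note H = assms(2)[unfolded has_weak_partial_iff[OF assms(1)]]
  have smp: "Ck_on k (partial_deriv i \<phi>) UNIV" "Ck_on k (partial_deriv i \<beta>) UNIV" for k
    using sm(1)[of "Suc k"] sm(2)[of "Suc k"] by (auto simp: partial_deriv_def[abs_def])
  have tp: "(\<lambda>x. \<phi> x * \<beta> x) \<in> test_functions \<Omega>" "(\<lambda>x. partial_deriv i \<phi> x * \<beta> x) \<in> test_functions \<Omega>"
    "(\<lambda>x. \<phi> x * partial_deriv i \<beta> x) \<in> test_functions \<Omega>"
    using t 
  proof (atomize (full), elim disjE, goal_cases)
    case 1
    show ?case using test_functions_scaleR_smooth[OF 1 sm(2)] test_functions_scaleR_smooth[OF 1 smp(2)]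
      test_functions_scaleR_smooth[OF test_functions_partial_deriv[OF 1] sm(2)] by simp
  next
    case 2
    show ?case using test_functions_smooth_scaleR[OF sm(1) 2] test_functions_smooth_scaleR[OF smp(1) 2]
      test_functions_smooth_scaleR[OF sm(1) test_functions_partial_deriv[OF 2]] by simp
  qed
  have pr: "partial_deriv i (\<lambda>x. \<phi> x * \<beta> x) x = \<phi> x * partial_deriv i \<beta> x + partial_deriv i \<phi> x * \<beta> x" for x
    using partial_deriv_scaleR[OF sm, of i x] by simp
  have I: "integrable lebesgue (\<lambda>x. (\<phi> x * \<beta> x) *\<^sub>R g x)" "integrable lebesgue (\<lambda>x. (\<phi> x * partial_deriv i \<beta> x) *\<^sub>R u x)"
     "integrable lebesgue (\<lambda>x. (partial_deriv i \<phi> x * \<beta> x) *\<^sub>R u x)"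
    using integrable_test_scaleR[OF tp(1)] integrable_test_scaleR[OF tp(2)] integrable_test_scaleR[OF tp(3)] H by auto
  have e1: "(LINT x|lebesgue. partial_deriv i (\<lambda>x. \<phi> x * \<beta> x) x *\<^sub>R u x) = - (LINT x|lebesgue. (\<phi> x * \<beta> x) *\<^sub>R g x)"
    using H tp(1) by blast
  have e2: "(LINT x|lebesgue. partial_deriv i (\<lambda>x. \<phi> x * \<beta> x) x *\<^sub>R u x) =
     (LINT x|lebesgue. (\<phi> x * partial_deriv i \<beta> x) *\<^sub>R u x) + (LINT x|lebesgue. (partial_deriv i \<phi> x * \<beta> x) *\<^sub>R u x)"
    unfolding pr scaleR_add_left by (rule Bochner_Integration.integral_add[OF I(2,3)])
  have e3: "(LINT x|lebesgue. \<phi> x *\<^sub>R (\<beta> x *\<^sub>R g x + partial_deriv i \<beta> x *\<^sub>R u x)) =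
     (LINT x|lebesgue. (\<phi> x * \<beta> x) *\<^sub>R g x) + (LINT x|lebesgue. (\<phi> x * partial_deriv i \<beta> x) *\<^sub>R u x)"
    unfolding scaleR_add_right scaleR_scaleR by (rule Bochner_Integration.integral_add[OF I(1,2)])
  have e4: "(LINT x|lebesgue. partial_deriv i \<phi> x *\<^sub>R \<beta> x *\<^sub>R u x) = (LINT x|lebesgue. (partial_deriv i \<phi> x * \<beta> x) *\<^sub>R u x)"
    by simp
  show ?thesis unfolding e4 e3 using e1 unfolding e2 by (simp add: eq_diff_eq add.commute)
qed

lemma has_weak_partial_smooth_scaleR:
  fixes \<beta> :: "real^'n \<Rightarrow> real"
  assumes "open \<Omega>" "has_weak_partial \<Omega> i u g" and sm: "\<And>k. Ck_on k \<beta> UNIV"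
  shows "has_weak_partial \<Omega> i (\<lambda>x. \<beta> x *\<^sub>R u x) (\<lambda>x. \<beta> x *\<^sub>R g x + partial_deriv i \<beta> x *\<^sub>R u x)"
proof -
  have c: "continuous_on UNIV \<beta>" "continuous_on UNIV (partial_deriv i \<beta>)"
    using sm[of 0] sm[of 1] by (auto simp: partial_deriv_def[abs_def])
  show ?thesis
    unfolding has_weak_partial_iff[OF assms(1)]
    using assms(2)[unfolded has_weak_partial_iff[OF assms(1)]]
    by (intro conjI allI impI weak_product_rule[OF assms(1,2) test_functions_smooth sm] disjI1
       locally_integrable_on_add locally_integrable_on_scaleR c) simp_all
qed

text \<open>Near a compact set where the cut-off is 1 nothing changes, while the product is globally
  integrable together with its weak derivative. All translations then make sense without regard to
  the domain.\<close>

lemma has_weak_partial_cutoff_UNIV: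
  fixes \<theta> :: "real^'n \<Rightarrow> real"
  assumes "open \<Omega>" "has_weak_partial \<Omega> i u g" and \<theta>: "\<theta> \<in> test_functions \<Omega>"
  shows "has_weak_partial UNIV i (\<lambda>x. \<theta> x *\<^sub>R u x) (\<lambda>x. \<theta> x *\<^sub>R g x + partial_deriv i \<theta> x *\<^sub>R u x)"
    and "integrable lebesgue (\<lambda>x. \<theta> x *\<^sub>R u x)"
    and "integrable lebesgue (\<lambda>x. \<theta> x *\<^sub>R g x + partial_deriv i \<theta> x *\<^sub>R u x)"
proof -
  note H = assms(2)[unfolded has_weak_partial_iff[OF assms(1)]]
  show I: "integrable lebesgue (\<lambda>x. \<theta> x *\<^sub>R u x)"
    "integrable lebesgue (\<lambda>x. \<theta> x *\<^sub>R g x + partial_deriv i \<theta> x *\<^sub>R u x)"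
    using H by (auto intro!: Bochner_Integration.integrable_add integrable_test_scaleR[OF \<theta>]
        integrable_test_scaleR[OF test_functions_partial_deriv[OF \<theta>]])
  show "has_weak_partial UNIV i (\<lambda>x. \<theta> x *\<^sub>R u x) (\<lambda>x. \<theta> x *\<^sub>R g x + partial_deriv i \<theta> x *\<^sub>R u x)"
    unfolding has_weak_partial_iff[OF open_UNIV]
    by (intro conjI allI impI integrable_imp_locally_integrable I
        weak_product_rule[OF assms(1,2) test_functions_smooth test_functions_smooth[OF \<theta>]] disjI2 \<theta>)
qed

lemma test_function_lipschitz:
  fixes \<psi> :: "real^'n \<Rightarrow> 'b::euclidean_space"
  assumes "\<psi> \<in> test_functions \<Omega>" 
  obtains M where "M > 0" "\<And>x h. norm (\<psi> (x + h *\<^sub>R axis i 1) - \<psi> x) \<le> M * \<bar>h\<bar>"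
proof -
  obtain M where M: "M > 0" "\<And>x. norm (partial_deriv i \<psi> x) \<le> M"
    using test_functions_bounded[OF test_functions_partial_deriv[OF assms]] by metis
  have "norm (\<psi> (x + h *\<^sub>R axis i 1) - \<psi> x) \<le> M * \<bar>h\<bar>" for x h
  proof -
    have "norm (\<psi> (x + h *\<^sub>R axis i 1) - \<psi> (x + 0 *\<^sub>R axis i 1)) \<le> M * norm (h - 0)"
    proof (rule differentiable_bound[where S=UNIV and f'="\<lambda>t s. s *\<^sub>R partial_deriv i \<psi> (x + t *\<^sub>R axis i 1)"])
      fix t
      have "((\<lambda>t. \<psi> (x + t *\<^sub>R axis i 1)) has_derivative (\<lambda>s. frechet_derivative \<psi> (at (x + t *\<^sub>R axis i 1)) (s *\<^sub>R axis i 1))) (at t)"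
        by (rule has_derivative_compose[OF _ test_functions_has_derivative[OF assms]]) (auto intro!: derivative_eq_intros)
      then show "((\<lambda>t. \<psi> (x + t *\<^sub>R axis i 1)) has_derivative (\<lambda>s. s *\<^sub>R partial_deriv i \<psi> (x + t *\<^sub>R axis i 1))) (at t)"
        using linear_scale[OF has_derivative_linear[OF test_functions_has_derivative[OF assms]]]
        by (simp add: partial_deriv_def)
      show "onorm (\<lambda>s. s *\<^sub>R partial_deriv i \<psi> (x + t *\<^sub>R axis i 1)) \<le> M"
        by (rule onorm_le) (use M(2) in \<open>simp add: mult.commute[of M] mult_left_mono\<close>)
    qed auto
    then show ?thesis by simp
  qed
  then show ?thesis using that M by blast
qed

lemma difference_quotient_at_0:
  fixes \<gamma> :: "real \<Rightarrow> 'a::real_normed_vector"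
  assumes "(\<gamma> has_vector_derivative v) (at (0::real))"
  shows "((\<lambda>t. (\<gamma> t - \<gamma> 0) /\<^sub>R t) \<longlongrightarrow> v) (at 0)"
proof -
  have "((\<lambda>h. norm (\<gamma> (0 + h) - \<gamma> 0 - h *\<^sub>R v) / norm h) \<longlongrightarrow> 0) (at 0)"
    using assms unfolding has_vector_derivative_def has_derivative_at by blast
  moreover have "\<forall>\<^sub>F h in at 0. norm (\<gamma> (0 + h) - \<gamma> 0 - h *\<^sub>R v) / norm h = norm ((\<gamma> h - \<gamma> 0) /\<^sub>R h - v)"
    unfolding eventually_at_filter
  proof (intro always_eventually allI impI)
    fix h :: real assume "h \<noteq> 0"
    then have "(\<gamma> h - \<gamma> 0) /\<^sub>R h - v = (\<gamma> h - \<gamma> 0 - h *\<^sub>R v) /\<^sub>R h" by (simp add: scaleR_diff_right)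
    then show "norm (\<gamma> (0 + h) - \<gamma> 0 - h *\<^sub>R v) / norm h = norm ((\<gamma> h - \<gamma> 0) /\<^sub>R h - v)"
      by (simp add: divide_inverse mult.commute)
  qed
  ultimately have "((\<lambda>h. norm ((\<gamma> h - \<gamma> 0) /\<^sub>R h - v)) \<longlongrightarrow> 0) (at 0)" by (rule Lim_transform_eventually)
  then show ?thesis by (rule LIM_zero_cancel[OF tendsto_norm_zero_cancel])
qed

lemma test_function_difference_quotient:
  fixes \<psi> :: "real^'n \<Rightarrow> 'b::euclidean_space"
  assumes "\<psi> \<in> test_functions \<Omega>" 
  shows "((\<lambda>h. (\<psi> (x + h *\<^sub>R axis i 1) - \<psi> x) /\<^sub>R h) \<longlongrightarrow> partial_deriv i \<psi> x) (at 0)"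
proof -
  have "((\<lambda>t. \<psi> (x + t *\<^sub>R axis i 1)) has_derivative (\<lambda>s. frechet_derivative \<psi> (at (x + 0 *\<^sub>R axis i 1)) (s *\<^sub>R axis i 1))) (at 0)"
    by (rule has_derivative_compose[OF _ test_functions_has_derivative[OF assms]]) (auto intro!: derivative_eq_intros)
  then have "((\<lambda>t. \<psi> (x + t *\<^sub>R axis i 1)) has_vector_derivative partial_deriv i \<psi> x) (at 0)"
    using linear_scale[OF has_derivative_linear[OF test_functions_has_derivative[OF assms]]]
    by (simp add: partial_deriv_def has_vector_derivative_def)
  from difference_quotient_at_0[OF this] show ?thesis by simp
qed

text \<open>Difference quotients have integral zero by translation invariance, and they converge to the
  partial derivative with a bounded majorant of compact support.\<close>

lemma integral_partial_deriv_test: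
  fixes \<psi> :: "real^'n \<Rightarrow> 'b::euclidean_space"
  assumes "\<psi> \<in> test_functions \<Omega>"
  shows "(LINT x|lebesgue. partial_deriv i \<psi> x) = 0"
proof -
  obtain K where K: "compact K" "\<And>x. x \<notin> K \<Longrightarrow> \<psi> x = 0" 
    using assms unfolding test_functions_def by blast
  obtain M where M: "M > 0" "\<And>x h. norm (\<psi> (x + h *\<^sub>R axis i 1) - \<psi> x) \<le> M * \<bar>h\<bar>"
    using test_function_lipschitz[OF assms] by blast
  obtain R where R: "\<And>x. x \<in> K \<Longrightarrow> norm x \<le> R"
    using compact_imp_bounded[OF K(1)] by (auto simp: bounded_iff)
  define h where "h k = inverse (real (Suc k))" for k
  have h: "h k > 0" "h k \<le> 1" for k by (auto simp: h_def inverse_le_1_iff)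
  have h0: "filterlim h (at 0) sequentially"
    unfolding h_def by (rule filterlim_atI[OF LIMSEQ_inverse_real_of_nat]) auto
  have int: "integrable lebesgue \<psi>"
    using integrable_bilinear_test[OF bounded_bilinear_scaleR[THEN bounded_bilinear.flip] assms continuous_imp_locally_integrable[of "\<lambda>_. 1::real"]]
    by simp
  define Q where "Q k x = (\<psi> (x + h k *\<^sub>R axis i 1) - \<psi> x) /\<^sub>R h k" for k x
  have intQ: "integrable lebesgue (Q k)" "(LINT x|lebesgue. Q k x) = 0" for k
    using integrable_translation[OF int, of "h k *\<^sub>R axis i 1"] integral_translation[OF int, of "h k *\<^sub>R axis i 1"] int
    unfolding Q_def by (auto simp: add.commute[of "h k *\<^sub>R axis i 1"])
  have "(\<lambda>k. LINT x|lebesgue. Q k x) \<longlonglongrightarrow> (LINT x|lebesgue. partial_deriv i \<psi> x)"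
  proof (rule integral_dominated_convergence)
    show "integrable lebesgue (\<lambda>x. indicator (cball 0 (R + 1)) x *\<^sub>R M :: real)"
      by (intro integrable_real_indicator integrable_scaleR_left)
        (use emeasure_lborel_cball_finite in \<open>auto simp: less_top[symmetric]\<close>)
    show "partial_deriv i \<psi> \<in> borel_measurable lebesgue"
      by (rule borel_measurable_lebesgue[OF test_functions_measurable[OF test_functions_partial_deriv[OF assms]]])
    show "Q k \<in> borel_measurable lebesgue" for k using intQ(1) by (rule borel_measurable_integrable)
    show "AE x in lebesgue. (\<lambda>k. Q k x) \<longlonglongrightarrow> partial_deriv i \<psi> x"
      unfolding Q_def
      by (intro AE_I2 filterlim_compose[OF test_function_difference_quotient[OF assms] h0])
    have "norm (Q k x) \<le> indicator (cball 0 (R + 1)) x *\<^sub>R M" for k x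
    proof (cases "x \<in> cball 0 (R + 1)")
      case True
      have "norm (Q k x) \<le> inverse (h k) * (M * h k)"
        using M(2)[of x "h k"] h[of k] by (simp add: Q_def mult_left_mono)
      also have "\<dots> = M" using h(1)[of k] by simp
      finally show ?thesis using True by simp
    next
      case False
      then have "norm x > R + 1" by simp
      then have "x \<notin> K" "x + h k *\<^sub>R axis i 1 \<notin> K"
        using R[of x] R[of "x + h k *\<^sub>R axis i 1"] h[of k] norm_diff_ineq[of x "h k *\<^sub>R axis i 1"] by auto
      then show ?thesis using K(2) M(1) by (simp add: Q_def)
    qed
    then show "AE x in lebesgue. norm (Q k x) \<le> indicator (cball 0 (R + 1)) x *\<^sub>R M" for k by simp
  qed
  then show ?thesis by (simp add: intQ LIMSEQ_const_iff)
qed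

lemma has_weak_partial_smooth:
  fixes \<zeta> :: "real^'n \<Rightarrow> 'b::euclidean_space"
  assumes "open \<Omega>" and sm: "\<And>k. Ck_on k \<zeta> UNIV"
  shows "has_weak_partial \<Omega> i \<zeta> (partial_deriv i \<zeta>)"
proof -
  have c: "continuous_on UNIV \<zeta>" "continuous_on UNIV (partial_deriv i \<zeta>)"
    using sm[of 0] sm[of 1] by (auto simp: partial_deriv_def[abs_def])
  note l = c[THEN continuous_imp_locally_integrable, where \<Omega>=\<Omega>]
  show ?thesis unfolding has_weak_partial_iff[OF assms(1)]
  proof (intro conjI allI impI l)
    fix \<phi> :: "real^'n \<Rightarrow> real" assume \<phi>: "\<phi> \<in> test_functions \<Omega>"
    have "0 = (LINT x|lebesgue. partial_deriv i (\<lambda>x. \<phi> x *\<^sub>R \<zeta> x) x)"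
      using integral_partial_deriv_test[OF test_functions_scaleR_smooth[OF \<phi> sm]] by simp
    also have "\<dots> = (LINT x|lebesgue. \<phi> x *\<^sub>R partial_deriv i \<zeta> x + partial_deriv i \<phi> x *\<^sub>R \<zeta> x)"
      using partial_deriv_scaleR[OF test_functions_smooth[OF \<phi>] sm] by simp
    also have "\<dots> = (LINT x|lebesgue. \<phi> x *\<^sub>R partial_deriv i \<zeta> x) + (LINT x|lebesgue. partial_deriv i \<phi> x *\<^sub>R \<zeta> x)"
      by (intro Bochner_Integration.integral_add integrable_test_scaleR[OF \<phi>] l 
          integrable_test_scaleR[OF test_functions_partial_deriv[OF \<phi>]])
    finally show "(LINT x|lebesgue. partial_deriv i \<phi> x *\<^sub>R \<zeta> x) = - (LINT x|lebesgue. \<phi> x *\<^sub>R partial_deriv i \<zeta> x)"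
      by (simp add: eq_neg_iff_add_eq_0 add.commute)
  qed
qed

section \<open>Continuity of translation in the mean\<close>

definition translation_continuous :: "('a::euclidean_space \<Rightarrow> 'b::euclidean_space) \<Rightarrow> bool" where
  "translation_continuous f \<longleftrightarrow> ((\<lambda>h. LINT x|lebesgue. norm (f (h + x) - f x)) \<longlongrightarrow> 0) (at 0)"

text \<open>The property passes to limits in the mean, because a translation preserves the distance in the
  mean and so f differs from its translate by at most twice the approximation error more than g does.\<close>

lemma translation_continuous_approx:
  fixes f :: "'a::euclidean_space \<Rightarrow> 'b::euclidean_space"
  assumes f: "integrable lebesgue f"
    and g: "\<And>\<epsilon>. \<epsilon> > 0 \<Longrightarrow> \<exists>g. integrable lebesgue g \<and> translation_continuous g \<and> (LINT x|lebesgue. norm (f x - g x)) < \<epsilon>"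
  shows "translation_continuous f"
  unfolding translation_continuous_def
proof (rule tendstoI)
  fix e :: real assume "e > 0"
  obtain g where g: "integrable lebesgue g" "translation_continuous g" "(LINT x|lebesgue. norm (f x - g x)) < e / 3"
    using g[of "e/3"] \<open>e > 0\<close> by auto
  have "\<forall>\<^sub>F h in at 0. dist (LINT x|lebesgue. norm (g (h + x) - g x)) 0 < e / 3"
    using g(2) \<open>e > 0\<close> unfolding translation_continuous_def by (intro tendstoD) auto
  then show "\<forall>\<^sub>F h in at 0. dist (LINT x|lebesgue. norm (f (h + x) - f x)) 0 < e"
  proof eventually_elim
    case (elim h)
    have fg: "integrable lebesgue (\<lambda>x. norm (f x - g x))" using f g(1) by auto
    have fi: "integrable lebesgue (\<lambda>x. norm (f (h + x) - f x))" 
      and gi: "integrable lebesgue (\<lambda>x. norm (g (h + x) - g x))"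
      using f g(1) integrable_translation[OF f] integrable_translation[OF g(1)] by auto
    have "(LINT x|lebesgue. norm (f (h + x) - f x)) \<le> 
      (LINT x|lebesgue. norm (f (h + x) - g (h + x)) + (norm (g (h + x) - g x) + norm (f x - g x)))"
    proof (rule integral_mono)
      show "integrable lebesgue (\<lambda>x. norm (f (h + x) - g (h + x)) + (norm (g (h + x) - g x) + norm (f x - g x)))"
        by (intro Bochner_Integration.integrable_add gi fg integrable_translation[OF fg])
      fix x
      have "f (h + x) - f x = (f (h + x) - g (h + x)) + ((g (h + x) - g x) - (f x - g x))" by simp
      then show "norm (f (h + x) - f x) \<le> norm (f (h + x) - g (h + x)) + (norm (g (h + x) - g x) + norm (f x - g x))"
        using norm_triangle_ineq[of "f (h + x) - g (h + x)" "(g (h + x) - g x) - (f x - g x)"]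
          norm_triangle_ineq4[of "g (h + x) - g x" "f x - g x"] by simp
    qed (rule fi)
    also have "\<dots> = (LINT x|lebesgue. norm (f (h + x) - g (h + x))) + ((LINT x|lebesgue. norm (g (h + x) - g x)) + (LINT x|lebesgue. norm (f x - g x)))"
      using gi fg integrable_translation[OF fg] by (simp add: Bochner_Integration.integral_add)
    also have "(LINT x|lebesgue. norm (f (h + x) - g (h + x))) = (LINT x|lebesgue. norm (f x - g x))"
      by (rule integral_translation[OF fg])
    finally show ?case using elim g(3) by (simp add: dist_real_def)
  qed
qed

text \<open>For two functions of equal integral, the integral of \<open>\<bar>v - u\<bar>\<close> is twice that of the positive part of
  \<open>u - v\<close>. With u the indicator of an open set and v its translate by h, this positive part tends
  to zero pointwise as h does: a point of an open set stays in it after a small translation. Dominated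
  convergence applies with u as majorant.\<close>

lemma translation_continuous_open:
  fixes U :: "'a::euclidean_space set" and c :: "'b::euclidean_space"
  assumes U: "open U" and fin: "integrable lebesgue (indicator U :: 'a \<Rightarrow> real)"
  shows "translation_continuous (\<lambda>x. indicator U x *\<^sub>R c)"
proof -
  define u :: "'a \<Rightarrow> real" where "u = indicator U"
  have ui: "integrable lebesgue u" using fin by (simp add: u_def)
  have U': "\<And>h. (\<lambda>x. u (h + x)) \<in> borel_measurable lebesgue"
    using integrable_translation[OF ui] by (rule borel_measurable_integrable)
  have lim0: "((\<lambda>h. LINT x|lebesgue. max 0 (u x - u (h + x))) \<longlongrightarrow> 0) (at 0)"
    unfolding tendsto_at_iff_sequentially comp_def
  proof (intro allI impI)
    fix X :: "nat \<Rightarrow> 'a" assume X: "X \<longlonglongrightarrow> 0"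
    have "(\<lambda>n. LINT x|lebesgue. max 0 (u x - u (X n + x))) \<longlonglongrightarrow> (LINT x|(lebesgue::'a measure). (0::real))"
    proof (rule integral_dominated_convergence)
      show "integrable lebesgue u" by (rule ui)
      show "(\<lambda>x. max 0 (u x - u (X n + x))) \<in> borel_measurable lebesgue" for n
        using U' borel_measurable_integrable[OF ui] by (intro borel_measurable_max borel_measurable_diff) auto
      show "AE x in lebesgue. norm (max 0 (u x - u (X n + x))) \<le> u x" for n
        by (intro AE_I2) (auto simp: u_def indicator_def)
      show "AE x in lebesgue. (\<lambda>n. max 0 (u x - u (X n + x))) \<longlonglongrightarrow> 0"
      proof (intro AE_I2)
        fix x
        show "(\<lambda>n. max 0 (u x - u (X n + x))) \<longlonglongrightarrow> 0"
        proof (cases "x \<in> U")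
          case True
          have "(\<lambda>n. X n + x) \<longlonglongrightarrow> 0 + x" by (intro tendsto_add X tendsto_const)
          then have "\<forall>\<^sub>F n in sequentially. X n + x \<in> U"
            using topological_tendstoD[OF _ U] True by fastforce
          then show ?thesis
            by (intro tendsto_eventually) (auto elim!: eventually_mono simp: u_def)
        next
          case False
          then show ?thesis by (intro tendsto_eventually) (auto simp: u_def indicator_def)
        qed
      qed
    qed auto
    then show "(\<lambda>n. LINT x|lebesgue. max 0 (u x - u (X n + x))) \<longlonglongrightarrow> 0" by simp
  qed
  have mx: "integrable lebesgue (\<lambda>x. max 0 (u x - u (h + x)))" for h
    using ui integrable_translation[OF ui] by (intro integrable_max) auto
  have "(LINT x|lebesgue. norm (indicator U (h + x) *\<^sub>R c - indicator U x *\<^sub>R c)) = norm c * (2 * (LINT x|lebesgue. max 0 (u x - u (h + x))))" for h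
  proof -
    have "norm (indicator U (h + x) *\<^sub>R c - indicator U x *\<^sub>R c) = 
      norm c * ((u (h + x) - u x) + 2 * max 0 (u x - u (h + x)))" for x
      by (auto simp: u_def indicator_def)
    then have "(LINT x|lebesgue. norm (indicator U (h + x) *\<^sub>R c - indicator U x *\<^sub>R c))
      = norm c * ((LINT x|lebesgue. u (h + x)) - (LINT x|lebesgue. u x) + 2 * (LINT x|lebesgue. max 0 (u x - u (h + x))))"
      using mx ui integrable_translation[OF ui] by (simp add: Bochner_Integration.integral_add)
    then show ?thesis by (simp add: integral_translation[OF ui])
  qed
  moreover have "((\<lambda>h. norm c * (2 * (LINT x|lebesgue. max 0 (u x - u (h + x))))) \<longlongrightarrow> norm c * (2 * 0)) (at 0)"
    by (intro tendsto_mult lim0 tendsto_const)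
  ultimately show ?thesis unfolding translation_continuous_def by simp
qed

lemma translation_continuous_indicator:
  fixes c :: "'b::euclidean_space"
  assumes A: "A \<in> sets lebesgue" "emeasure lebesgue A < \<infinity>"
  shows "translation_continuous (\<lambda>x. indicator A x *\<^sub>R c)"
proof (rule translation_continuous_approx)
  have iA: "integrable lebesgue (\<lambda>x. indicator A x *\<^sub>R c)"
    using A by (intro integrable_scaleR_left integrable_real_indicator)
  then show "integrable lebesgue (\<lambda>x. indicator A x *\<^sub>R c)" .
  fix e :: real assume "e > 0"
  define d where "d = e / (norm c + 1)"
  have d: "d > 0" using \<open>e > 0\<close> by (simp add: d_def add_nonneg_pos)
  obtain U where U: "open U" "A \<subseteq> U" "U - A \<in> lmeasurable" "emeasure lebesgue (U - A) < d"
    using sets_lebesgue_outer_open[OF A(1) d] by metis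
  have "emeasure lebesgue U \<le> emeasure lebesgue A + emeasure lebesgue (U - A)"
    using emeasure_subadditive[of A lebesgue "U - A"] U A(1) by (simp add: Un_absorb1 fmeasurableD)
  also have "\<dots> < \<infinity>" using A(2) order.strict_trans[OF U(4) ennreal_less_top] by simp
  finally have fin: "integrable lebesgue (indicator U :: _ \<Rightarrow> real)"
    using U(1) by (intro integrable_real_indicator sets_lebesgue_open)
  have iU: "integrable lebesgue (\<lambda>x. indicator U x *\<^sub>R c)"
    by (intro integrable_scaleR_left fin)
  have "(LINT x|lebesgue. norm (indicator A x *\<^sub>R c - indicator U x *\<^sub>R c)) = (LINT x|lebesgue. indicator (U - A) x * norm c)"
    using U(2) by (intro Bochner_Integration.integral_cong) (auto simp: indicator_def)
  also have "\<dots> = measure lebesgue (U - A) * norm c" by simp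
  also have "\<dots> \<le> d * norm c"
  proof (rule mult_right_mono)
    have "ennreal (measure lebesgue (U - A)) < ennreal d" using U(4) emeasure_eq_measure2[OF U(3)] by simp
    then show "measure lebesgue (U - A) \<le> d" using d by (simp add: ennreal_less_iff)
  qed simp
  also have "\<dots> < d * (norm c + 1)" using d by simp
  also have "\<dots> = e" using add_nonneg_pos[OF norm_ge_zero[of c] zero_less_one] by (simp add: d_def)
  finally have "(LINT x|lebesgue. norm (indicator A x *\<^sub>R c - indicator U x *\<^sub>R c)) < e" .
  then show "\<exists>g. integrable lebesgue g \<and> translation_continuous g \<and> (LINT x|lebesgue. norm (indicator A x *\<^sub>R c - g x)) < e"
    using iU translation_continuous_open[OF U(1) fin] by blast
qed

lemma translation_continuous_integrable:
  fixes f :: "'a::euclidean_space \<Rightarrow> 'b::euclidean_space"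
  assumes "integrable lebesgue f" shows "translation_continuous f"
  using assms
proof (induction rule: integrable_induct)
  case (base A c)
  then show ?case by (rule translation_continuous_indicator)
next
  case (add f g)
  have "((\<lambda>h. (LINT x|lebesgue. norm (f (h + x) - f x)) + (LINT x|lebesgue. norm (g (h + x) - g x))) \<longlongrightarrow> 0 + 0) (at 0)"
    using add unfolding translation_continuous_def by (intro tendsto_add)
  then have L: "((\<lambda>h. (LINT x|lebesgue. norm (f (h + x) - f x)) + (LINT x|lebesgue. norm (g (h + x) - g x))) \<longlongrightarrow> 0) (at 0)" by simp
  show ?case unfolding translation_continuous_def
  proof (rule tendsto_sandwich[OF _ _ tendsto_const L])
    show "\<forall>\<^sub>F h in at 0. 0 \<le> (LINT x|lebesgue. norm (f (h + x) + g (h + x) - (f x + g x)))" by simp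
    have "(LINT x|lebesgue. norm (f (h + x) + g (h + x) - (f x + g x))) \<le>
      (LINT x|lebesgue. norm (f (h + x) - f x)) + (LINT x|lebesgue. norm (g (h + x) - g x))" for h
    proof -
      have i: "integrable lebesgue (\<lambda>x. norm (f (h + x) - f x))" "integrable lebesgue (\<lambda>x. norm (g (h + x) - g x))"
        "integrable lebesgue (\<lambda>x. norm (f (h + x) + g (h + x) - (f x + g x)))"
        using add(1,2) integrable_translation[OF add(1)] integrable_translation[OF add(2)] by auto
      have "(LINT x|lebesgue. norm (f (h + x) + g (h + x) - (f x + g x))) \<le> (LINT x|lebesgue. norm (f (h + x) - f x) + norm (g (h + x) - g x))"
        by (rule integral_mono[OF i(3) Bochner_Integration.integrable_add[OF i(1,2)]]) (metis add_diff_add norm_triangle_ineq)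
      then show ?thesis using i by (simp add: Bochner_Integration.integral_add)
    qed
    then show "\<forall>\<^sub>F h in at 0. (LINT x|lebesgue. norm (f (h + x) + g (h + x) - (f x + g x))) \<le>
      (LINT x|lebesgue. norm (f (h + x) - f x)) + (LINT x|lebesgue. norm (g (h + x) - g x))" by simp
  qed
next
  case (lim f s)
  have L: "(\<lambda>i. LINT x|lebesgue. norm (f x - s i x)) \<longlonglongrightarrow> (LINT x|(lebesgue::'a measure). norm (0::'b))"
  proof (rule integral_dominated_convergence)
    show "integrable lebesgue (\<lambda>x. 3 * norm (f x))" using lim(4) by simp
    show "AE x in lebesgue. (\<lambda>i. norm (f x - s i x)) \<longlonglongrightarrow> norm (0::'b)"
      using lim(2) by (intro AE_I2 tendsto_norm) (auto intro!: tendsto_eq_intros)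
    show "AE x in lebesgue. norm (norm (f x - s i x)) \<le> 3 * norm (f x)" for i
    proof (intro AE_I2)
      fix x :: 'a
      show "norm (norm (f x - s i x)) \<le> 3 * norm (f x)"
        using norm_triangle_ineq4[of "f x" "s i x"] lim(3)[of x i] by simp
    qed
    show "(\<lambda>x. norm (f x - s i x)) \<in> borel_measurable lebesgue" for i
      using lim(1)[of i] lim(4)
      by (intro borel_measurable_integrable integrable_norm Bochner_Integration.integrable_diff)
  qed auto
  show ?case
  proof (rule translation_continuous_approx[OF lim(4)])
    fix e :: real assume "e > 0"
    then have "\<forall>\<^sub>F i in sequentially. (LINT x|lebesgue. norm (f x - s i x)) < e"
      using order_tendstoD(2)[OF L, of e] by simp
    then obtain i where "(LINT x|lebesgue. norm (f x - s i x)) < e"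
      by (meson eventually_happens trivial_limit_sequentially)
    then show "\<exists>g. integrable lebesgue g \<and> translation_continuous g \<and> (LINT x|lebesgue. norm (f x - g x)) < e"
      using lim(1) lim(5) by blast
  qed
qed

section \<open>Difference quotients of Sobolev functions converge in the mean\<close>

lemma AE_eq_borel:
  fixes f :: "'a::euclidean_space \<Rightarrow> 'b::euclidean_space"
  assumes "f \<in> borel_measurable lebesgue"
  obtains g where "g \<in> borel_measurable borel" "AE x in lebesgue. f x = g x"
proof -
  have "\<exists>g\<in>borel_measurable lborel. AE x in lborel. f x \<bullet> b = g x" for b
    using assms by (intro completion_ex_borel_measurable_real borel_measurable_inner) auto
  then obtain g where g: "\<And>b. g b \<in> borel_measurable borel" "\<And>b. AE x in lborel. f x \<bullet> b = g b x"
    by (metis measurable_lborel2)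
  have "AE x in lborel. \<forall>b\<in>Basis. f x \<bullet> b = g b x"
    using g(2) by (intro AE_finite_allI) auto
  then have "AE x in lborel. f x = (\<Sum>b\<in>Basis. g b x *\<^sub>R b)"
    by eventually_elim (metis (mono_tags, lifting) euclidean_representation sum.cong)
  moreover have "(\<lambda>x. \<Sum>b\<in>Basis. g b x *\<^sub>R b) \<in> borel_measurable borel"
    using g(1) by measurable
  ultimately show ?thesis using that AE_completion by blast
qed

lemma has_derivative_translate:
  fixes f :: "'a::real_normed_vector \<Rightarrow> 'b::real_normed_vector"
  assumes "(f has_derivative f') (at (x + c))" shows "((\<lambda>x. f (x + c)) has_derivative f') (at x)"
  by (rule has_derivative_compose[of "\<lambda>x. x + c" "\<lambda>v. v" x UNIV f f', OF _ assms]) (auto intro!: derivative_eq_intros)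

lemma Ck_on_translate:
  fixes f :: "'a::euclidean_space \<Rightarrow> 'b::real_normed_vector"
  assumes "Ck_on k f UNIV" shows "Ck_on k (\<lambda>x. f (x + c)) UNIV"
  using assms
proof (induction k arbitrary: f)
  case 0
  then show ?case by (auto intro!: continuous_on_compose2[of UNIV f] continuous_intros)
next
  case (Suc k)
  show ?case
  proof (rule Ck_on_SucI[OF open_UNIV])
    show "((\<lambda>x. f (x + c)) has_derivative frechet_derivative f (at (x + c))) (at x)" for x
      by (rule has_derivative_translate[OF Ck_on_has_derivative[OF Suc.prems UNIV_I]])
    show "Ck_on k (\<lambda>x. frechet_derivative f (at (x + c)) v) UNIV" for v
      using Suc.prems by (intro Suc.IH[of "\<lambda>x. frechet_derivative f (at x) v"]) simp
  qed
qed

lemma test_functions_translate: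
  fixes \<phi> :: "'a::euclidean_space \<Rightarrow> 'b::real_normed_vector"
  assumes "\<phi> \<in> test_functions UNIV" 
  shows "(\<lambda>x. \<phi> (x + c)) \<in> test_functions UNIV" 
proof -
  obtain K where K: "compact K" "\<And>x. x \<notin> K \<Longrightarrow> \<phi> x = 0" 
    using assms unfolding test_functions_def by blast
  show ?thesis
  proof (rule test_functionsI[OF Ck_on_translate[OF test_functions_smooth[OF assms]]])
    show "compact ((\<lambda>x. x - c) ` K)" by (rule compact_translation_subtract[OF K(1)])
    show "\<phi> (x + c) = 0" if "x \<notin> (\<lambda>x. x - c) ` K" for x
    proof (rule K(2))
      show "x + c \<notin> K" using that by (metis add_diff_cancel image_eqI)
    qed
  qed simp
qed

lemma partial_deriv_translate:
  fixes \<phi> :: "real^'n \<Rightarrow> 'b::real_normed_vector"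
  assumes "\<phi> \<in> test_functions UNIV" 
  shows "partial_deriv i (\<lambda>x. \<phi> (x + c)) x = partial_deriv i \<phi> (x + c)"
proof -
  have "((\<lambda>x. \<phi> (x + c)) has_derivative frechet_derivative \<phi> (at (x + c))) (at x)"
    by (rule has_derivative_translate[OF test_functions_has_derivative[OF assms]])
  from partial_deriv_eqI[OF this] show ?thesis by (simp add: partial_deriv_def)
qed

lemma test_function_difference_eq_average:
  fixes \<phi> :: "real^'n \<Rightarrow> real"
  assumes "\<phi> \<in> test_functions UNIV"
  shows "(LINT t|lborel. indicator {0..1} t *\<^sub>R (h * partial_deriv i \<phi> (x - (t * h) *\<^sub>R axis i 1))) = \<phi> x - \<phi> (x - h *\<^sub>R axis i 1)"
proof -
  have "(LINT t|lborel. indicator {0..1} t *\<^sub>R (h * partial_deriv i \<phi> (x - (t * h) *\<^sub>R axis i 1))) 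
    = - \<phi> (x - (1 * h) *\<^sub>R axis i 1) - (- \<phi> (x - (0 * h) *\<^sub>R axis i 1))"
  proof (rule integral_FTC_atLeastAtMost)
    fix t :: real
    have "((\<lambda>t. \<phi> (x - (t * h) *\<^sub>R axis i 1)) has_derivative 
      (\<lambda>s. frechet_derivative \<phi> (at (x - (t * h) *\<^sub>R axis i 1)) (- (s * h) *\<^sub>R axis i 1))) (at t)"
      by (rule has_derivative_compose[OF _ test_functions_has_derivative[OF assms]]) (auto intro!: derivative_eq_intros)
    then have D: "((\<lambda>t. - \<phi> (x - (t * h) *\<^sub>R axis i 1)) has_derivative 
      (\<lambda>s. - frechet_derivative \<phi> (at (x - (t * h) *\<^sub>R axis i 1)) (- (s * h) *\<^sub>R axis i 1))) (at t)"
      by (rule has_derivative_minus)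
    have sc: "- frechet_derivative \<phi> (at y) (- (s * h) *\<^sub>R axis i 1) = s *\<^sub>R (h * partial_deriv i \<phi> y)" for s y
      unfolding linear_scale[OF has_derivative_linear[OF test_functions_has_derivative[OF assms]]]
      by (simp add: partial_deriv_def)
    show "((\<lambda>t. - \<phi> (x - (t * h) *\<^sub>R axis i 1)) has_vector_derivative h * partial_deriv i \<phi> (x - (t * h) *\<^sub>R axis i 1)) (at t within {0..1})"
      using D unfolding has_vector_derivative_def sc by (rule has_derivative_at_withinI)
    show "continuous_on {0..1} (\<lambda>t. h * partial_deriv i \<phi> (x - (t * h) *\<^sub>R axis i 1))"
      by (rule continuous_on_mult_left, rule continuous_on_compose2[OF test_functions_continuous[OF test_functions_partial_deriv[OF assms], of UNIV]])
        (auto intro!: continuous_on_diff continuous_on_scaleR continuous_on_mult continuous_on_const continuous_on_id)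
  qed simp
  then show ?thesis by simp
qed

text \<open>Together with the next lemma this justifies Fubini on the product of the unit interval of
  translation parameters with the space.\<close>

lemma integrable_product_bounded:
  fixes f :: "real^'n \<Rightarrow> 'b::euclidean_space" and b :: "real \<times> (real^'n) \<Rightarrow> real"
  assumes f: "integrable lborel f" and b: "b \<in> borel_measurable borel" "\<And>p. \<bar>b p\<bar> \<le> M"
  shows "integrable (lborel \<Otimes>\<^sub>M lborel) (\<lambda>(t, x). indicator {0..1::real} t *\<^sub>R b (t, x) *\<^sub>R f x)"
proof (rule Bochner_Integration.integrable_bound)
  have f_m[measurable]: "f \<in> borel_measurable lborel" using borel_measurable_integrable[OF f] by simp
  have "sets (lborel \<Otimes>\<^sub>M lborel) = sets (borel :: (real \<times> (real^'n)) measure)"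
    by (simp add: borel_prod[symmetric] cong: sets_pair_measure_cong)
  then have b_m[measurable]: "b \<in> borel_measurable (lborel \<Otimes>\<^sub>M lborel)" using b(1) measurable_cong_sets by blast
  have i_m[measurable]: "(\<lambda>p. indicator {0..1::real} (fst p) :: real) \<in> borel_measurable (lborel \<Otimes>\<^sub>M (lborel :: (real^'n) measure))"
    by (rule measurable_compose[OF measurable_fst]) simp
  have fs_m[measurable]: "(\<lambda>p. f (snd p)) \<in> borel_measurable ((lborel :: real measure) \<Otimes>\<^sub>M lborel)"
    by (rule measurable_compose[OF measurable_snd f_m])
  show "integrable (lborel \<Otimes>\<^sub>M lborel) (\<lambda>(t, x). indicator {0..1::real} t *\<^sub>R (M * norm (f x)))"
  proof (rule lborel_pair.Fubini_integrable)
    show "(\<lambda>(t, x). indicat_real {0..1::real} t *\<^sub>R (M * norm (f x))) \<in> borel_measurable (lborel \<Otimes>\<^sub>M lborel)"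
      unfolding case_prod_beta' using i_m fs_m
      by (intro borel_measurable_scaleR borel_measurable_times borel_measurable_norm) auto
    have "integrable lborel (\<lambda>t. indicat_real {0..1::real} t *\<^sub>R (LINT x|lborel. \<bar>M\<bar> * norm (f x)))"
      by (intro integrable_scaleR_left integrable_real_indicator) auto
    then show "integrable lborel (\<lambda>t. LINT x|lborel. norm (case (t, x) of (t, x) \<Rightarrow> indicat_real {0..1::real} t *\<^sub>R (M * norm (f x))))"
      by (simp add: abs_mult)
    show "AE t in lborel. integrable lborel (\<lambda>x. case (t, x) of (t, x) \<Rightarrow> indicat_real {0..1::real} t *\<^sub>R (M * norm (f x)))"
      using f by simp
  qed
  show "(\<lambda>(t, x). indicat_real {0..1::real} t *\<^sub>R b (t, x) *\<^sub>R f x) \<in> borel_measurable (lborel \<Otimes>\<^sub>M lborel)"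
    unfolding case_prod_beta' prod.collapse by (intro borel_measurable_scaleR i_m fs_m b_m)
  have "norm (b (t, x) *\<^sub>R f x) \<le> norm (M * norm (f x))" for t x
    using b(2)[of "(t, x)"] by (auto simp: abs_mult intro!: mult_right_mono)
  then show "AE p in lborel \<Otimes>\<^sub>M lborel. norm (case p of (t, x) \<Rightarrow> indicat_real {0..1::real} t *\<^sub>R b (t, x) *\<^sub>R f x)
         \<le> norm (case p of (t, x) \<Rightarrow> indicat_real {0..1::real} t *\<^sub>R (M * norm (f x)))"
    by (intro AE_I2) (auto simp: indicator_def)
qed

lemma integrable_product_translate:
  fixes f :: "real^'n \<Rightarrow> 'b::euclidean_space"
  assumes f: "integrable lborel f"
  shows "integrable (lborel \<Otimes>\<^sub>M lborel) (\<lambda>(t, x). indicator {0..1::real} t *\<^sub>R f (x + (t * h) *\<^sub>R e))"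
proof (rule lborel_pair.Fubini_integrable)
  have f_m[measurable]: "f \<in> borel_measurable borel" using borel_measurable_integrable[OF f] by simp
  have tr: "integrable lborel (\<lambda>x. f (x + c))" "(LINT x|lborel. norm (f (x + c))) = (LINT x|lborel. norm (f x))" for c
    using integrable_translation[of f c] integral_translation[of "\<lambda>x. norm (f x)" c] f
    by (simp_all add: integrable_completion integral_completion add.commute)
  show "(\<lambda>(t, x). indicat_real {0..1::real} t *\<^sub>R f (x + (t * h) *\<^sub>R e)) \<in> borel_measurable (lborel \<Otimes>\<^sub>M lborel)"
  proof -
    have "(\<lambda>p. indicator {0..1::real} (fst p) :: real) \<in> borel_measurable (lborel \<Otimes>\<^sub>M (lborel :: (real^'n) measure))"
      by (rule measurable_compose[OF measurable_fst]) simp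
    moreover have "(\<lambda>p. snd p + (fst p * h) *\<^sub>R e) \<in> borel_measurable (lborel \<Otimes>\<^sub>M lborel)"
      by (intro borel_measurable_add borel_measurable_scaleR borel_measurable_times) 
        (auto intro: measurable_compose[OF measurable_fst] measurable_compose[OF measurable_snd])
    then have "(\<lambda>p. f (snd p + (fst p * h) *\<^sub>R e)) \<in> borel_measurable (lborel \<Otimes>\<^sub>M lborel)"
      by (rule measurable_compose[OF _ f_m])
    ultimately show ?thesis unfolding case_prod_beta' by (intro borel_measurable_scaleR)
  qed
  have "integrable lborel (\<lambda>t. indicat_real {0..1::real} t *\<^sub>R (LINT x|lborel. norm (f x)))"
    by (intro integrable_scaleR_left integrable_real_indicator) auto
  then show "integrable lborel (\<lambda>t. LINT x|lborel. norm (case (t, x) of (t, x) \<Rightarrow> indicat_real {0..1::real} t *\<^sub>R f (x + (t * h) *\<^sub>R e)))"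
    by (simp add: tr)
  show "AE t in lborel. integrable lborel (\<lambda>x. case (t, x) of (t, x) \<Rightarrow> indicat_real {0..1::real} t *\<^sub>R f (x + (t * h) *\<^sub>R e))"
    by (simp add: tr)
qed

text \<open>By Fubini the distance in the mean between f and its average over the segment from 0 to \<open>h e\<close> is
  at most the supremum over that segment of the distance between f and its translates.\<close>

lemma average_translate_tendsto:
  fixes f :: "real^'n \<Rightarrow> 'b::euclidean_space" and e :: "real^'n"
  assumes f: "integrable lborel f"
  defines "A \<equiv> \<lambda>h x. LINT t|lborel. indicator {0..1::real} t *\<^sub>R f (x + (t * h) *\<^sub>R e)"
  shows "((\<lambda>h. LINT x|lborel. norm (A h x - f x)) \<longlongrightarrow> 0) (at 0)" and "integrable lborel (A h)"
proof -
  have f_m[measurable]: "f \<in> borel_measurable borel" using borel_measurable_integrable[OF f] by simp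
  define \<omega> where "\<omega> s = (LINT x|lborel. norm (f (x + s *\<^sub>R e) - f x))" for s
  have tr: "integrable lborel (\<lambda>x. f (x + c))" for c
    using integrable_translation[of f c] f by (simp add: integrable_completion add.commute)
  note F = integrable_product_translate[OF f, where e=e]
  show A: "integrable lborel (A h)" for h
    unfolding A_def using lborel_pair.integrable_snd[OF F] by simp
  have "translation_continuous f"
    using f by (intro translation_continuous_integrable) (simp add: integrable_completion)
  then have tc: "((\<lambda>v. LINT x|lborel. norm (f (v + x) - f x)) \<longlongrightarrow> 0) (at 0)"
    by (simp add: translation_continuous_def integral_completion)
  have \<omega>: "\<exists>d>0. \<forall>s. \<bar>s\<bar> < d \<longrightarrow> \<omega> s \<le> \<epsilon>" if "\<epsilon> > 0" for \<epsilon>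
  proof -
    obtain d where d: "d > 0" "\<And>v. v \<noteq> 0 \<Longrightarrow> norm v < d \<Longrightarrow> (LINT x|lborel. norm (f (v + x) - f x)) < \<epsilon>"
      using tc \<open>\<epsilon> > 0\<close> unfolding tendsto_iff eventually_at by (auto simp: dist_real_def)
    have "\<omega> s \<le> \<epsilon>" if "\<bar>s\<bar> < d / (norm e + 1)" for s
    proof (cases "s *\<^sub>R e = 0")
      case True then show ?thesis using \<open>\<epsilon> > 0\<close> by (auto simp: \<omega>_def)
    next
      case False
      have "norm (s *\<^sub>R e) \<le> \<bar>s\<bar> * (norm e + 1)" by (simp add: mult_left_mono)
      also have "\<dots> < d" using that add_nonneg_pos[OF norm_ge_zero[of e] zero_less_one] by (simp add: field_simps)
      finally show ?thesis using d(2)[of "s *\<^sub>R e"] False by (simp add: \<omega>_def add.commute)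
    qed
    moreover have "d / (norm e + 1) > 0" using d(1) by (simp add: add_nonneg_pos)
    ultimately show ?thesis by blast
  qed
  have bound: "(LINT x|lborel. norm (A h x - f x)) \<le> \<epsilon>" if h: "\<And>s. \<bar>s\<bar> \<le> \<bar>h\<bar> \<Longrightarrow> \<omega> s \<le> \<epsilon>" for h \<epsilon>
  proof -
    define D where "D t x = indicator {0..1::real} t *\<^sub>R f (x + (t * h) *\<^sub>R e) - indicator {0..1::real} t *\<^sub>R 1 *\<^sub>R f x" for t x
    have Di: "integrable (lborel \<Otimes>\<^sub>M lborel) (\<lambda>(t, x). D t x)"
      using Bochner_Integration.integrable_diff[OF F integrable_product_bounded[OF f, of "\<lambda>_. 1" 1]]
      by (simp add: D_def case_prod_beta')
    then have nDi: "integrable (lborel \<Otimes>\<^sub>M lborel) (\<lambda>(t, x). norm (D t x))"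
      using integrable_norm[OF Di] by (simp add: case_prod_beta')
    have 1: "AE x in lborel. norm (A h x - f x) \<le> (LINT t|lborel. norm (D t x))"
      using lborel_pair.AE_integrable_snd[OF F[of h]]
    proof eventually_elim
      case (elim x)
      have "A h x - f x = (LINT t|lborel. D t x)"
        unfolding A_def D_def using elim by (subst Bochner_Integration.integral_diff) auto
      then show ?case by (simp add: integral_norm_bound)
    qed
    have 2: "(LINT x|lborel. norm (D t x)) \<le> indicator {0..1} t *\<^sub>R \<epsilon>" for t
    proof (cases "t \<in> {0..1}")
      case True
      have "\<bar>t * h\<bar> \<le> \<bar>h\<bar>" using True by (auto simp: abs_mult mult_left_le_one_le)
      then show ?thesis using h[of "t * h"] True by (simp add: D_def \<omega>_def)
    qed (simp add: D_def)
    have "(LINT x|lborel. norm (A h x - f x)) \<le> (LINT x|lborel. LINT t|lborel. norm (D t x))"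
      by (rule integral_mono_AE[OF _ lborel_pair.integrable_snd[OF nDi] 1]) (use A[of h] f in auto)
    also have "\<dots> = (LINT t|lborel. LINT x|lborel. norm (D t x))"
      by (rule lborel_pair.Fubini_integral[OF nDi])
    also have "\<dots> \<le> (LINT t|lborel. indicator {0..1::real} t *\<^sub>R \<epsilon>)"
      by (rule integral_mono[OF lborel_pair.integrable_fst[OF nDi] _ 2])
        (auto intro!: integrable_scaleR_left integrable_real_indicator)
    also have "\<dots> = \<epsilon>" by simp
    finally show ?thesis .
  qed
  show "((\<lambda>h. LINT x|lborel. norm (A h x - f x)) \<longlongrightarrow> 0) (at 0)"
  proof (rule tendstoI)
    fix \<epsilon> :: real assume "\<epsilon> > 0"
    then obtain d where d: "d > 0" "\<And>s. \<bar>s\<bar> < d \<Longrightarrow> \<omega> s \<le> \<epsilon> / 2" using \<omega>[of "\<epsilon>/2"] by auto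
    have "(LINT x|lborel. norm (A h x - f x)) \<le> \<epsilon> / 2" if "\<bar>h\<bar> < d" for h
      by (rule bound) (use d that in auto)
    then have "dist (LINT x|lborel. norm (A h x - f x)) 0 < \<epsilon>" if "\<bar>h\<bar> < d" for h
      using that \<open>\<epsilon> > 0\<close> by (force simp: dist_real_def)
    then show "\<forall>\<^sub>F h in at 0. dist (LINT x|lborel. norm (A h x - f x)) 0 < \<epsilon>"
      using d(1) unfolding eventually_at by (auto simp: dist_real_def)
  qed
qed

text \<open>The weak form of the fundamental theorem of calculus. Against a test function, move the
  translations onto the test function, use the weak derivative there, and apply the fundamental
  theorem of calculus to the test function along the segment. The fundamental lemma removes the test
  function.\<close>

lemma difference_eq_average:
  fixes U G :: "real^'n \<Rightarrow> 'b::euclidean_space"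
  assumes w: "has_weak_partial UNIV i U G" and U: "integrable lborel U" and G: "integrable lborel G"
  shows "AE x in lebesgue. U (x + h *\<^sub>R axis i 1) - U x = 
    h *\<^sub>R (LINT t|lborel. indicator {0..1::real} t *\<^sub>R G (x + (t * h) *\<^sub>R axis i 1))"
proof -
  define e :: "real^'n" where "e = axis i 1"
  define A where "A x = (LINT t|lborel. indicator {0..1::real} t *\<^sub>R G (x + (t * h) *\<^sub>R e))" for x
  have A: "integrable lborel A"
    unfolding A_def[abs_def] by (rule average_translate_tendsto(2)[OF G])
  have UL: "integrable lebesgue U" and GL: "integrable lebesgue G" and AL: "integrable lebesgue A"
    using U G A by (simp_all add: integrable_completion)
  have tr: "integrable lebesgue (\<lambda>x. U (x + c))" for c
    using integrable_translation[OF UL, of c] by (simp add: add.commute)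
  define W where "W x = U (x + h *\<^sub>R e) - U x - h *\<^sub>R A x" for x
  have W: "integrable lebesgue W"
    unfolding W_def by (intro Bochner_Integration.integrable_diff integrable_scaleR_right tr UL AL)
  have "AE x in lebesgue. x \<in> UNIV \<longrightarrow> W x = 0"
  proof (rule fundamental_lemma[OF open_UNIV integrable_imp_locally_integrable[OF W]])
    fix \<phi> :: "real^'n \<Rightarrow> real" assume \<phi>: "\<phi> \<in> test_functions UNIV"
    note \<phi>c = test_functions_translate[OF \<phi>]
    have Tint: "integrable lebesgue (\<lambda>x. \<psi> x *\<^sub>R f x)" if "\<psi> \<in> test_functions UNIV" "integrable lebesgue f"
      for \<psi> :: "real^'n \<Rightarrow> real" and f :: "real^'n \<Rightarrow> 'b"
      by (rule integrable_test_scaleR[OF that(1) integrable_imp_locally_integrable[OF that(2)]])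
    have Tborel: "(\<lambda>x. \<psi> x *\<^sub>R f x) \<in> borel_measurable lborel" if "\<psi> \<in> test_functions UNIV" "integrable lborel f"
      for \<psi> :: "real^'n \<Rightarrow> real" and f :: "real^'n \<Rightarrow> 'b"
      using test_functions_measurable[OF that(1)] borel_measurable_integrable[OF that(2)] by simp
    have shift: "(LINT x|lborel. \<phi> x *\<^sub>R f (x + c)) = (LINT x|lborel. \<phi> (x - c) *\<^sub>R f x)" if "integrable lborel f"
      for c and f :: "real^'n \<Rightarrow> 'b"
    proof -
      have i: "integrable lebesgue (\<lambda>x. \<phi> (x + (- c)) *\<^sub>R f x)"
        using that by (intro Tint[OF \<phi>c]) (simp add: integrable_completion)
      have "(LINT x|lebesgue. \<phi> (c + x + - c) *\<^sub>R f (c + x)) = (LINT x|lebesgue. \<phi> (x + (- c)) *\<^sub>R f x)"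
        by (rule integral_translation[OF i])
      moreover have "(\<lambda>x. \<phi> x *\<^sub>R f (x + c)) \<in> borel_measurable lborel"
        using test_functions_measurable[OF \<phi>] borel_measurable_integrable[OF that] by simp
      ultimately show ?thesis using Tborel[OF \<phi>c that, of "-c"] by (simp add: integral_completion add.commute)
    qed
    have F1: "integrable (lborel \<Otimes>\<^sub>M lborel) (\<lambda>(t, x). indicator {0..1::real} t *\<^sub>R \<phi> x *\<^sub>R G (x + (t * h) *\<^sub>R e))"
    proof -
      obtain M where M: "\<And>x. norm (\<phi> x) \<le> M" using test_functions_bounded[OF \<phi>] by blast
      note F = integrable_product_translate[OF G, of h e]
      show ?thesis
      proof (rule Bochner_Integration.integrable_bound[OF integrable_scaleR_right[OF F, of M]])
        have "(\<lambda>p. \<phi> (snd p)) \<in> borel_measurable ((lborel :: real measure) \<Otimes>\<^sub>M lborel)"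
          by (rule measurable_compose[OF measurable_snd]) (use test_functions_measurable[OF \<phi>] in simp)
        from borel_measurable_scaleR[OF this borel_measurable_integrable[OF F]]
        show "(\<lambda>(t, x). indicat_real {0..1::real} t *\<^sub>R \<phi> x *\<^sub>R G (x + (t * h) *\<^sub>R e)) \<in> borel_measurable (lborel \<Otimes>\<^sub>M lborel)"
          by (simp add: case_prod_beta' mult.commute)
        have "norm (\<phi> x *\<^sub>R y) \<le> norm (M *\<^sub>R y)" for x and y :: 'b
          using M[of x] by (auto intro!: mult_right_mono)
        then show "AE p in lborel \<Otimes>\<^sub>M lborel. norm (case p of (t, x) \<Rightarrow> indicat_real {0..1::real} t *\<^sub>R \<phi> x *\<^sub>R G (x + (t * h) *\<^sub>R e))
          \<le> norm (M *\<^sub>R (case p of (t, x) \<Rightarrow> indicat_real {0..1::real} t *\<^sub>R G (x + (t * h) *\<^sub>R e)))"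
          by (intro AE_I2) (auto simp: indicator_def)
      qed
    qed
    have F2: "integrable (lborel \<Otimes>\<^sub>M lborel) (\<lambda>(t, x). indicator {0..1::real} t *\<^sub>R partial_deriv i \<phi> (x - (t * h) *\<^sub>R e) *\<^sub>R U x)"
    proof -
      note d\<phi> = test_functions_partial_deriv[OF \<phi>, of i]
      obtain M where M: "\<And>x. norm (partial_deriv i \<phi> x) \<le> M" using test_functions_bounded[OF d\<phi>] by blast
      have "continuous_on UNIV (\<lambda>p::real \<times> (real^'n). partial_deriv i \<phi> (snd p - (fst p * h) *\<^sub>R e))"
        by (rule continuous_on_compose2[OF test_functions_continuous[OF d\<phi>, of UNIV]]) 
          (auto intro!: continuous_intros)
      then show ?thesis
        using integrable_product_bounded[OF U borel_measurable_continuous_onI, of "\<lambda>p. partial_deriv i \<phi> (snd p - (fst p * h) *\<^sub>R e)" M] M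
        by simp
    qed
    have "h *\<^sub>R (LINT x|lborel. \<phi> x *\<^sub>R A x) = h *\<^sub>R (LINT x|lborel. LINT t|lborel. indicator {0..1::real} t *\<^sub>R \<phi> x *\<^sub>R G (x + (t * h) *\<^sub>R e))"
      unfolding A_def by (simp add: integral_scaleR_right[symmetric] mult.commute del: integral_scaleR_right)
    also have "\<dots> = h *\<^sub>R (LINT t|lborel. LINT x|lborel. indicator {0..1::real} t *\<^sub>R \<phi> x *\<^sub>R G (x + (t * h) *\<^sub>R e))"
      by (simp only: lborel_pair.Fubini_integral[OF F1])
    also have "\<dots> = h *\<^sub>R (LINT t|lborel. LINT x|lborel. - (indicator {0..1::real} t *\<^sub>R partial_deriv i \<phi> (x - (t * h) *\<^sub>R e) *\<^sub>R U x))"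
    proof -
      have "(LINT x|lborel. \<phi> x *\<^sub>R G (x + (t * h) *\<^sub>R e)) = - (LINT x|lborel. partial_deriv i \<phi> (x - (t * h) *\<^sub>R e) *\<^sub>R U x)" for t
      proof -
        note \<phi>t = \<phi>c[of "- ((t * h) *\<^sub>R e)"]
        have "(LINT x|lebesgue. partial_deriv i (\<lambda>x. \<phi> (x + - ((t * h) *\<^sub>R e))) x *\<^sub>R U x) = - (LINT x|lebesgue. \<phi> (x + - ((t * h) *\<^sub>R e)) *\<^sub>R G x)"
          using w \<phi>t unfolding has_weak_partial_iff[OF open_UNIV] by blast
        then show ?thesis
          using shift[OF G, of "(t * h) *\<^sub>R e"] Tborel[OF \<phi>t G] Tborel[OF test_functions_partial_deriv[OF \<phi>t, of i] U]
          by (simp add: partial_deriv_translate[OF \<phi>, of i "- ((t * h) *\<^sub>R e)", simplified] integral_completion)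
      qed
      then show ?thesis by (simp del: scaleR_scaleR)
    qed
    also have "\<dots> = h *\<^sub>R - (LINT x|lborel. LINT t|lborel. indicator {0..1::real} t *\<^sub>R partial_deriv i \<phi> (x - (t * h) *\<^sub>R e) *\<^sub>R U x)"
      using lborel_pair.Fubini_integral[OF F2] by simp
    also have "\<dots> = - (LINT x|lborel. (LINT t|lborel. indicator {0..1::real} t *\<^sub>R (h * partial_deriv i \<phi> (x - (t * h) *\<^sub>R e))) *\<^sub>R U x)"
    proof -
      have "h *\<^sub>R (LINT t|lborel. indicator {0..1::real} t *\<^sub>R partial_deriv i \<phi> (x - (t * h) *\<^sub>R e) *\<^sub>R U x) =
        (LINT t|lborel. indicator {0..1::real} t *\<^sub>R (h * partial_deriv i \<phi> (x - (t * h) *\<^sub>R e))) *\<^sub>R U x" for x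
      proof -
        have "continuous_on {0..1::real} (\<lambda>t. partial_deriv i \<phi> (x - (t * h) *\<^sub>R e))"
          by (rule continuous_on_compose2[OF test_functions_continuous[OF test_functions_partial_deriv[OF \<phi>], of UNIV]])
            (auto intro!: continuous_on_diff continuous_on_scaleR continuous_on_mult continuous_on_const continuous_on_id)
        from borel_integrable_compact[OF _ this] 
        have int: "integrable lborel (\<lambda>t. indicator {0..1::real} t *\<^sub>R partial_deriv i \<phi> (x - (t * h) *\<^sub>R e))"
          by (simp add: mult.commute)
        have "(LINT t|lborel. indicator {0..1::real} t *\<^sub>R partial_deriv i \<phi> (x - (t * h) *\<^sub>R e) *\<^sub>R U x)
          = (LINT t|lborel. (indicator {0..1::real} t *\<^sub>R partial_deriv i \<phi> (x - (t * h) *\<^sub>R e)) *\<^sub>R U x)" by simp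
        also have "\<dots> = (LINT t|lborel. indicator {0..1::real} t *\<^sub>R partial_deriv i \<phi> (x - (t * h) *\<^sub>R e)) *\<^sub>R U x"
          by (rule integral_scaleR_left[OF int])
        finally show ?thesis 
          by (simp add: mult.left_commute[of _ h])
      qed
      then show ?thesis by (simp flip: integral_scaleR_right)
    qed
    also have "\<dots> = - (LINT x|lborel. (\<phi> x - \<phi> (x - h *\<^sub>R e)) *\<^sub>R U x)"
      by (simp only: e_def test_function_difference_eq_average[OF \<phi>])
    also have "\<dots> = (LINT x|lborel. \<phi> (x - h *\<^sub>R e) *\<^sub>R U x) - (LINT x|lborel. \<phi> x *\<^sub>R U x)"
    proof -
      have "(\<lambda>x. \<phi> (x - h *\<^sub>R e)) \<in> test_functions UNIV" using \<phi>c[of "- (h *\<^sub>R e)"] by simp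
      then have "integrable lborel (\<lambda>x. \<phi> x *\<^sub>R U x)" "integrable lborel (\<lambda>x. \<phi> (x - h *\<^sub>R e) *\<^sub>R U x)"
        using Tint[OF \<phi> UL] Tint[OF _ UL] Tborel[OF \<phi> U] Tborel[OF _ U] by (simp_all add: integrable_completion)
      then show ?thesis by (simp add: scaleR_diff_left)
    qed
    finally have hA: "h *\<^sub>R (LINT x|lborel. \<phi> x *\<^sub>R A x) = (LINT x|lborel. \<phi> x *\<^sub>R U (x + h *\<^sub>R e)) - (LINT x|lborel. \<phi> x *\<^sub>R U x)"
      by (simp add: shift[OF U])
    then show "(LINT x|lebesgue. \<phi> x *\<^sub>R W x) = 0"
    proof -
      have i: "integrable lebesgue (\<lambda>x. \<phi> x *\<^sub>R U (x + h *\<^sub>R e))" "integrable lebesgue (\<lambda>x. \<phi> x *\<^sub>R U x)" 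
        "integrable lebesgue (\<lambda>x. \<phi> x *\<^sub>R A x)"
        by (intro Tint[OF \<phi>] tr UL AL)+
      have "(\<lambda>x. \<phi> x *\<^sub>R U (x + h *\<^sub>R e)) \<in> borel_measurable lborel"
        using test_functions_measurable[OF \<phi>] borel_measurable_integrable[OF U] by simp
      then have c: "(LINT x|lebesgue. \<phi> x *\<^sub>R U (x + h *\<^sub>R e)) = (LINT x|lborel. \<phi> x *\<^sub>R U (x + h *\<^sub>R e))"
        "(LINT x|lebesgue. \<phi> x *\<^sub>R U x) = (LINT x|lborel. \<phi> x *\<^sub>R U x)"
        "(LINT x|lebesgue. \<phi> x *\<^sub>R A x) = (LINT x|lborel. \<phi> x *\<^sub>R A x)"
        using Tborel[OF \<phi> U] Tborel[OF \<phi> A] by (simp_all add: integral_completion)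
      have "(LINT x|lebesgue. \<phi> x *\<^sub>R W x) = (LINT x|lebesgue. \<phi> x *\<^sub>R U (x + h *\<^sub>R e) - \<phi> x *\<^sub>R U x - h *\<^sub>R (\<phi> x *\<^sub>R A x))"
        by (simp add: W_def scaleR_diff_right mult.commute)
      also have "\<dots> = (LINT x|lebesgue. \<phi> x *\<^sub>R U (x + h *\<^sub>R e)) - (LINT x|lebesgue. \<phi> x *\<^sub>R U x) - h *\<^sub>R (LINT x|lebesgue. \<phi> x *\<^sub>R A x)"
        using i by (simp del: scaleR_scaleR)
      finally show ?thesis using hA unfolding c by simp
    qed
  qed
  then show ?thesis unfolding W_def A_def e_def by simp
qed

text \<open>Difference quotients are averages of the weak derivative over short segments, and such averages
  converge in the mean. Borel representatives are used because the averages involve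
  measurability in the pair of translation parameter and point.\<close>

lemma difference_quotient_tendsto:
  fixes U G :: "real^'n \<Rightarrow> 'b::euclidean_space"
  assumes w: "has_weak_partial UNIV i U G" and U: "integrable lebesgue U" and G: "integrable lebesgue G"
  shows "((\<lambda>h. LINT x|lebesgue. norm ((U (x + h *\<^sub>R axis i 1) - U x) /\<^sub>R h - G x)) \<longlongrightarrow> 0) (at 0)"
proof -
  obtain U' where U'm: "U' \<in> borel_measurable borel" and U': "AE x in lebesgue. U x = U' x"
    using AE_eq_borel[OF borel_measurable_integrable[OF U]] by blast
  obtain G' where G'm: "G' \<in> borel_measurable borel" and G': "AE x in lebesgue. G x = G' x"
    using AE_eq_borel[OF borel_measurable_integrable[OF G]] by blast
  have Ui: "integrable lborel U'" and Gi: "integrable lborel G'"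
    using integrable_lebesgue_AE_cong(1)[OF U U'] integrable_lebesgue_AE_cong(1)[OF G G'] U'm G'm
    by (simp_all add: integrable_completion)
  have w': "has_weak_partial UNIV i U' G'"
    using has_weak_partial_AE_cong[OF open_UNIV w, of U' G'] U' G' by simp
  define A where "A h x = (LINT t|lborel. indicator {0..1::real} t *\<^sub>R G' (x + (t * h) *\<^sub>R axis i 1))" for h x
  have A: "integrable lborel (A h)" for h
    unfolding A_def[abs_def] by (rule average_translate_tendsto(2)[OF Gi])
  have "((\<lambda>h. LINT x|lborel. norm (A h x - G' x)) \<longlongrightarrow> 0) (at 0)"
    unfolding A_def by (rule average_translate_tendsto(1)[OF Gi])
  moreover have "\<forall>\<^sub>F h in at 0. (LINT x|lborel. norm (A h x - G' x)) = (LINT x|lebesgue. norm ((U (x + h *\<^sub>R axis i 1) - U x) /\<^sub>R h - G x))"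
    unfolding eventually_at_filter
  proof (intro always_eventually allI impI)
    fix h :: real assume "h \<noteq> 0"
    have "(LINT x|lborel. norm (A h x - G' x)) = (LINT x|lebesgue. norm (A h x - G' x))"
      using A Gi by (intro integral_completion[symmetric] borel_measurable_integrable integrable_norm Bochner_Integration.integrable_diff)
    also have "\<dots> = (LINT x|lebesgue. norm ((U (x + h *\<^sub>R axis i 1) - U x) /\<^sub>R h - G x))"
    proof (rule integrable_lebesgue_AE_cong(2))
      have "integrable lebesgue (\<lambda>x. U (x + h *\<^sub>R axis i 1))"
        using integrable_translation[OF U, of "h *\<^sub>R axis i 1"] by (simp add: add.commute)
      then show "integrable lebesgue (\<lambda>x. norm ((U (x + h *\<^sub>R axis i 1) - U x) /\<^sub>R h - G x))"
        using U G by auto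
      have U'h: "AE x in lebesgue. U (x + h *\<^sub>R axis i 1) = U' (x + h *\<^sub>R axis i 1)"
        using AE_lebesgue_translation[OF U', of "h *\<^sub>R axis i 1"] by (simp add: add.commute)
      show "AE x in lebesgue. norm ((U (x + h *\<^sub>R axis i 1) - U x) /\<^sub>R h - G x) = norm (A h x - G' x)"
        using difference_eq_average[OF w' Ui Gi, of h] U'h U' G'
      proof eventually_elim
        case (elim x)
        then show ?case using \<open>h \<noteq> 0\<close> by (simp add: A_def)
      qed
    qed
    finally show "(LINT x|lborel. norm (A h x - G' x)) = (LINT x|lebesgue. norm ((U (x + h *\<^sub>R axis i 1) - U x) /\<^sub>R h - G x))" .
  qed
  ultimately show ?thesis by (rule Lim_transform_eventually)
qed

section \<open>The chain rule\<close>

text \<open>Cover the compact set by finitely many balls with cut-off functions \<open>\<beta>\<close> and take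
  \<open>1 - \<Prod> (1 - \<beta>)\<close>, which is 1 wherever one factor is.\<close>

lemma cutoff_near_compact:
  fixes K :: "'a::euclidean_space set"
  assumes "compact K" "open \<Omega>" "K \<subseteq> \<Omega>"
  obtains \<theta> :: "'a \<Rightarrow> real" and V where "\<theta> \<in> test_functions \<Omega>" "open V" "K \<subseteq> V" "V \<subseteq> \<Omega>" "\<And>x. x \<in> V \<Longrightarrow> \<theta> x = 1"
proof -
  have "\<exists>r>0. cball x (2 * r) \<subseteq> \<Omega>" if x: "x \<in> K" for x
  proof -
    obtain e where "e > 0" "cball x e \<subseteq> \<Omega>" using assms(2,3) x by (meson open_contains_cball subsetD)
    then show ?thesis by (intro exI[of _ "e/2"]) auto
  qed
  then obtain r where r: "\<And>x. x \<in> K \<Longrightarrow> r x > 0" "\<And>x. x \<in> K \<Longrightarrow> cball x (2 * r x) \<subseteq> \<Omega>" by metis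
  obtain F where F: "F \<subseteq> K" "finite F" "K \<subseteq> (\<Union>x\<in>F. ball x (r x))"
  proof -
    have "K \<subseteq> (\<Union>x\<in>K. ball x (r x))" using r(1) by force
    then show ?thesis using compactE_image[OF assms(1), of K "\<lambda>x. ball x (r x)"] that by blast
  qed
  have "\<exists>\<beta> :: 'a \<Rightarrow> real. (\<forall>k. Ck_on k \<beta> UNIV) \<and> (\<forall>y\<in>cball x (r x). \<beta> y = 1) \<and> (\<forall>y. y \<notin> ball x (2 * r x) \<longrightarrow> \<beta> y = 0)" if "x \<in> F" for x
  proof -
    have "r x > 0" using that F(1) r(1) by blast
    then have "r x < 2 * r x" by simp
    from smooth_cutoff[OF \<open>r x > 0\<close> this, of x] show ?thesis by metis
  qed
  then obtain \<beta> :: "'a \<Rightarrow> 'a \<Rightarrow> real" where \<beta>: "\<And>x k. x \<in> F \<Longrightarrow> Ck_on k (\<beta> x) UNIV" 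
    "\<And>x y. x \<in> F \<Longrightarrow> y \<in> cball x (r x) \<Longrightarrow> \<beta> x y = 1" "\<And>x y. x \<in> F \<Longrightarrow> y \<notin> ball x (2 * r x) \<Longrightarrow> \<beta> x y = 0"
    by metis
  define \<theta> where "\<theta> y = 1 + (-1) * (\<Prod>x\<in>F. 1 + (-1) * \<beta> x y)" for y
  show ?thesis
  proof
    show "\<theta> \<in> test_functions \<Omega>"
    proof (rule test_functionsI[where K="\<Union>x\<in>F. cball x (2 * r x)"])
      have "Ck_on k (\<lambda>y. 1 + (-1) * \<beta> x y) UNIV" if "x \<in> F" for k x
        by (rule Ck_on_add[OF open_UNIV Ck_on_const[OF open_UNIV] Ck_on_mult[OF open_UNIV Ck_on_const[OF open_UNIV] \<beta>(1)[OF that]]])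
      then show "Ck_on k \<theta> UNIV" for k
        unfolding \<theta>_def
        by (rule Ck_on_add[OF open_UNIV Ck_on_const[OF open_UNIV] Ck_on_mult[OF open_UNIV Ck_on_const[OF open_UNIV] Ck_on_prod[OF F(2) open_UNIV]]])
      show "compact (\<Union>x\<in>F. cball x (2 * r x))" using F(2) by (intro compact_UN) auto
      show "(\<Union>x\<in>F. cball x (2 * r x)) \<subseteq> \<Omega>" using F(1) r(2) by blast
      show "\<theta> y = 0" if "y \<notin> (\<Union>x\<in>F. cball x (2 * r x))" for y
      proof -
        have "\<beta> x y = 0" if "x \<in> F" for x
        proof (rule \<beta>(3)[OF that])
          show "y \<notin> ball x (2 * r x)" using \<open>y \<notin> _\<close> that by auto
        qed
        then show ?thesis by (simp add: \<theta>_def)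
      qed
    qed
    show "open (\<Union>x\<in>F. ball x (r x))" by blast
    show "K \<subseteq> (\<Union>x\<in>F. ball x (r x))" by (rule F(3))
    have "ball x (r x) \<subseteq> \<Omega>" if "x \<in> F" for x
      using r[of x] F(1) that by (force simp: subset_iff)
    then show "(\<Union>x\<in>F. ball x (r x)) \<subseteq> \<Omega>" by blast
    show "\<theta> y = 1" if y: "y \<in> (\<Union>x\<in>F. ball x (r x))" for y
    proof -
      obtain x where x: "x \<in> F" "y \<in> ball x (r x)" using y by blast
      then have "\<beta> x y = 1" using \<beta>(2)[OF x(1)] by auto
      then have "(\<Prod>x\<in>F. 1 + (-1) * \<beta> x y) = 0" using x(1) F(2) by (intro prod_zero) auto
      then show ?thesis by (simp add: \<theta>_def)
    qed
  qed
qed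

lemma compact_translates_in_open:
  fixes K :: "'a::euclidean_space set"
  assumes "compact K" "open V" "K \<subseteq> V"
  obtains d where "d > 0" "\<And>x v. x \<in> K \<Longrightarrow> norm v < d \<Longrightarrow> x + v \<in> V"
proof (cases "K = {}")
  case True then show ?thesis using that[of 1] by simp
next
  case False
  obtain d where "d > 0" "(\<Union>x\<in>K. ball x d) \<subseteq> V"
    using compact_subset_open_imp_ball_epsilon_subset[OF assms] by blast
  then show ?thesis using that[of d] by (force simp: dist_norm)
qed

text \<open>Only differentiability at the single point y is used: the remainder is \<open>norm (z - y)\<close> times a
  function continuous at y with value zero there.\<close>

lemma difference_quotient_differentiable:
  fixes F :: "'b::real_normed_vector \<Rightarrow> 'c::real_normed_vector"
  assumes F: "(F has_derivative F') (at y)" and h: "h \<longlonglongrightarrow> 0" "\<And>k. h k \<noteq> 0"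
    and z: "(\<lambda>k. (z k - y) /\<^sub>R h k) \<longlonglongrightarrow> v"
  shows "(\<lambda>k. (F (z k) - F y) /\<^sub>R h k) \<longlonglongrightarrow> F' v"
proof -
  interpret F': bounded_linear F' using F has_derivative_bounded_linear by blast
  define r where "r w = (if w = y then 0 else (F w - F y - F' (w - y)) /\<^sub>R norm (w - y))" for w
  have "((\<lambda>w. (F w - F y - F' (w - y)) /\<^sub>R norm (w - y)) \<longlongrightarrow> 0) (at y)"
    using F by (simp add: has_derivative_at_within)
  then have "(r \<longlongrightarrow> 0) (at y)"
    by (rule Lim_transform_eventually) (auto simp: r_def eventually_at_filter)
  then have "isCont r y" by (simp add: isCont_def r_def)
  moreover have "z \<longlonglongrightarrow> y"
  proof -
    have "(\<lambda>k. h k *\<^sub>R ((z k - y) /\<^sub>R h k) + y) \<longlonglongrightarrow> 0 *\<^sub>R v + y" by (intro tendsto_intros h z)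
    then show ?thesis using h(2) by simp
  qed
  ultimately have "(\<lambda>k. r (z k)) \<longlonglongrightarrow> 0"
    using isCont_tendsto_compose[of y r z sequentially] by (simp add: r_def)
  moreover have "(\<lambda>k. norm ((z k - y) /\<^sub>R h k)) \<longlonglongrightarrow> norm v" by (intro tendsto_norm z)
  ultimately have "(\<lambda>k. norm ((z k - y) /\<^sub>R h k) *\<^sub>R r (z k)) \<longlonglongrightarrow> norm v *\<^sub>R 0" by (intro tendsto_scaleR)
  from tendsto_norm_zero[OF this[unfolded scaleR_zero_right]]
  have "(\<lambda>k. norm (norm ((z k - y) /\<^sub>R h k) *\<^sub>R r (z k))) \<longlonglongrightarrow> 0" .
  moreover have "norm (norm ((z k - y) /\<^sub>R h k) *\<^sub>R r (z k)) = norm ((F (z k) - F y) /\<^sub>R h k - F' ((z k - y) /\<^sub>R h k))" for k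
  proof -
    have "F (z k) - F y - F' (z k - y) = norm (z k - y) *\<^sub>R r (z k)" by (simp add: r_def F'.zero)
    moreover have "(F (z k) - F y) /\<^sub>R h k - F' ((z k - y) /\<^sub>R h k) = (F (z k) - F y - F' (z k - y)) /\<^sub>R h k"
      unfolding F'.scaleR by (simp add: scaleR_diff_right)
    ultimately show ?thesis by (simp add: abs_mult)
  qed
  ultimately have "(\<lambda>k. norm ((F (z k) - F y) /\<^sub>R h k - F' ((z k - y) /\<^sub>R h k))) \<longlonglongrightarrow> 0" by simp
  then have "(\<lambda>k. (F (z k) - F y) /\<^sub>R h k - F' ((z k - y) /\<^sub>R h k)) \<longlonglongrightarrow> 0" by (rule tendsto_norm_zero_cancel)
  from tendsto_add[OF this F'.tendsto[OF z]] show ?thesis by simp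
qed

text \<open>F need not be measurable off C, so it is replaced by zero there; this alters the
  composition on a null set only. Growth is at most linear by the Lipschitz condition.\<close>

lemma locally_integrable_lipschitz_compose:
  fixes u :: "real^'n \<Rightarrow> 'b::euclidean_space" and F :: "'b \<Rightarrow> 'c::euclidean_space"
  assumes u: "u locally_integrable_on \<Omega>" and C: "closed C" "AE x in lebesgue. x \<in> \<Omega> \<longrightarrow> u x \<in> C"
    and F: "\<And>y z. y \<in> C \<Longrightarrow> z \<in> C \<Longrightarrow> norm (F y - F z) \<le> L * norm (y - z)"
  shows "(\<lambda>x. F (u x)) locally_integrable_on \<Omega>"
  unfolding locally_integrable_on_indicator
proof (intro allI impI, elim conjE)
  fix K assume K: "compact K" "K \<subseteq> \<Omega>"
  define F0 where "F0 y = (if y \<in> C then F y else 0)" for y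
  obtain a where a: "\<And>y. y \<in> C \<Longrightarrow> norm (F y) \<le> a + \<bar>L\<bar> * norm y"
  proof (cases "C = {}")
    case True then show ?thesis using that by blast
  next
    case False
    then obtain y0 where y0: "y0 \<in> C" by blast
    have "norm (F y) \<le> (norm (F y0) + \<bar>L\<bar> * norm y0) + \<bar>L\<bar> * norm y" if "y \<in> C" for y
    proof -
      have "norm (F y) \<le> norm (F y0) + norm (F y - F y0)" by (metis add.commute diff_add_cancel norm_triangle_ineq)
      also have "norm (F y - F y0) \<le> \<bar>L\<bar> * norm (y - y0)"
        using F[OF that y0] mult_right_mono[OF abs_ge_self[of L] norm_ge_zero[of "y - y0"]] by linarith
      also have "\<dots> \<le> \<bar>L\<bar> * (norm y + norm y0)" by (intro mult_left_mono norm_triangle_ineq4) auto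
      finally show ?thesis by (simp add: algebra_simps)
    qed
    then show ?thesis using that by blast
  qed
  have "continuous_on C F"
  proof (rule continuous_onI)
    fix x and e :: real assume "x \<in> C" "e > 0"
    have "\<bar>L\<bar> + 1 > 0" by simp
    have "dist (F x') (F x) \<le> e" if "x' \<in> C" "dist x' x < e / (\<bar>L\<bar> + 1)" for x'
    proof -
      have "dist (F x') (F x) \<le> L * dist x' x" using F[OF that(1) \<open>x \<in> C\<close>] by (simp add: dist_norm)
      also have "\<dots> \<le> (\<bar>L\<bar> + 1) * dist x' x" by (intro mult_right_mono) auto
      also have "\<dots> \<le> e" using that(2) \<open>\<bar>L\<bar> + 1 > 0\<close> by (simp add: field_simps)
      finally show ?thesis .
    qed
    then show "\<exists>d>0. \<forall>x'\<in>C. dist x' x < d \<longrightarrow> dist (F x') (F x) \<le> e"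
      using \<open>e > 0\<close> \<open>\<bar>L\<bar> + 1 > 0\<close> by (intro exI[of _ "e / (\<bar>L\<bar> + 1)"]) auto
  qed
  then have F0m: "F0 \<in> borel_measurable borel"
    unfolding F0_def using C(1) by (intro borel_measurable_continuous_on_if) auto
  have uK: "integrable lebesgue (\<lambda>x. indicator K x *\<^sub>R u x)" 
    using u K by (simp add: locally_integrable_on_indicator)
  have KL: "K \<in> sets lebesgue" "emeasure lebesgue K < \<infinity>"
    using lmeasurable_compact[OF K(1)] by (auto simp: fmeasurable_def)
  have "integrable lebesgue (\<lambda>x. indicator K x *\<^sub>R F0 (indicator K x *\<^sub>R u x))"
  proof (rule Bochner_Integration.integrable_bound)
    show "integrable lebesgue (\<lambda>x. indicator K x *\<^sub>R \<bar>a\<bar> + \<bar>L\<bar> * norm (indicator K x *\<^sub>R u x))"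
      by (intro Bochner_Integration.integrable_add integrable_mult_right integrable_norm uK integrable_scaleR_left 
          integrable_real_indicator KL)
    show "(\<lambda>x. indicator K x *\<^sub>R F0 (indicator K x *\<^sub>R u x)) \<in> borel_measurable lebesgue"
      using KL(1) measurable_compose[OF borel_measurable_integrable[OF uK] F0m]
      by (intro borel_measurable_scaleR borel_measurable_indicator)
    have "norm (F0 y) \<le> \<bar>a\<bar> + \<bar>L\<bar> * norm y" for y
      using a[of y] by (auto simp: F0_def)
    then show "AE x in lebesgue. norm (indicator K x *\<^sub>R F0 (indicator K x *\<^sub>R u x))
       \<le> norm (indicator K x *\<^sub>R \<bar>a\<bar> + \<bar>L\<bar> * norm (indicator K x *\<^sub>R u x))"
      by (intro AE_I2) (auto simp: indicator_def)
  qed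
  moreover have "AE x in lebesgue. indicator K x *\<^sub>R F0 (indicator K x *\<^sub>R u x) = indicator K x *\<^sub>R F (u x)"
    using C(2) by eventually_elim (use K(2) in \<open>auto simp: indicator_def F0_def\<close>)
  ultimately show "integrable lebesgue (\<lambda>x. indicator K x *\<^sub>R F (u x))"
    by (rule integrable_lebesgue_AE_cong(1))
qed

text \<open>On a neighbourhood V of the compact set K the function agrees with a globally integrable Sobolev
  function U. Small translates of K stay in V. Passing to a subsequence makes the difference quotients
  converge almost everywhere as well as in the mean.\<close>

lemma difference_quotient_converges_near:
  fixes u :: "real^'n \<Rightarrow> 'b::euclidean_space"
  assumes \<Omega>: "open \<Omega>" and w: "has_weak_partial \<Omega> i u g" and K: "compact K" "K \<subseteq> \<Omega>"
  obtains h :: "nat \<Rightarrow> real" and V U G K'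
  where "h \<longlonglongrightarrow> 0" "\<And>k. h k \<noteq> 0" "open V" "K \<subseteq> V" "V \<subseteq> K'" "compact K'" "K' \<subseteq> \<Omega>" 
    "\<And>x k. x \<in> K \<Longrightarrow> x + h k *\<^sub>R axis i 1 \<in> V"
    "\<And>x. x \<in> V \<Longrightarrow> U x = u x" "\<And>x. x \<in> V \<Longrightarrow> G x = g x"
    "integrable lebesgue U" "integrable lebesgue G"
    "(\<lambda>k. LINT x|lebesgue. norm ((U (x + h k *\<^sub>R axis i 1) - U x) /\<^sub>R h k - G x)) \<longlonglongrightarrow> 0"
    "AE x in lebesgue. (\<lambda>k. (U (x + h k *\<^sub>R axis i 1) - U x) /\<^sub>R h k - G x) \<longlonglongrightarrow> 0"
proof -
  obtain \<theta> :: "real^'n \<Rightarrow> real" and V where \<theta>: "\<theta> \<in> test_functions \<Omega>" "open V" "K \<subseteq> V" "V \<subseteq> \<Omega>" "\<And>x. x \<in> V \<Longrightarrow> \<theta> x = 1"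
    using cutoff_near_compact[OF K(1) \<Omega> K(2)] by blast
  obtain K' where K': "compact K'" "K' \<subseteq> \<Omega>" "\<And>x. x \<notin> K' \<Longrightarrow> \<theta> x = 0"
    using \<theta>(1) unfolding test_functions_def by blast
  define U where "U x = \<theta> x *\<^sub>R u x" for x
  define G where "G x = \<theta> x *\<^sub>R g x + partial_deriv i \<theta> x *\<^sub>R u x" for x
  note UG = has_weak_partial_cutoff_UNIV[OF \<Omega> w \<theta>(1), folded U_def G_def]
  have d\<theta>: "partial_deriv i \<theta> x = 0" if "x \<in> V" for x
  proof -
    have "(\<theta> has_derivative (\<lambda>v. 0)) (at x)"
      by (rule has_derivative_transform_within_open[OF has_derivative_const[of 1] \<theta>(2) that]) (simp add: \<theta>(5))
    from partial_deriv_eqI[OF this] show ?thesis .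
  qed
  obtain d where d: "d > 0" "\<And>x v. x \<in> K \<Longrightarrow> norm v < d \<Longrightarrow> x + v \<in> V"
    using compact_translates_in_open[OF K(1) \<theta>(2,3)] by blast
  define t where "t k = min d 1 * inverse (real (Suc (Suc k)))" for k
  have t: "t k \<noteq> 0" "\<bar>t k\<bar> < d" for k
  proof -
    have "inverse (real (Suc (Suc k))) < 1" by (simp add: inverse_less_1_iff)
    then have "t k < min d 1 * 1" unfolding t_def using d(1) by (intro mult_strict_left_mono) auto
    moreover have "t k > 0" using d(1) by (simp add: t_def)
    ultimately show "t k \<noteq> 0" "\<bar>t k\<bar> < d" by auto
  qed
  have t0: "t \<longlonglongrightarrow> 0"
    unfolding t_def by (rule tendsto_mult_right_zero[OF LIMSEQ_Suc[OF LIMSEQ_inverse_real_of_nat]])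
  then have "filterlim t (at 0) sequentially" using t(1) by (intro filterlim_atI) auto
  from filterlim_compose[OF difference_quotient_tendsto[OF UG] this]
  have L: "(\<lambda>k. LINT x|lebesgue. norm ((U (x + t k *\<^sub>R axis i 1) - U x) /\<^sub>R t k - G x)) \<longlonglongrightarrow> 0" .
  have "integrable lebesgue (\<lambda>x. (U (x + t k *\<^sub>R axis i 1) - U x) /\<^sub>R t k - G x)" for k
    using UG(2,3) integrable_translation[OF UG(2), of "t k *\<^sub>R axis i 1"]
    by (intro Bochner_Integration.integrable_diff integrable_scaleR_right) (auto simp: add.commute)
  from tendsto_L1_AE_subseq[OF this L] obtain r :: "nat \<Rightarrow> nat" where r: "strict_mono r"
    "AE x in lebesgue. (\<lambda>k. (U (x + t (r k) *\<^sub>R axis i 1) - U x) /\<^sub>R t (r k) - G x) \<longlonglongrightarrow> 0"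
    by blast
  show ?thesis
  proof (rule that[of "t \<circ> r" V K' U G])
    show "(t \<circ> r) \<longlonglongrightarrow> 0" using LIMSEQ_subseq_LIMSEQ[OF t0 r(1)] .
    show "(\<lambda>k. LINT x|lebesgue. norm ((U (x + (t \<circ> r) k *\<^sub>R axis i 1) - U x) /\<^sub>R (t \<circ> r) k - G x)) \<longlonglongrightarrow> 0"
      using LIMSEQ_subseq_LIMSEQ[OF L r(1)] by (simp add: comp_def)
    show "V \<subseteq> K'" using \<theta>(5) K'(3) by force
    show "x + (t \<circ> r) k *\<^sub>R axis i 1 \<in> V" if "x \<in> K" for x k
      using d(2)[OF that, of "t (r k) *\<^sub>R axis i 1"] t(2) by simp
    show "U x = u x" "G x = g x" if "x \<in> V" for x using \<theta>(5)[OF that] d\<theta>[OF that] by (auto simp: U_def G_def)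
  qed (use r t \<theta> K' UG in auto)
qed

text \<open>Along a sequence of step sizes for which the difference quotients of u converge almost everywhere,
  the difference quotients of \<open>F u\<close> converge to the asserted derivative, since F is differentiable at the
  points of C. The Lipschitz condition on C bounds them by L times those of u, which converge in the
  mean. So the limit may be taken under the integral with a test function, and moving the difference
  quotient onto the test function identifies the limit as the weak derivative.\<close>

theorem has_weak_partial_chain:
  fixes u :: "real^'n \<Rightarrow> 'b::euclidean_space" and F :: "'b \<Rightarrow> 'c::euclidean_space"
  assumes \<Omega>: "open \<Omega>" and w: "has_weak_partial \<Omega> i u g"
    and C: "closed C" "AE x in lebesgue. x \<in> \<Omega> \<longrightarrow> u x \<in> C"
    and lip: "\<And>y z. y \<in> C \<Longrightarrow> z \<in> C \<Longrightarrow> norm (F y - F z) \<le> L * norm (y - z)"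
    and diff: "\<And>y. y \<in> C \<Longrightarrow> F differentiable (at y)"
  shows "has_weak_partial \<Omega> i (\<lambda>x. F (u x)) (\<lambda>x. frechet_derivative F (at (u x)) (g x))"
proof -
  note H = w[unfolded has_weak_partial_iff[OF \<Omega>]]
  define Q where "Q x = frechet_derivative F (at (u x)) (g x)" for x
  have L0: "norm (F y - F z) \<le> \<bar>L\<bar> * norm (y - z)" if "y \<in> C" "z \<in> C" for y z
    using lip[OF that] mult_right_mono[OF abs_ge_self[of L] norm_ge_zero[of "y - z"]] by linarith
  have Fu: "(\<lambda>x. F (u x)) locally_integrable_on \<Omega>"
    by (rule locally_integrable_lipschitz_compose[OF _ C lip]) (use H in auto)
  have key: "integrable lebesgue (\<lambda>x. indicator K x *\<^sub>R Q x) \<and>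
    (\<forall>\<phi>::real^'n \<Rightarrow> real. \<phi> \<in> test_functions \<Omega> \<and> (\<forall>x. x \<notin> K \<longrightarrow> \<phi> x = 0) \<longrightarrow>
      (LINT x|lebesgue. partial_deriv i \<phi> x *\<^sub>R F (u x)) = - (LINT x|lebesgue. \<phi> x *\<^sub>R Q x))"
    if K: "compact K" "K \<subseteq> \<Omega>" for K
  proof -
    define e :: "real^'n" where "e = axis i 1"
    obtain h V U G K' where h: "h \<longlonglongrightarrow> 0" "\<And>k::nat. h k \<noteq> 0" 
      and V: "open V" "K \<subseteq> V" "V \<subseteq> K'" and K': "compact K'" "K' \<subseteq> \<Omega>"
      and hV: "\<And>x k. x \<in> K \<Longrightarrow> x + h k *\<^sub>R e \<in> V"
      and UV: "\<And>x. x \<in> V \<Longrightarrow> U x = u x" "\<And>x. x \<in> V \<Longrightarrow> G x = g x"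
      and UG: "integrable lebesgue U" "integrable lebesgue G"
      and lim: "(\<lambda>k. LINT x|lebesgue. norm ((U (x + h k *\<^sub>R e) - U x) /\<^sub>R h k - G x)) \<longlonglongrightarrow> 0"
        "AE x in lebesgue. (\<lambda>k. (U (x + h k *\<^sub>R e) - U x) /\<^sub>R h k - G x) \<longlonglongrightarrow> 0"
      unfolding e_def by (rule difference_quotient_converges_near[OF \<Omega> w K]) blast
    define P where "P x = indicator K' x *\<^sub>R F (u x)" for x
    have P: "integrable lebesgue P"
      unfolding P_def using Fu K' by (simp add: locally_integrable_on_indicator)
    have Ph: "integrable lebesgue (\<lambda>x. P (x + c))" for c
      using integrable_translation[OF P, of c] by (simp add: add.commute)
    have Uh: "integrable lebesgue (\<lambda>x. U (x + c))" for c
      using integrable_translation[OF UG(1), of c] by (simp add: add.commute)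
    define q where "q k x = indicator K x *\<^sub>R ((P (x + h k *\<^sub>R e) - P x) /\<^sub>R h k)" for k x
    define q0 where "q0 x = indicator K x *\<^sub>R Q x" for x
    define D where "D k x = (U (x + h k *\<^sub>R e) - U x) /\<^sub>R h k" for k x
    have Di: "integrable lebesgue (\<lambda>x. D k x - G x)" for k
      unfolding D_def by (intro Bochner_Integration.integrable_diff integrable_scaleR_right Uh UG)
    have KL: "K \<in> sets lebesgue" using K(1) by (rule sets_lebesgue_compact)
    have qi: "integrable lebesgue (q k)" for k
      unfolding q_def 
      by (intro integrable_mult_indicator[OF KL] integrable_scaleR_right Bochner_Integration.integrable_diff Ph P)
    have "AE x in lebesgue. \<forall>k. x + h k *\<^sub>R e \<in> \<Omega> \<longrightarrow> u (x + h k *\<^sub>R e) \<in> C"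
      unfolding AE_all_countable
    proof
      fix k show "AE x in lebesgue. x + h k *\<^sub>R e \<in> \<Omega> \<longrightarrow> u (x + h k *\<^sub>R e) \<in> C"
        using AE_lebesgue_translation[OF C(2), of "h k *\<^sub>R e"] by (simp add: add.commute)
    qed
    with C(2) lim(2) have pw: "AE x in lebesgue. q0 x = lim (\<lambda>k. q k x) \<and> (\<lambda>k. q k x) \<longlonglongrightarrow> q0 x \<and>
       (\<forall>k. norm (q k x) \<le> \<bar>L\<bar> * norm (D k x)) \<and> norm (q0 x) \<le> \<bar>L\<bar> * norm (G x)"
    proof eventually_elim
      case (elim x)
      show ?case
      proof (cases "x \<in> K")
        case False
        then have z: "q k x = 0" "q0 x = 0" for k by (auto simp: q_def q0_def)
        then have "(\<lambda>k. q k x) \<longlonglongrightarrow> q0 x" by simp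
        then show ?thesis using z limI by force
      next
        case True
        then have x: "x \<in> V" "\<And>k. x + h k *\<^sub>R e \<in> V" using V(2) hV by auto
        then have xK': "x \<in> K'" "\<And>k. x + h k *\<^sub>R e \<in> K'" using V(3) by auto
        have uC: "u x \<in> C" "\<And>k. u (x + h k *\<^sub>R e) \<in> C" using elim xK' K'(2) by auto
        have qx: "q k x = (F (u (x + h k *\<^sub>R e)) - F (u x)) /\<^sub>R h k" for k
          using True xK' by (simp add: q_def P_def)
        have Dx: "D k x = (u (x + h k *\<^sub>R e) - u x) /\<^sub>R h k" for k using x UV by (simp add: D_def)
        have "(\<lambda>k. D k x - g x) \<longlonglongrightarrow> 0" using elim(2) UV x by (simp add: D_def)
        then have "(\<lambda>k. (u (x + h k *\<^sub>R e) - u x) /\<^sub>R h k) \<longlonglongrightarrow> g x"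
          unfolding Dx by (rule LIM_zero_cancel)
        from difference_quotient_differentiable[OF diff[OF uC(1), unfolded frechet_derivative_works] h this]
        have lq: "(\<lambda>k. q k x) \<longlonglongrightarrow> q0 x" using True by (simp add: qx q0_def Q_def)
        have b: "norm (q k x) \<le> \<bar>L\<bar> * norm (D k x)" for k
          using mult_left_mono[OF L0[OF uC(2) uC(1), of k], of "inverse \<bar>h k\<bar>"] by (simp add: qx Dx mult.left_commute)
        have "(\<lambda>k. \<bar>L\<bar> * norm (D k x)) \<longlonglongrightarrow> \<bar>L\<bar> * norm (G x)"
          using LIM_zero_cancel[OF \<open>(\<lambda>k. D k x - g x) \<longlonglongrightarrow> 0\<close>] UV(2)[OF x(1)] by (intro tendsto_intros) auto
        then have "norm (q0 x) \<le> \<bar>L\<bar> * norm (G x)"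
          by (rule LIMSEQ_le[OF tendsto_norm[OF lq]]) (use b in auto)
        then show ?thesis using lq b limI[OF lq] by simp
      qed
    qed
    have q0m: "q0 \<in> borel_measurable lebesgue"
    proof (rule borel_measurable_AE)
      show "(\<lambda>x. lim (\<lambda>k. q k x)) \<in> borel_measurable lebesgue"
        using borel_measurable_integrable[OF qi] by (rule borel_measurable_lim_metric)
      show "AE x in lebesgue. lim (\<lambda>k. q k x) = q0 x" using pw by eventually_elim simp
    qed
    have q0i: "integrable lebesgue q0"
    proof (rule Bochner_Integration.integrable_bound[OF _ q0m])
      show "integrable lebesgue (\<lambda>x. \<bar>L\<bar> * norm (G x))" using UG(2) by simp
      show "AE x in lebesgue. norm (q0 x) \<le> norm (\<bar>L\<bar> * norm (G x))"
        using pw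
      proof eventually_elim
        case (elim x)
        then have "norm (q0 x) \<le> \<bar>L\<bar> * norm (G x)" by blast
        then show ?case by (simp add: abs_mult)
      qed
    qed
    \<comment> \<open>The majorant \<open>\<bar>L\<bar> norm (D k x)\<close> of \<open>q k x\<close> depends on k. Subtracting \<open>\<bar>L\<bar> norm (D k x - G x)\<close>, which
      tends to zero in the mean, leaves an error with the fixed majorant \<open>2 \<bar>L\<bar> norm (G x)\<close>.\<close>
    define Z where "Z k x = max 0 (norm (q k x - q0 x) - \<bar>L\<bar> * norm (D k x - G x))" for k x
    have Zi: "integrable lebesgue (Z k)" for k
      unfolding Z_def
      by (intro integrable_max integrable_zero
          Bochner_Integration.integrable_diff[OF integrable_norm[OF Bochner_Integration.integrable_diff[OF qi q0i]]
            integrable_mult_right[OF integrable_norm[OF Di]]])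
    have "(\<lambda>k. LINT x|lebesgue. Z k x) \<longlonglongrightarrow> (LINT x|(lebesgue::(real^'n) measure). 0)"
    proof (rule integral_dominated_convergence)
      show "integrable lebesgue (\<lambda>x. 2 * \<bar>L\<bar> * norm (G x))" using UG(2) by simp
      show "Z k \<in> borel_measurable lebesgue" for k using Zi by (rule borel_measurable_integrable)
      show "AE x in lebesgue. (\<lambda>k. Z k x) \<longlonglongrightarrow> 0"
        using pw
      proof eventually_elim
        case (elim x)
        have "(\<lambda>k. norm (q k x - q0 x)) \<longlonglongrightarrow> 0"
          using elim by (intro tendsto_norm_zero LIM_zero) auto
        then show ?case
          by (rule tendsto_sandwich[OF _ _ tendsto_const, rotated 2]) (auto simp: Z_def)
      qed
      show "AE x in lebesgue. norm (Z k x) \<le> 2 * \<bar>L\<bar> * norm (G x)" for k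
        using pw
      proof eventually_elim
        case (elim x)
        have "norm (q k x - q0 x) \<le> norm (q k x) + norm (q0 x)" by (rule norm_triangle_ineq4)
        also have "\<dots> \<le> \<bar>L\<bar> * norm (D k x) + \<bar>L\<bar> * norm (G x)" using elim by (intro add_mono) auto
        also have "\<bar>L\<bar> * norm (D k x) \<le> \<bar>L\<bar> * (norm (D k x - G x) + norm (G x))"
          by (intro mult_left_mono) (metis diff_add_cancel norm_triangle_ineq, simp)
        finally show ?case by (simp add: Z_def algebra_simps)
      qed
    qed auto
    then have Z0: "(\<lambda>k. LINT x|lebesgue. Z k x) \<longlonglongrightarrow> 0" by simp
    have lim_q: "(\<lambda>k. LINT x|lebesgue. \<phi> x *\<^sub>R q k x) \<longlonglongrightarrow> (LINT x|lebesgue. \<phi> x *\<^sub>R q0 x)"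
      if \<phi>: "\<phi> \<in> test_functions \<Omega>" for \<phi> :: "real^'n \<Rightarrow> real"
    proof -
      obtain B where B: "B > 0" "\<And>x. norm (\<phi> x) \<le> B" using test_functions_bounded[OF \<phi>] by blast
      have i: "integrable lebesgue (\<lambda>x. \<phi> x *\<^sub>R f x)" if "integrable lebesgue f" for f :: "real^'n \<Rightarrow> 'c"
        by (rule integrable_test_scaleR[OF \<phi> integrable_imp_locally_integrable[OF that]])
      have lim': "(\<lambda>k. B * ((LINT x|lebesgue. Z k x) + \<bar>L\<bar> * (LINT x|lebesgue. norm (D k x - G x)))) \<longlonglongrightarrow> B * (0 + \<bar>L\<bar> * 0)"
        using lim(1) unfolding D_def by (intro tendsto_intros Z0)
      have b: "norm ((LINT x|lebesgue. \<phi> x *\<^sub>R q k x) - (LINT x|lebesgue. \<phi> x *\<^sub>R q0 x)) \<le>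
        B * ((LINT x|lebesgue. Z k x) + \<bar>L\<bar> * (LINT x|lebesgue. norm (D k x - G x)))" for k
      proof -
        have "(LINT x|lebesgue. \<phi> x *\<^sub>R q k x) - (LINT x|lebesgue. \<phi> x *\<^sub>R q0 x) = (LINT x|lebesgue. \<phi> x *\<^sub>R (q k x - q0 x))"
          using i[OF qi] i[OF q0i] by (simp add: scaleR_diff_right)
        also have "norm \<dots> \<le> (LINT x|lebesgue. norm (\<phi> x *\<^sub>R (q k x - q0 x)))" by (rule integral_norm_bound)
        also have "\<dots> \<le> (LINT x|lebesgue. B * (Z k x + \<bar>L\<bar> * norm (D k x - G x)))"
        proof (rule integral_mono)
          show "integrable lebesgue (\<lambda>x. norm (\<phi> x *\<^sub>R (q k x - q0 x)))"
            by (intro integrable_norm i Bochner_Integration.integrable_diff qi q0i)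
          show "integrable lebesgue (\<lambda>x. B * (Z k x + \<bar>L\<bar> * norm (D k x - G x)))"
            by (intro integrable_mult_right Bochner_Integration.integrable_add Zi integrable_norm Di)
          fix x
          have "norm (q k x - q0 x) \<le> Z k x + \<bar>L\<bar> * norm (D k x - G x)" by (simp add: Z_def)
          then show "norm (\<phi> x *\<^sub>R (q k x - q0 x)) \<le> B * (Z k x + \<bar>L\<bar> * norm (D k x - G x))"
            using B by (auto intro!: mult_mono)
        qed
        also have "\<dots> = B * ((LINT x|lebesgue. Z k x) + \<bar>L\<bar> * (LINT x|lebesgue. norm (D k x - G x)))"
          using Zi[of k] integrable_norm[OF Di[of k]] by simp
        finally show ?thesis .
      qed
      have "(\<lambda>k. norm ((LINT x|lebesgue. \<phi> x *\<^sub>R q k x) - (LINT x|lebesgue. \<phi> x *\<^sub>R q0 x))) \<longlonglongrightarrow> 0"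
      proof (rule tendsto_sandwich[OF _ _ tendsto_const])
        show "(\<lambda>k. B * ((LINT x|lebesgue. Z k x) + \<bar>L\<bar> * (LINT x|lebesgue. norm (D k x - G x)))) \<longlonglongrightarrow> 0"
          using lim' by simp
      qed (use b in \<open>simp_all only: always_eventually norm_ge_zero simp_thms\<close>)
      then show ?thesis by (rule LIM_zero_cancel[OF tendsto_norm_zero_cancel])
    qed
    have lim_P: "(\<lambda>k. LINT x|lebesgue. \<phi> x *\<^sub>R q k x) \<longlonglongrightarrow> - (LINT x|lebesgue. partial_deriv i \<phi> x *\<^sub>R F (u x))"
      if \<phi>: "\<phi> \<in> test_functions \<Omega>" and \<phi>K: "\<And>x. x \<notin> K \<Longrightarrow> \<phi> x = 0" for \<phi> :: "real^'n \<Rightarrow> real"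
    proof -
      obtain M where M: "M > 0" "\<And>x h. norm (\<phi> (x + h *\<^sub>R axis i 1) - \<phi> x) \<le> M * \<bar>h\<bar>"
        using test_function_lipschitz[OF \<phi>] by metis
      note \<phi>U = test_functions_mono[OF \<phi> subset_UNIV]
      have i: "integrable lebesgue (\<lambda>x. \<psi> x *\<^sub>R f x)" if "\<psi> \<in> test_functions UNIV" "integrable lebesgue f" 
        for f :: "real^'n \<Rightarrow> 'c" and \<psi> :: "real^'n \<Rightarrow> real"
        by (rule integrable_test_scaleR[OF that(1) integrable_imp_locally_integrable[OF that(2)]])
      have d: "(LINT x|lebesgue. \<phi> x *\<^sub>R q k x) = (LINT x|lebesgue. ((\<phi> (x + (- h k) *\<^sub>R e) - \<phi> x) /\<^sub>R h k) *\<^sub>R P x)" for k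
      proof -
        have tt: "(\<lambda>x. \<phi> (x + (- h k) *\<^sub>R e)) \<in> test_functions UNIV" by (rule test_functions_translate[OF \<phi>U])
        have "(LINT x|lebesgue. \<phi> x *\<^sub>R q k x) = (LINT x|lebesgue. (\<phi> x *\<^sub>R P (x + h k *\<^sub>R e) - \<phi> x *\<^sub>R P x) /\<^sub>R h k)"
          by (rule Bochner_Integration.integral_cong) (use \<phi>K in \<open>auto simp: q_def indicator_def algebra_simps\<close>)
        also have "\<dots> = ((LINT x|lebesgue. \<phi> x *\<^sub>R P (x + h k *\<^sub>R e)) - (LINT x|lebesgue. \<phi> x *\<^sub>R P x)) /\<^sub>R h k"
          using i[OF \<phi>U Ph] i[OF \<phi>U P] by (simp del: scaleR_right_diff_distrib)
        also have "(LINT x|lebesgue. \<phi> x *\<^sub>R P (x + h k *\<^sub>R e)) = (LINT x|lebesgue. \<phi> (x + (- h k) *\<^sub>R e) *\<^sub>R P x)"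
          using integral_translation[OF i[OF tt P], of "h k *\<^sub>R e"] by (simp add: add.commute)
        also have "((LINT x|lebesgue. \<phi> (x + (- h k) *\<^sub>R e) *\<^sub>R P x) - (LINT x|lebesgue. \<phi> x *\<^sub>R P x)) /\<^sub>R h k
          = (LINT x|lebesgue. (\<phi> (x + (- h k) *\<^sub>R e) *\<^sub>R P x - \<phi> x *\<^sub>R P x) /\<^sub>R h k)"
          using i[OF tt P] i[OF \<phi>U P] by (simp del: scaleR_right_diff_distrib)
        finally show ?thesis by (simp add: algebra_simps)
      qed
      have "(\<lambda>k. LINT x|lebesgue. ((\<phi> (x + (- h k) *\<^sub>R e) - \<phi> x) /\<^sub>R h k) *\<^sub>R P x) \<longlonglongrightarrow> (LINT x|lebesgue. (- partial_deriv i \<phi> x) *\<^sub>R P x)"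
      proof (rule integral_dominated_convergence)
        show "integrable lebesgue (\<lambda>x. M * norm (P x))" using P by simp
        show "(\<lambda>x. (- partial_deriv i \<phi> x) *\<^sub>R P x) \<in> borel_measurable lebesgue"
          using i[OF test_functions_partial_deriv[OF \<phi>U] P, of i] by (simp add: borel_measurable_integrable)
        show "(\<lambda>x. ((\<phi> (x + (- h k) *\<^sub>R e) - \<phi> x) /\<^sub>R h k) *\<^sub>R P x) \<in> borel_measurable lebesgue" for k
          by (intro borel_measurable_scaleR borel_measurable_integrable[OF P] borel_measurable_lebesgue borel_measurable_diff
              test_functions_measurable[OF test_functions_translate[OF \<phi>U]] test_functions_measurable[OF \<phi>U]) auto
        show "AE x in lebesgue. norm (((\<phi> (x + (- h k) *\<^sub>R e) - \<phi> x) /\<^sub>R h k) *\<^sub>R P x) \<le> M * norm (P x)" for k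
        proof (intro AE_I2)
          fix x
          have "norm ((\<phi> (x + (- h k) *\<^sub>R e) - \<phi> x) /\<^sub>R h k) \<le> M"
            using M(2)[of x "- h k"] h(2)[of k] by (simp add: e_def field_simps abs_mult)
          then show "norm (((\<phi> (x + (- h k) *\<^sub>R e) - \<phi> x) /\<^sub>R h k) *\<^sub>R P x) \<le> M * norm (P x)"
            unfolding norm_scaleR[of "(\<phi> (x + (- h k) *\<^sub>R e) - \<phi> x) /\<^sub>R h k"]
            by (intro mult_right_mono) auto
        qed
        show "AE x in lebesgue. (\<lambda>k. ((\<phi> (x + (- h k) *\<^sub>R e) - \<phi> x) /\<^sub>R h k) *\<^sub>R P x) \<longlonglongrightarrow> (- partial_deriv i \<phi> x) *\<^sub>R P x"
        proof (intro AE_I2 tendsto_scaleR tendsto_const)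
          fix x
          have "filterlim (\<lambda>k. - h k) (at 0) sequentially"
            using tendsto_minus[OF h(1)] h(2) by (intro filterlim_atI) auto
          from tendsto_minus[OF filterlim_compose[OF test_function_difference_quotient[OF \<phi>, of x i] this]]
          show "(\<lambda>k. (\<phi> (x + (- h k) *\<^sub>R e) - \<phi> x) /\<^sub>R h k) \<longlonglongrightarrow> - partial_deriv i \<phi> x"
            by (simp add: e_def)
        qed
      qed
      moreover have eq: "(- partial_deriv i \<phi> x) *\<^sub>R P x = - (partial_deriv i \<phi> x *\<^sub>R F (u x))" for x
      proof (cases "x \<in> K")
        case True then show ?thesis using V by (auto simp: P_def)
      next
        case False
        have "partial_deriv i \<phi> x = 0"
          unfolding partial_deriv_def using \<phi>K False by (intro frechet_derivative_off_support[OF K(1)])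
        then show ?thesis by simp
      qed
      ultimately show ?thesis by (simp only: d eq integral_minus)
    qed
    have "(LINT x|lebesgue. partial_deriv i \<phi> x *\<^sub>R F (u x)) = - (LINT x|lebesgue. \<phi> x *\<^sub>R Q x)"
      if \<phi>: "\<phi> \<in> test_functions \<Omega>" and \<phi>K: "\<And>x. x \<notin> K \<Longrightarrow> \<phi> x = 0" for \<phi> :: "real^'n \<Rightarrow> real"
    proof -
      have "(LINT x|lebesgue. \<phi> x *\<^sub>R q0 x) = (LINT x|lebesgue. \<phi> x *\<^sub>R Q x)"
        by (rule Bochner_Integration.integral_cong) (use \<phi>K in \<open>auto simp: q0_def indicator_def\<close>)
      then show ?thesis using LIMSEQ_unique[OF lim_q[OF \<phi>] lim_P[OF \<phi> \<phi>K]] by (metis minus_minus)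
    qed
    then show ?thesis using q0i unfolding q0_def by blast
  qed
  show ?thesis
    unfolding has_weak_partial_iff[OF \<Omega>] Q_def[symmetric]
  proof (intro conjI allI impI Fu)
    show "Q locally_integrable_on \<Omega>" unfolding locally_integrable_on_indicator using key by blast
    fix \<phi> :: "real^'n \<Rightarrow> real" assume \<phi>: "\<phi> \<in> test_functions \<Omega>"
    then obtain K where "compact K" "K \<subseteq> \<Omega>" "\<And>x. x \<notin> K \<Longrightarrow> \<phi> x = 0"
      unfolding test_functions_def by blast
    then show "(LINT x|lebesgue. partial_deriv i \<phi> x *\<^sub>R F (u x)) = - (LINT x|lebesgue. \<phi> x *\<^sub>R Q x)"
      using key \<phi> by blast
  qed
qed

section \<open>Symmetry of second derivatives\<close>

lemma has_derivative_along_line: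
  fixes f :: "'a::real_normed_vector \<Rightarrow> 'b::real_normed_vector"
  assumes "(f has_derivative f') (at (a + t *\<^sub>R v))"
  shows "((\<lambda>t. f (a + t *\<^sub>R v)) has_derivative (\<lambda>r. f' (r *\<^sub>R v))) (at t)"
  by (rule has_derivative_compose[where g=f and f="\<lambda>t. a + t *\<^sub>R v" and f'="\<lambda>r. r *\<^sub>R v", OF _ assms])
    (auto intro!: derivative_eq_intros)

text \<open>The mean value theorem is applied first in direction v to the difference of f over the step
  \<open>s w\<close>, and then in direction w to the derivative in direction v.\<close>

lemma second_difference_mean_value:
  fixes f :: "'a::euclidean_space \<Rightarrow> real"
  assumes s: "s > 0" and S: "\<And>p. norm (p - x) \<le> s * (norm v + norm w) \<Longrightarrow> p \<in> S"
    and f: "\<And>z. z \<in> S \<Longrightarrow> (f has_derivative f' z) (at z)"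
    and b: "\<And>z. z \<in> S \<Longrightarrow> ((\<lambda>z. f' z v) has_derivative b z) (at z)"
  shows "\<exists>p. norm (p - x) \<le> s * (norm v + norm w) \<and>
    f (x + s *\<^sub>R v + s *\<^sub>R w) - f (x + s *\<^sub>R v) - (f (x + s *\<^sub>R w) - f x) = s * s * b p w"
proof -
  have near: "norm (x + \<xi> *\<^sub>R v + \<eta> *\<^sub>R w - x) \<le> s * (norm v + norm w)" if "0 \<le> \<xi>" "\<xi> \<le> s" "0 \<le> \<eta>" "\<eta> \<le> s" for \<xi> \<eta>
  proof -
    have "norm (x + \<xi> *\<^sub>R v + \<eta> *\<^sub>R w - x) = norm (\<xi> *\<^sub>R v + \<eta> *\<^sub>R w)" by simp
    also have "\<dots> \<le> \<xi> * norm v + \<eta> * norm w" using norm_triangle_ineq[of "\<xi> *\<^sub>R v" "\<eta> *\<^sub>R w"] that by simp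
    also have "\<dots> \<le> s * norm v + s * norm w" using that by (intro add_mono mult_right_mono) auto
    finally show ?thesis by (simp add: algebra_simps)
  qed
  have sc: "f' z (r *\<^sub>R y) = r * f' z y" if "z \<in> S" for z r y
    using linear_scale[OF has_derivative_linear[OF f[OF that]]] by simp
  have scb: "b z (r *\<^sub>R y) = r * b z y" if "z \<in> S" for z r y
    using linear_scale[OF has_derivative_linear[OF b[OF that]]] by simp
  define h where "h \<tau> = f (x + \<tau> *\<^sub>R v + s *\<^sub>R w) - f (x + \<tau> *\<^sub>R v)" for \<tau>
  have "\<exists>\<xi>. 0 < \<xi> \<and> \<xi> < s \<and> h s - h 0 = (s - 0) * (f' (x + \<xi> *\<^sub>R v + s *\<^sub>R w) v - f' (x + \<xi> *\<^sub>R v) v)"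
  proof (rule MVT2[OF s])
    fix \<tau> assume \<tau>: "0 \<le> \<tau>" "\<tau> \<le> s"
    have m: "x + \<tau> *\<^sub>R v + s *\<^sub>R w \<in> S" "x + \<tau> *\<^sub>R v \<in> S"
      using S[OF near[OF \<tau>, of s]] S[OF near[OF \<tau>, of 0]] s by auto
    have "(h has_derivative (\<lambda>r. f' (x + \<tau> *\<^sub>R v + s *\<^sub>R w) (r *\<^sub>R v) - f' (x + \<tau> *\<^sub>R v) (r *\<^sub>R v))) (at \<tau>)"
      using has_derivative_diff[OF has_derivative_along_line[of f _ "x + s *\<^sub>R w" \<tau> v] has_derivative_along_line[OF f[OF m(2)]]]
        f[OF m(1)] unfolding h_def by (simp add: add.assoc add.commute[of "s *\<^sub>R w"])
    then show "(h has_real_derivative f' (x + \<tau> *\<^sub>R v + s *\<^sub>R w) v - f' (x + \<tau> *\<^sub>R v) v) (at \<tau>)"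
      unfolding has_field_derivative_def by (rule has_derivative_eq_rhs) (use sc[OF m(1)] sc[OF m(2)] in \<open>simp add: fun_eq_iff algebra_simps\<close>)
  qed
  then obtain \<xi> where \<xi>: "0 < \<xi>" "\<xi> < s" "h s - h 0 = s * (f' (x + \<xi> *\<^sub>R v + s *\<^sub>R w) v - f' (x + \<xi> *\<^sub>R v) v)" by auto
  have "\<exists>\<eta>. 0 < \<eta> \<and> \<eta> < s \<and> f' (x + \<xi> *\<^sub>R v + s *\<^sub>R w) v - f' (x + \<xi> *\<^sub>R v + 0 *\<^sub>R w) v = (s - 0) * b (x + \<xi> *\<^sub>R v + \<eta> *\<^sub>R w) w"
  proof (rule MVT2[OF s])
    fix \<tau> assume \<tau>: "0 \<le> \<tau>" "\<tau> \<le> s"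
    have m: "x + \<xi> *\<^sub>R v + \<tau> *\<^sub>R w \<in> S"
      using S[OF near[of \<xi> \<tau>]] \<xi> \<tau> by auto
    have "((\<lambda>\<tau>. f' (x + \<xi> *\<^sub>R v + \<tau> *\<^sub>R w) v) has_derivative (\<lambda>r. b (x + \<xi> *\<^sub>R v + \<tau> *\<^sub>R w) (r *\<^sub>R w))) (at \<tau>)"
      by (rule has_derivative_along_line[OF b[OF m]])
    then show "((\<lambda>\<tau>. f' (x + \<xi> *\<^sub>R v + \<tau> *\<^sub>R w) v) has_real_derivative b (x + \<xi> *\<^sub>R v + \<tau> *\<^sub>R w) w) (at \<tau>)"
      unfolding has_field_derivative_def by (rule has_derivative_eq_rhs) (simp add: fun_eq_iff scb[OF m])
  qed
  then obtain \<eta> where \<eta>: "0 < \<eta>" "\<eta> < s" "f' (x + \<xi> *\<^sub>R v + s *\<^sub>R w) v - f' (x + \<xi> *\<^sub>R v) v = s * b (x + \<xi> *\<^sub>R v + \<eta> *\<^sub>R w) w"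
    by auto
  show ?thesis
    using near[of \<xi> \<eta>] \<xi> \<eta> by (intro exI[of _ "x + \<xi> *\<^sub>R v + \<eta> *\<^sub>R w"]) (auto simp: h_def)
qed

text \<open>The second difference is symmetric in v and w. By the mean value theorem it equals \<open>s\<^sup>2\<close> times
  either mixed derivative at points within distance of order s, and both are continuous.\<close>

lemma second_derivative_symmetric_real:
  fixes f :: "'a::euclidean_space \<Rightarrow> real"
  assumes S: "open S" "x \<in> S" 
    and f: "\<And>z. z \<in> S \<Longrightarrow> (f has_derivative f' z) (at z)"
    and bv: "\<And>z. z \<in> S \<Longrightarrow> ((\<lambda>z. f' z v) has_derivative bv z) (at z)" and bw: "\<And>z. z \<in> S \<Longrightarrow> ((\<lambda>z. f' z w) has_derivative bw z) (at z)"
    and c: "continuous_on S (\<lambda>z. bv z w)" "continuous_on S (\<lambda>z. bw z v)"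
  shows "bv x w = bw x v"
proof -
  obtain r where r: "r > 0" "\<And>p. norm (p - x) < r \<Longrightarrow> p \<in> S"
    using S by (metis dist_norm open_dist)
  define s where "s k = r / (norm v + norm w + 1) * inverse (real (Suc (Suc k)))" for k
  have no: "norm v + norm w + 1 > 0" by (simp add: add_nonneg_pos)
  have s: "s k > 0" "s k * (norm v + norm w) < r" for k
  proof -
    show "s k > 0" using r no by (simp add: s_def)
    have "inverse (real (Suc (Suc k))) < 1" by (simp add: inverse_less_1_iff)
    then have "s k < r / (norm v + norm w + 1) * 1" unfolding s_def using r no by (intro mult_strict_left_mono) auto
    then have "s k * (norm v + norm w + 1) < r" using no by (simp add: field_simps)
    then show "s k * (norm v + norm w) < r" using \<open>s k > 0\<close> by (simp add: algebra_simps)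
  qed
  have s0: "s \<longlonglongrightarrow> 0"
    unfolding s_def by (rule tendsto_mult_right_zero[OF LIMSEQ_Suc[OF LIMSEQ_inverse_real_of_nat]])
  have inS: "p \<in> S" if "norm (p - x) \<le> s k * (norm v + norm w)" for p k
    using r(2) s(2)[of k] that by (meson order_le_less_trans)
  have "\<exists>p. norm (p - x) \<le> s k * (norm v + norm w) \<and>
    f (x + s k *\<^sub>R v + s k *\<^sub>R w) - f (x + s k *\<^sub>R v) - (f (x + s k *\<^sub>R w) - f x) = s k * s k * bv p w" for k
    by (rule second_difference_mean_value[OF s(1) inS f bv])
  then obtain p where p: "\<And>k. norm (p k - x) \<le> s k * (norm v + norm w)"
    "\<And>k. f (x + s k *\<^sub>R v + s k *\<^sub>R w) - f (x + s k *\<^sub>R v) - (f (x + s k *\<^sub>R w) - f x) = s k * s k * bv (p k) w" by metis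
  have "\<exists>p. norm (p - x) \<le> s k * (norm w + norm v) \<and>
    f (x + s k *\<^sub>R w + s k *\<^sub>R v) - f (x + s k *\<^sub>R w) - (f (x + s k *\<^sub>R v) - f x) = s k * s k * bw p v" for k
    by (rule second_difference_mean_value[OF s(1) inS[unfolded add.commute[of "norm v"]] f bw])
  then obtain q where q: "\<And>k. norm (q k - x) \<le> s k * (norm w + norm v)"
    "\<And>k. f (x + s k *\<^sub>R w + s k *\<^sub>R v) - f (x + s k *\<^sub>R w) - (f (x + s k *\<^sub>R v) - f x) = s k * s k * bw (q k) v" by metis
  have eq: "bv (p k) w = bw (q k) v" for k
  proof -
    have "s k * s k * bv (p k) w = s k * s k * bw (q k) v"
      unfolding p(2)[symmetric] q(2)[symmetric] by (simp add: algebra_simps)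
    then show ?thesis using s(1)[of k] by simp
  qed
  have conv: "a \<longlonglongrightarrow> x" if "\<And>k. norm (a k - x) \<le> s k * c" for a c
  proof -
    have "(\<lambda>k. s k * c) \<longlonglongrightarrow> 0" using tendsto_mult_left_zero[OF s0] .
    then have "(\<lambda>k. norm (a k - x)) \<longlonglongrightarrow> 0"
      by (rule tendsto_sandwich[OF _ _ tendsto_const, rotated 2]) (use that in auto)
    then show ?thesis using LIM_zero_cancel[OF tendsto_norm_zero_cancel] by blast
  qed
  have "isCont (\<lambda>z. bv z w) x" "isCont (\<lambda>z. bw z v) x"
    using c S by (auto simp: continuous_on_eq_continuous_at)
  then have "(\<lambda>k. bv (p k) w) \<longlonglongrightarrow> bv x w" "(\<lambda>k. bw (q k) v) \<longlonglongrightarrow> bw x v"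
    using conv[OF p(1)] conv[OF q(1)] by (auto intro: isCont_tendsto_compose)
  then show ?thesis unfolding eq using LIMSEQ_unique by blast
qed

lemma Hess_symmetric:
  fixes f :: "real^'p \<Rightarrow> real^'p"
  assumes S: "open S" "x \<in> S" and f: "Ck_on 2 f S"
  shows "Hess f x v w = Hess f x w v"
proof (rule euclidean_eqI)
  fix c :: "real^'p"
  have f1: "Ck_on (Suc (Suc 0)) f S" using f by (simp add: numeral_2_eq_2)
  have d1: "(f has_derivative frechet_derivative f (at z)) (at z)" if "z \<in> S" for z
    using Ck_on_has_derivative[OF f1 that] .
  have d2: "((\<lambda>z. frechet_derivative f (at z) a) has_derivative (\<lambda>b. Hess f z b a)) (at z)" if "z \<in> S" for z a
    using Ck_on_has_derivative[of 0 "\<lambda>z. frechet_derivative f (at z) a" S z] f1 that by (simp add: Hess_def)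
  have c2: "continuous_on S (\<lambda>z. Hess f z b a)" for a b
    using f1 by (simp add: Hess_def)
  have "Hess f x w v \<bullet> c = Hess f x v w \<bullet> c"
    by (rule second_derivative_symmetric_real[OF S, where f="\<lambda>z. f z \<bullet> c" and f'="\<lambda>z a. frechet_derivative f (at z) a \<bullet> c"
          and bv="\<lambda>z b. Hess f z b v \<bullet> c" and bw="\<lambda>z b. Hess f z b w \<bullet> c" and v=v and w=w])
      (auto intro!: has_derivative_inner_left d1 d2 continuous_on_inner c2 continuous_on_const)
  then show "Hess f x v w \<bullet> c = Hess f x w v \<bullet> c" by simp
qed

section \<open>The nearest point projection of a set of positive reach\<close>

locale nearest_point_tube =
  fixes N :: "(real^'p) set" and \<delta> :: real
  assumes \<delta>: "\<delta> > 0"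
    and unique_nearest: "\<And>x. x \<in> tubular_nbhd N \<delta> \<Longrightarrow> \<exists>!y. y \<in> N \<and> dist x y = infdist x N"
    and projection_C2: "Ck_on 2 (closest_point N) (tubular_nbhd N \<delta>)"
begin

abbreviation "\<pi> \<equiv> closest_point N"
abbreviation "T \<equiv> tubular_nbhd N \<delta>"
abbreviation "D y \<equiv> frechet_derivative \<pi> (at y)"

lemma N_nonempty: "N \<noteq> {}"
proof
  assume "N = {}"
  then have "(0::real^'p) \<in> T" using \<delta> by (simp add: tubular_nbhd_def infdist_def)
  then show False using unique_nearest \<open>N = {}\<close> by blast
qed

lemma N_subset_T: "y \<in> N \<Longrightarrow> y \<in> T"
  using \<delta> by (simp add: tubular_nbhd_def)

text \<open>A point of the closure has distance zero from N, and the distance is attained.\<close>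

lemma closed_N: "closed N"
proof -
  have "x \<in> N" if "x \<in> closure N" for x
  proof -
    have 0: "infdist x N = 0" using that N_nonempty by (simp add: in_closure_iff_infdist_zero)
    then have "x \<in> T" using \<delta> by (simp add: tubular_nbhd_def)
    then show ?thesis using unique_nearest 0 by fastforce
  qed
  then show ?thesis using closure_subset_eq by blast
qed

lemma open_T: "open T"
  unfolding tubular_nbhd_def by (intro open_Collect_less continuous_intros)

lemma projection_in: "\<pi> x \<in> N"
  by (rule closest_point_in_set[OF closed_N N_nonempty])

lemma dist_projection: "dist x (\<pi> x) = infdist x N"
proof (rule antisym)
  show "infdist x N \<le> dist x (\<pi> x)" by (rule infdist_le[OF projection_in])
  show "dist x (\<pi> x) \<le> infdist x N"
    using closest_point_le[OF closed_N, of _ x] N_nonempty by (simp add: infdist_def cINF_greatest)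
qed

lemma projection_eqI:
  assumes "x \<in> T" "y \<in> N" "dist x y \<le> infdist x N" shows "\<pi> x = y"
  using unique_nearest[OF assms(1)] assms(2,3) infdist_le[OF assms(2), of x] projection_in dist_projection
  by (metis order_antisym)

lemma projection_id: "y \<in> N \<Longrightarrow> \<pi> y = y"
  by (rule closest_point_self)

lemma in_T_near: "y \<in> N \<Longrightarrow> norm v < \<delta> \<Longrightarrow> y + v \<in> T"
  using infdist_le[of y N "y + v"] by (simp add: tubular_nbhd_def dist_norm)

lemma projection_C2': "Ck_on (Suc (Suc 0)) \<pi> T"
  using projection_C2 by (simp add: numeral_2_eq_2)

lemma projection_derivative: "x \<in> T \<Longrightarrow> (\<pi> has_derivative D x) (at x)"
  using Ck_on_has_derivative[OF projection_C2'] .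

lemma linear_D: "x \<in> T \<Longrightarrow> linear (D x)"
  using projection_derivative has_derivative_linear by blast

lemma D_expand: "x \<in> T \<Longrightarrow> (\<Sum>b\<in>Basis. (a \<bullet> b) *\<^sub>R D x b) = D x a"
  by (simp only: linear_scale[OF linear_D, symmetric] linear_sum[OF linear_D, symmetric] euclidean_representation)

lemma D_derivative: "x \<in> T \<Longrightarrow> ((\<lambda>z. D z a) has_derivative (\<lambda>v. Hess \<pi> x v a)) (at x)"
  using Ck_on_has_derivative[of 0 "\<lambda>z. D z a" T x] projection_C2' by (simp add: Hess_def)

lemma D_C1: "Ck_on 1 (\<lambda>z. D z a) T"
  using projection_C2' by simp

lemma D_continuous: "continuous_on T (\<lambda>z. D z a)"
  using Ck_on_SucD[of 0 "\<lambda>z. D z a" T] D_C1 by simp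

lemma isCont_projection: "x \<in> T \<Longrightarrow> isCont \<pi> x"
  using projection_derivative has_derivative_continuous by blast

lemma isCont_D: "x \<in> T \<Longrightarrow> isCont (\<lambda>z. D z a) x"
  using D_continuous open_T continuous_on_eq_continuous_at by blast

lemma linear_Hess: "x \<in> T \<Longrightarrow> linear (\<lambda>v. Hess \<pi> x v a)"
  using D_derivative has_derivative_linear by blast

lemma Hess_scaleR: "x \<in> T \<Longrightarrow> Hess \<pi> x (r *\<^sub>R v) a = r *\<^sub>R Hess \<pi> x v a"
  using linear_scale[OF linear_Hess] .

lemma projection_along_curve:
  assumes "(\<gamma> has_vector_derivative v) (at t within S)" "\<gamma> t \<in> T"
  shows "((\<lambda>t. \<pi> (\<gamma> t)) has_vector_derivative D (\<gamma> t) v) (at t within S)"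
    and "((\<lambda>t. D (\<gamma> t) a) has_vector_derivative Hess \<pi> (\<gamma> t) v a) (at t within S)"
proof -
  show "((\<lambda>t. D (\<gamma> t) a) has_vector_derivative Hess \<pi> (\<gamma> t) v a) (at t within S)"
    using has_derivative_compose[OF assms(1)[unfolded has_vector_derivative_def] D_derivative[OF assms(2), of a]]
    unfolding has_vector_derivative_def by (simp add: Hess_scaleR[OF assms(2)])
  show "((\<lambda>t. \<pi> (\<gamma> t)) has_vector_derivative D (\<gamma> t) v) (at t within S)"
    using has_derivative_compose[OF assms(1)[unfolded has_vector_derivative_def] projection_derivative[OF assms(2)]]
    unfolding has_vector_derivative_def by (simp add: linear_scale[OF linear_D[OF assms(2)]])
qed

text \<open>Moving from x towards its foot by a distance d decreases the distance from N by at most d, and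
  the distance from the foot by exactly d.\<close>

lemma projection_towards_foot:
  assumes "x \<in> T" "0 \<le> s" "s \<le> 1" shows "\<pi> (x - s *\<^sub>R (x - \<pi> x)) = \<pi> x" "x - s *\<^sub>R (x - \<pi> x) \<in> T"
proof -
  let ?z = "x - s *\<^sub>R (x - \<pi> x)"
  have zq: "dist ?z (\<pi> x) = (1 - s) * dist x (\<pi> x)"
  proof -
    have "?z - \<pi> x = (1 - s) *\<^sub>R (x - \<pi> x)" by (simp add: algebra_simps)
    then show ?thesis using assms by (simp add: dist_norm)
  qed
  have zx: "dist x ?z = s * dist x (\<pi> x)" using assms by (simp add: dist_norm)
  have "infdist x N \<le> infdist ?z N + dist x ?z" by (rule infdist_triangle)
  then have le: "dist ?z (\<pi> x) \<le> infdist ?z N" using zq zx dist_projection[of x] by (simp add: algebra_simps)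
  have "infdist ?z N \<le> dist ?z (\<pi> x)" by (rule infdist_le[OF projection_in])
  also have "\<dots> \<le> 1 * dist x (\<pi> x)" unfolding zq using assms by (intro mult_right_mono) auto
  also have "\<dots> < \<delta>" using assms(1) dist_projection[of x] by (simp add: tubular_nbhd_def)
  finally show "?z \<in> T" by (simp add: tubular_nbhd_def)
  then show "\<pi> ?z = \<pi> x" by (rule projection_eqI[OF _ projection_in le])
qed

text \<open>The projection is constant on the segment from x to its foot.\<close>

lemma D_normal_direction:
  assumes "x \<in> T" shows "D x (x - \<pi> x) = 0"
proof -
  have "((\<lambda>s. x - s *\<^sub>R (x - \<pi> x)) has_vector_derivative - (x - \<pi> x)) (at 0 within {0..1})"
    by (auto intro!: derivative_eq_intros)
  from projection_along_curve(1)[OF this]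
  have "((\<lambda>s. \<pi> (x - s *\<^sub>R (x - \<pi> x))) has_vector_derivative D x (- (x - \<pi> x))) (at 0 within {0..1})"
    using assms by simp
  moreover have "((\<lambda>s. \<pi> (x - s *\<^sub>R (x - \<pi> x))) has_vector_derivative 0) (at 0 within {0..1})"
    by (rule has_vector_derivative_transform[OF _ _ has_vector_derivative_const[of "\<pi> x"]])
      (use projection_towards_foot[OF assms] in auto)
  ultimately have "D x (- (x - \<pi> x)) = 0"
    using vector_derivative_unique_within_closed_interval[of 0 1 0] by auto
  then show ?thesis using linear_neg[OF linear_D[OF assms], of "x - \<pi> x"] by (metis neg_equal_0_iff_equal)
qed

lemma D_bounded_on_compact:
  assumes "compact K" "K \<subseteq> T" obtains M where "M \<ge> 0" "\<And>x v. x \<in> K \<Longrightarrow> norm (D x v) \<le> M * norm v"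
proof -
  have "\<exists>B. \<forall>x\<in>K. norm (D x b) \<le> B" for b
    using compact_imp_bounded[OF compact_continuous_image[OF continuous_on_subset[OF D_continuous assms(2)] assms(1)]]
    by (auto simp: bounded_iff)
  then obtain B where B: "\<And>b x. x \<in> K \<Longrightarrow> norm (D x b) \<le> B b" by metis
  define M where "M = (\<Sum>b\<in>Basis. \<bar>B b\<bar>)"
  have "norm (D x v) \<le> M * norm v" if "x \<in> K" for x v
  proof -
    have xT: "x \<in> T" using that assms(2) by blast
    have "D x v = (\<Sum>b\<in>Basis. (v \<bullet> b) *\<^sub>R D x b)" by (simp only: D_expand[OF xT])
    also have "norm \<dots> \<le> (\<Sum>b\<in>Basis. norm ((v \<bullet> b) *\<^sub>R D x b))" by (rule norm_sum)
    also have "\<dots> \<le> (\<Sum>b\<in>Basis. norm v * \<bar>B b\<bar>)"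
    proof (rule sum_mono)
      fix b :: "real^'p" assume "b \<in> Basis"
      then show "norm ((v \<bullet> b) *\<^sub>R D x b) \<le> norm v * \<bar>B b\<bar>"
        using B[OF that, of b] Basis_le_norm[of b v] by (auto intro!: mult_mono)
    qed
    also have "\<dots> = M * norm v" by (simp add: M_def sum_distrib_left sum_distrib_right mult.commute)
    finally show ?thesis .
  qed
  moreover have "M \<ge> 0" unfolding M_def by (intro sum_nonneg) auto
  ultimately show ?thesis using that by blast
qed

text \<open>Let \<open>p s\<close> be the foot of the point \<open>q + s \<nu>\<close>. Its derivative is \<open>D \<nu>\<close>, and D annihilates
  \<open>q + s \<nu> - p s\<close>, so \<open>s p'(s) = D (p s - q)\<close>. This is a linear equation for \<open>p - q\<close>, which vanishes at
  \<open>s = r\<close> and hence, by Gronwall's argument, as long as the ray stays in the tube.\<close>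

lemma projection_normal_ray:
  assumes q: "q \<in> N" and \<nu>: "norm \<nu> = 1" and r: "0 < r" "r < \<delta>" "\<pi> (q + r *\<^sub>R \<nu>) = q" and t: "0 \<le> t" "t < \<delta>"
  shows "\<pi> (q + t *\<^sub>R \<nu>) = q"
proof (cases "t \<le> r")
  case True
  have "q + r *\<^sub>R \<nu> \<in> T" using in_T_near[OF q] r \<nu> by simp
  from projection_towards_foot(1)[OF this, of "1 - t / r"] 
  show ?thesis using True r t by (simp add: algebra_simps)
next
  case False
  define p where "p s = \<pi> (q + s *\<^sub>R \<nu>)" for s
  have inT: "q + s *\<^sub>R \<nu> \<in> T" if "s \<in> {r..t}" for s
    using in_T_near[OF q, of "s *\<^sub>R \<nu>"] r t that \<nu> by simp
  have "compact ((\<lambda>s. q + s *\<^sub>R \<nu>) ` {r..t})"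
    by (intro compact_continuous_image continuous_intros) auto
  then obtain M where M: "M \<ge> 0" "\<And>x v. x \<in> (\<lambda>s. q + s *\<^sub>R \<nu>) ` {r..t} \<Longrightarrow> norm (D x v) \<le> M * norm v"
    using D_bounded_on_compact[of "(\<lambda>s. q + s *\<^sub>R \<nu>) ` {r..t}"] inT by blast
  have p': "(p has_vector_derivative D (q + s *\<^sub>R \<nu>) \<nu>) (at s)" if "s \<in> {r..t}" for s
    unfolding p_def using inT[OF that]
    by (intro projection_along_curve(1)[of "\<lambda>s. q + s *\<^sub>R \<nu>"]) (auto intro!: derivative_eq_intros)
  have ode: "s *\<^sub>R D (q + s *\<^sub>R \<nu>) \<nu> = D (q + s *\<^sub>R \<nu>) (p s - q)" if "s \<in> {r..t}" for s
  proof -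
    note lin = linear_D[OF inT[OF that]]
    have "0 = D (q + s *\<^sub>R \<nu>) (s *\<^sub>R \<nu> - (p s - q))"
      using D_normal_direction[OF inT[OF that]] by (simp add: p_def algebra_simps)
    then show ?thesis by (simp add: linear_diff[OF lin] linear_scale[OF lin])
  qed
  define \<psi> where "\<psi> s = exp (- (2 * M / r) * s) * ((p s - q) \<bullet> (p s - q))" for s
  have "\<psi> t \<le> \<psi> r"
  proof (rule DERIV_nonpos_imp_nonincreasing[where f=\<psi> and a=r and b=t])
    show "r \<le> t" using False by simp
    fix s assume "r \<le> s" "s \<le> t"
    then have s: "s \<in> {r..t}" "s > 0" using r by auto
    let ?e = "exp (- (2 * M / r) * s)"
    have "((\<lambda>s. (p s - q) \<bullet> (p s - q)) has_real_derivative 2 * ((p s - q) \<bullet> D (q + s *\<^sub>R \<nu>) \<nu>)) (at s)"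
      using p'[OF s(1)] unfolding has_vector_derivative_def has_field_derivative_def
      by (auto intro!: derivative_eq_intros simp: inner_commute algebra_simps)
    moreover have "((\<lambda>s. exp (- (2 * M / r) * s)) has_real_derivative - (2 * M / r) * ?e) (at s)"
      using r by (auto intro!: derivative_eq_intros)
    ultimately have "(\<psi> has_real_derivative (- (2 * M / r) * ?e) * ((p s - q) \<bullet> (p s - q)) + 
        2 * ((p s - q) \<bullet> D (q + s *\<^sub>R \<nu>) \<nu>) * ?e) (at s)"
      unfolding \<psi>_def by (intro DERIV_mult)
    moreover have "(- (2 * M / r) * ?e) * ((p s - q) \<bullet> (p s - q)) + 2 * ((p s - q) \<bullet> D (q + s *\<^sub>R \<nu>) \<nu>) * ?e \<le> 0"
    proof -
      have "s * ((p s - q) \<bullet> D (q + s *\<^sub>R \<nu>) \<nu>) = (p s - q) \<bullet> D (q + s *\<^sub>R \<nu>) (p s - q)"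
        unfolding ode[OF s(1), symmetric] by simp
      also have "\<dots> \<le> norm (p s - q) * (M * norm (p s - q))"
        using M(2)[OF imageI[OF s(1)], of "p s - q"] by (intro order_trans[OF norm_cauchy_schwarz] mult_left_mono) auto
      also have "\<dots> = M * ((p s - q) \<bullet> (p s - q))" by (simp add: power2_norm_eq_inner[symmetric] power2_eq_square)
      finally have "(p s - q) \<bullet> D (q + s *\<^sub>R \<nu>) \<nu> \<le> (M / s) * ((p s - q) \<bullet> (p s - q))"
        using s(2) by (simp add: field_simps)
      also have "\<dots> \<le> (M / r) * ((p s - q) \<bullet> (p s - q))"
        using s M(1) r by (intro mult_right_mono divide_left_mono) auto
      finally have "2 * ((p s - q) \<bullet> D (q + s *\<^sub>R \<nu>) \<nu>) * ?e \<le> 2 * ((M / r) * ((p s - q) \<bullet> (p s - q))) * ?e"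
        by (intro mult_right_mono mult_left_mono) auto
      moreover have "2 * ((M / r) * ((p s - q) \<bullet> (p s - q))) * ?e = (2 * M / r) * ?e * ((p s - q) \<bullet> (p s - q))"
        by (simp add: mult_ac)
      ultimately show ?thesis by linarith
    qed
    ultimately show "\<exists>y. (\<psi> has_real_derivative y) (at s) \<and> y \<le> 0" by blast
  qed
  moreover have "\<psi> r = 0" using r(3) by (simp add: \<psi>_def p_def)
  moreover have "\<psi> t \<ge> 0" by (simp add: \<psi>_def)
  ultimately have "\<psi> t = 0" by simp
  then show ?thesis by (simp add: \<psi>_def p_def)
qed

text \<open>For every \<open>t < \<delta>\<close> the point at distance t from q on the normal ray still has foot q, so y lies outside
  the open ball of radius t around it. Expand the square and let t tend to \<open>\<delta>\<close>.\<close>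

lemma projection_reach_inequality:
  assumes "x \<in> T" "y \<in> N"
  shows "(x - \<pi> x) \<bullet> (y - \<pi> x) \<le> norm (x - \<pi> x) * (norm (y - \<pi> x))\<^sup>2 / (2 * \<delta>)"
proof (cases "x = \<pi> x")
  case True then show ?thesis by (metis cancel_comm_monoid_add_class.diff_cancel div_0 eq_iff inner_zero_left mult_zero_left norm_zero)
next
  case False
  define q r \<nu> where "q = \<pi> x" and "r = norm (x - q)" and "\<nu> = (x - q) /\<^sub>R r"
  have r: "r > 0" "r < \<delta>" and q: "q \<in> N" and \<nu>: "norm \<nu> = 1" and x: "x = q + r *\<^sub>R \<nu>"
  proof -
    show r0: "r > 0" using False by (simp add: q_def r_def)
    show "r < \<delta>" using assms(1) dist_projection[of x] by (simp add: q_def r_def dist_norm tubular_nbhd_def)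
    show "q \<in> N" by (simp add: q_def projection_in)
    show "norm \<nu> = 1" using r0 by (simp add: \<nu>_def r_def[symmetric])
    show "x = q + r *\<^sub>R \<nu>" using r0 by (simp add: \<nu>_def)
  qed
  define a b where "a = \<nu> \<bullet> (y - q)" and "b = (norm (y - q))\<^sup>2"
  have ta: "2 * t * a \<le> b" if t: "0 < t" "t < \<delta>" for t
  proof -
    have "\<pi> (q + t *\<^sub>R \<nu>) = q"
    proof (rule projection_normal_ray[OF q \<nu> r _ less_imp_le[OF t(1)] t(2)])
      have "\<pi> (q + r *\<^sub>R \<nu>) = \<pi> x" by (simp only: x[symmetric])
      then show "\<pi> (q + r *\<^sub>R \<nu>) = q" by (simp only: q_def)
    qed
    then have "dist (q + t *\<^sub>R \<nu>) q \<le> dist (q + t *\<^sub>R \<nu>) y"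
      using dist_projection[of "q + t *\<^sub>R \<nu>"] infdist_le[OF assms(2), of "q + t *\<^sub>R \<nu>"] by simp
    then have "t \<le> norm (t *\<^sub>R \<nu> - (y - q))" using \<nu> t by (simp add: dist_norm algebra_simps)
    then have "t\<^sup>2 \<le> (norm (t *\<^sub>R \<nu> - (y - q)))\<^sup>2" using t by (intro power_mono) auto
    also have "\<dots> = t\<^sup>2 * (norm \<nu>)\<^sup>2 - 2 * t * a + b"
      unfolding a_def b_def power2_norm_eq_inner by (simp add: inner_diff inner_commute power2_eq_square algebra_simps)
    finally show ?thesis using \<nu> by simp
  qed
  have "2 * \<delta> * a \<le> b"
  proof (rule ccontr)
    assume "\<not> 2 * \<delta> * a \<le> b"
    then have ab: "b < 2 * \<delta> * a" by simp
    have "b \<ge> 0" by (simp add: b_def)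
    then have "a > 0" using ab \<delta> by (smt (verit) mult_nonneg_nonpos)
    define t where "t = (\<delta> + b / (2 * a)) / 2"
    have "b / (2 * a) < \<delta>" using ab \<open>a > 0\<close> by (simp add: field_simps)
    moreover have "b / (2 * a) \<ge> 0" using \<open>a > 0\<close> \<open>b \<ge> 0\<close> by simp
    ultimately have t: "0 < t" "t < \<delta>" "b / (2 * a) < t" using \<delta> by (auto simp: t_def field_simps)
    then show False using ta[OF t(1,2)] \<open>a > 0\<close> by (simp add: field_simps)
  qed
  then have "a \<le> b / (2 * \<delta>)" using \<delta> by (simp add: field_simps)
  then have "r * a \<le> r * (b / (2 * \<delta>))" using r by (intro mult_left_mono) auto
  moreover have "(x - q) \<bullet> (y - q) = r * a" unfolding a_def by (subst (1) x) simp
  ultimately show ?thesis by (simp add: a_def b_def q_def r_def)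
qed

text \<open>Add the reach inequality at either foot, each with the other foot as the point of N.\<close>

lemma projection_lipschitz:
  assumes "infdist x N \<le> r" "infdist x' N \<le> r" "r < \<delta>"
  shows "norm (\<pi> x - \<pi> x') \<le> norm (x - x') / (1 - r / \<delta>)"
proof -
  define e where "e = \<pi> x - \<pi> x'"
  have T: "x \<in> T" "x' \<in> T" using assms by (auto simp: tubular_nbhd_def)
  have n: "norm (x - \<pi> x) \<le> r" "norm (x' - \<pi> x') \<le> r"
    using assms dist_projection[of x] dist_projection[of x'] by (auto simp: dist_norm)
  have pos: "1 - r / \<delta> > 0" using assms(3) \<delta> by simp
  have "(x - \<pi> x) \<bullet> (\<pi> x' - \<pi> x) \<le> norm (x - \<pi> x) * (norm (\<pi> x' - \<pi> x))\<^sup>2 / (2 * \<delta>)"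
    by (rule projection_reach_inequality[OF T(1) projection_in])
  also have "\<dots> \<le> r * (norm (\<pi> x' - \<pi> x))\<^sup>2 / (2 * \<delta>)"
    using n \<delta> by (intro divide_right_mono mult_right_mono) auto
  finally have 1: "- ((x - \<pi> x) \<bullet> e) \<le> r * (norm e)\<^sup>2 / (2 * \<delta>)"
    by (simp add: e_def norm_minus_commute inner_diff_right)
  have "(x' - \<pi> x') \<bullet> (\<pi> x - \<pi> x') \<le> norm (x' - \<pi> x') * (norm (\<pi> x - \<pi> x'))\<^sup>2 / (2 * \<delta>)"
    by (rule projection_reach_inequality[OF T(2) projection_in])
  also have "\<dots> \<le> r * (norm (\<pi> x - \<pi> x'))\<^sup>2 / (2 * \<delta>)"
    using n \<delta> by (intro divide_right_mono mult_right_mono) auto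
  finally have 2: "(x' - \<pi> x') \<bullet> e \<le> r * (norm e)\<^sup>2 / (2 * \<delta>)" by (simp add: e_def)
  have "(x' - \<pi> x') \<bullet> e - (x - \<pi> x) \<bullet> e = e \<bullet> e - (x - x') \<bullet> e"
    by (simp add: e_def inner_diff_left inner_diff_right)
  then have "(norm e)\<^sup>2 - (x - x') \<bullet> e \<le> (r / \<delta>) * (norm e)\<^sup>2"
  proof -
    have "(r / \<delta>) * (norm e)\<^sup>2 = r * (norm e)\<^sup>2 / (2 * \<delta>) + r * (norm e)\<^sup>2 / (2 * \<delta>)" using \<delta> by (simp add: field_simps)
    moreover have "(norm e)\<^sup>2 = e \<bullet> e" by (simp add: power2_norm_eq_inner)
    ultimately show ?thesis using 1 2 \<open>_ = e \<bullet> e - _\<close> by linarith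
  qed
  then have "(1 - r / \<delta>) * (norm e)\<^sup>2 \<le> (x - x') \<bullet> e" by (simp add: algebra_simps)
  also have "\<dots> \<le> norm (x - x') * norm e" by (rule norm_cauchy_schwarz)
  finally have "((1 - r / \<delta>) * norm e) * norm e \<le> norm (x - x') * norm e" by (simp add: power2_eq_square algebra_simps)
  then have "(1 - r / \<delta>) * norm e \<le> norm (x - x')"
    by (cases "norm e = 0") (auto dest: mult_right_le_imp_le)
  then show ?thesis using pos by (simp add: e_def field_simps)
qed

lemma line_derivative: "((\<lambda>t. y + t *\<^sub>R v) has_vector_derivative v) (at t within S)"
  by (auto intro!: derivative_eq_intros)

lemma eventually_line_in_T: "x \<in> T \<Longrightarrow> \<forall>\<^sub>F t in at 0. x + t *\<^sub>R v \<in> T"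
proof -
  assume "x \<in> T"
  have "((\<lambda>t. x + t *\<^sub>R v) \<longlongrightarrow> x + 0 *\<^sub>R v) (at 0)" by (intro tendsto_intros)
  then show ?thesis using topological_tendstoD[OF _ open_T] \<open>x \<in> T\<close> by fastforce
qed

lemma norm_D_le:
  assumes "infdist x N < r" "r < \<delta>" shows "norm (D x v) \<le> norm v / (1 - r / \<delta>)"
proof -
  have xT: "x \<in> T" using assms by (simp add: tubular_nbhd_def)
  have "((\<lambda>t. \<pi> (x + t *\<^sub>R v)) has_vector_derivative D x v) (at 0)"
    using projection_along_curve(1)[OF line_derivative[of x v 0 UNIV]] xT by simp
  from tendsto_norm[OF difference_quotient_at_0[OF this]]
  have "((\<lambda>t. norm ((\<pi> (x + t *\<^sub>R v) - \<pi> x) /\<^sub>R t)) \<longlongrightarrow> norm (D x v)) (at 0)" by simp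
  moreover have "\<forall>\<^sub>F t in at 0. norm ((\<pi> (x + t *\<^sub>R v) - \<pi> x) /\<^sub>R t) \<le> norm v / (1 - r / \<delta>)"
  proof -
    have "((\<lambda>t. infdist (x + t *\<^sub>R v) N) \<longlongrightarrow> infdist (x + 0 *\<^sub>R v) N) (at 0)" by (intro tendsto_intros)
    then have "\<forall>\<^sub>F t in at 0. infdist (x + t *\<^sub>R v) N < r"
      by (rule order_tendstoD(2)) (use assms in simp)
    moreover have "\<forall>\<^sub>F t in at (0::real). t \<noteq> 0" by (simp add: eventually_at_filter)
    ultimately show ?thesis
    proof eventually_elim
      case (elim t)
      have "norm (\<pi> (x + t *\<^sub>R v) - \<pi> x) \<le> norm (x + t *\<^sub>R v - x) / (1 - r / \<delta>)"
        by (rule projection_lipschitz) (use assms elim in auto)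
      then have "norm (\<pi> (x + t *\<^sub>R v) - \<pi> x) \<le> \<bar>t\<bar> * (norm v / (1 - r / \<delta>))" by simp
      then have "inverse \<bar>t\<bar> * norm (\<pi> (x + t *\<^sub>R v) - \<pi> x) \<le> inverse \<bar>t\<bar> * (\<bar>t\<bar> * (norm v / (1 - r / \<delta>)))"
        by (intro mult_left_mono) auto
      also have "\<dots> = norm v / (1 - r / \<delta>)" using elim by (simp del: times_divide_eq_right flip: mult.assoc)
      finally show ?case by simp
    qed
  qed
  ultimately show ?thesis by (intro tendsto_upperbound) auto
qed

text \<open>Differentiate \<open>\<pi> (\<pi> x) = \<pi> x\<close>.\<close>

lemma D_projection_D:
  assumes "x \<in> T" shows "D (\<pi> x) (D x v) = D x v"
proof -
  have q: "\<pi> x \<in> T" by (intro N_subset_T projection_in)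
  have 1: "((\<lambda>t. \<pi> (x + t *\<^sub>R v)) has_vector_derivative D x v) (at 0)"
    using projection_along_curve(1)[OF line_derivative[of x v 0 UNIV]] assms by simp
  from projection_along_curve(1)[OF this]
  have "((\<lambda>t. \<pi> (\<pi> (x + t *\<^sub>R v))) has_vector_derivative D (\<pi> x) (D x v)) (at 0)" using q by simp
  then have "((\<lambda>t. \<pi> (x + t *\<^sub>R v)) has_vector_derivative D (\<pi> x) (D x v)) (at 0)"
    by (simp add: projection_id[OF projection_in])
  then show ?thesis using 1 vector_derivative_unique_at by blast
qed

lemma D_idem: "y \<in> N \<Longrightarrow> D y (D y v) = D y v"
  using D_projection_D[OF N_subset_T] projection_id by simp

text \<open>In the reach inequality take \<open>y = \<pi> (q + t w)\<close>, which differs from the foot q by \<open>t D q w\<close> to first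
  order. The right hand side is quadratic in t, so dividing by t gives \<open>\<le> 0\<close>, and \<open>- w\<close> gives equality.\<close>

lemma projection_residual_orthogonal:
  assumes "x \<in> T" shows "(x - \<pi> x) \<bullet> D (\<pi> x) w = 0"
proof -
  let ?q = "\<pi> x"
  have qT: "?q \<in> T" by (intro N_subset_T projection_in)
  have le: "(x - ?q) \<bullet> D ?q w \<le> 0" for w
  proof -
    have "((\<lambda>t. \<pi> (?q + t *\<^sub>R w)) has_vector_derivative D ?q w) (at 0)"
      using projection_along_curve(1)[OF line_derivative[of ?q w 0 UNIV]] qT by simp
    from tendsto_within_subset[OF difference_quotient_at_0[OF this], of "{0<..}"]
    have L: "((\<lambda>t. (\<pi> (?q + t *\<^sub>R w) - ?q) /\<^sub>R t) \<longlongrightarrow> D ?q w) (at_right 0)"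
      using projection_id[OF projection_in] by simp
    have t0: "((\<lambda>t::real. t) \<longlongrightarrow> 0) (at_right 0)" by (simp add: tendsto_ident_at)
    have "((\<lambda>t. norm (x - ?q) * (t * (norm ((\<pi> (?q + t *\<^sub>R w) - ?q) /\<^sub>R t))\<^sup>2) / (2 * \<delta>) - (x - ?q) \<bullet> ((\<pi> (?q + t *\<^sub>R w) - ?q) /\<^sub>R t)) \<longlongrightarrow> 
      norm (x - ?q) * (0 * (norm (D ?q w))\<^sup>2) / (2 * \<delta>) - (x - ?q) \<bullet> D ?q w) (at_right 0)"
      by (intro tendsto_intros L t0) (use \<delta> in auto)
    moreover have "\<forall>\<^sub>F t in at_right 0. 0 \<le> norm (x - ?q) * (t * (norm ((\<pi> (?q + t *\<^sub>R w) - ?q) /\<^sub>R t))\<^sup>2) / (2 * \<delta>) - (x - ?q) \<bullet> ((\<pi> (?q + t *\<^sub>R w) - ?q) /\<^sub>R t)"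
      unfolding eventually_at_filter
    proof (intro always_eventually allI impI)
      fix t :: real assume "t \<in> {0<..}"
      then have t: "t > 0" by simp
      define z where "z = \<pi> (?q + t *\<^sub>R w)"
      have "(x - ?q) \<bullet> (z - ?q) / t \<le> (norm (x - ?q) * (norm (z - ?q))\<^sup>2 / (2 * \<delta>)) / t"
        unfolding z_def using t by (intro divide_right_mono projection_reach_inequality[OF assms projection_in]) auto
      also have "\<dots> = norm (x - ?q) * (t * (norm ((z - ?q) /\<^sub>R t))\<^sup>2) / (2 * \<delta>)"
      proof -
        have "norm ((z - ?q) /\<^sub>R t) = norm (z - ?q) / t" using t by (simp add: divide_inverse mult.commute)
        moreover have "norm (x - ?q) * (a)\<^sup>2 / (2 * \<delta>) / t = norm (x - ?q) * (t * (a / t)\<^sup>2) / (2 * \<delta>)" for a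
          using t \<delta> by (simp add: power2_eq_square)
        ultimately show ?thesis by metis
      qed
      moreover have "(x - ?q) \<bullet> ((z - ?q) /\<^sub>R t) = (x - ?q) \<bullet> (z - ?q) / t"
        by (simp only: inner_scaleR_right divide_inverse mult.commute)
      ultimately show "0 \<le> norm (x - ?q) * (t * (norm ((\<pi> (?q + t *\<^sub>R w) - ?q) /\<^sub>R t))\<^sup>2) / (2 * \<delta>) - (x - ?q) \<bullet> ((\<pi> (?q + t *\<^sub>R w) - ?q) /\<^sub>R t)"
        unfolding z_def[symmetric] by linarith
    qed
    ultimately have "0 \<le> norm (x - ?q) * (0 * (norm (D ?q w))\<^sup>2) / (2 * \<delta>) - (x - ?q) \<bullet> D ?q w"
      by (intro tendsto_lowerbound) auto
    then show ?thesis by simp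
  qed
  have "D ?q (- w) = - D ?q w" by (rule linear_neg[OF linear_D[OF qT]])
  then show ?thesis using le[of w] le[of "- w"] by simp
qed

lemma residual_quotient:
  assumes "y \<in> N" shows "((\<lambda>t. (y + t *\<^sub>R v - \<pi> (y + t *\<^sub>R v)) /\<^sub>R t) \<longlongrightarrow> v - D y v) (at 0)"
proof -
  have "((\<lambda>t. y + t *\<^sub>R v - \<pi> (y + t *\<^sub>R v)) has_vector_derivative v - D y v) (at 0)"
    using projection_along_curve(1)[OF line_derivative[of y v 0 UNIV]] N_subset_T[OF assms]
    by (intro has_vector_derivative_diff line_derivative) simp
  from difference_quotient_at_0[OF this] show ?thesis by (simp add: projection_id[OF assms])
qed

text \<open>Orthogonality of the residual at \<open>x = y + t v\<close>, divided by t, in the limit \<open>t \<rightarrow> 0\<close>.\<close>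

lemma D_orthogonal:
  assumes "y \<in> N" shows "(v - D y v) \<bullet> D y w = 0"
proof -
  have yT: "y \<in> T" by (rule N_subset_T[OF assms])
  have "((\<lambda>t. \<pi> (y + t *\<^sub>R v)) \<longlongrightarrow> \<pi> (y + 0 *\<^sub>R v)) (at 0)"
    by (rule isCont_tendsto_compose) (use isCont_projection[OF yT] in \<open>auto intro!: tendsto_eq_intros\<close>)
  then have "((\<lambda>t. D (\<pi> (y + t *\<^sub>R v)) w) \<longlongrightarrow> D y w) (at 0)"
    using isCont_tendsto_compose[OF isCont_D[OF yT], of "\<lambda>t. \<pi> (y + t *\<^sub>R v)" "at 0" w] projection_id[OF assms] by simp
  from tendsto_inner[OF residual_quotient[OF assms] this]
  have "((\<lambda>t. ((y + t *\<^sub>R v - \<pi> (y + t *\<^sub>R v)) /\<^sub>R t) \<bullet> D (\<pi> (y + t *\<^sub>R v)) w) \<longlongrightarrow> (v - D y v) \<bullet> D y w) (at 0)" .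
  moreover have "\<forall>\<^sub>F t in at 0. ((y + t *\<^sub>R v - \<pi> (y + t *\<^sub>R v)) /\<^sub>R t) \<bullet> D (\<pi> (y + t *\<^sub>R v)) w = 0"
    using eventually_line_in_T[OF yT, of v] by eventually_elim (simp add: projection_residual_orthogonal)
  then have "((\<lambda>t. ((y + t *\<^sub>R v - \<pi> (y + t *\<^sub>R v)) /\<^sub>R t) \<bullet> D (\<pi> (y + t *\<^sub>R v)) w) \<longlongrightarrow> 0) (at 0)"
    by (rule tendsto_eventually)
  ultimately show ?thesis using tendsto_unique[of "at (0::real)"] by auto
qed

lemma D_symmetric:
  assumes "y \<in> N" shows "D y v \<bullet> w = v \<bullet> D y w"
proof -
  have "v \<bullet> D y w = D y v \<bullet> D y w" "w \<bullet> D y v = D y w \<bullet> D y v"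
    using D_orthogonal[OF assms, of v w] D_orthogonal[OF assms, of w v] by (simp_all add: inner_diff_left)
  then show ?thesis by (metis inner_commute)
qed

lemma D_inner_D: "y \<in> N \<Longrightarrow> D y v \<bullet> D y w = D y v \<bullet> w"
  using D_symmetric[of y "D y v" w] D_idem[of y v] by simp

lemma norm_D_on_N:
  assumes "y \<in> N" shows "norm (D y v) \<le> norm v"
proof -
  have "norm (D y v) * norm (D y v) = D y v \<bullet> v"
    using D_inner_D[OF assms, of v v] by (simp add: power2_norm_eq_inner[symmetric] power2_eq_square)
  also have "\<dots> \<le> norm v * norm (D y v)" using norm_cauchy_schwarz[of "D y v" v] by (simp add: mult.commute)
  finally show ?thesis by (cases "norm (D y v) = 0") (auto dest: mult_right_le_imp_le)
qed

text \<open>The residual of \<open>y + t \<nu>\<close> is \<open>t \<nu>\<close> to first order when \<open>\<nu>\<close> is normal. Divide the reach inequality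
  by t and let t tend to zero.\<close>

lemma normal_reach_inequality:
  assumes "y \<in> N" "z \<in> N" "D y \<nu> = 0"
  shows "\<nu> \<bullet> (z - y) \<le> norm \<nu> * (norm (z - y))\<^sup>2 / (2 * \<delta>)"
proof -
  have yT: "y \<in> T" by (rule N_subset_T[OF assms(1)])
  have L1: "((\<lambda>t. (y + t *\<^sub>R \<nu> - \<pi> (y + t *\<^sub>R \<nu>)) /\<^sub>R t) \<longlongrightarrow> \<nu>) (at 0)"
    using residual_quotient[OF assms(1), of \<nu>] assms(3) by simp
  have "((\<lambda>t. \<pi> (y + t *\<^sub>R \<nu>)) \<longlongrightarrow> \<pi> (y + 0 *\<^sub>R \<nu>)) (at 0)"
    by (rule isCont_tendsto_compose) (use isCont_projection[OF yT] in \<open>auto intro!: tendsto_eq_intros\<close>)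
  then have L2: "((\<lambda>t. \<pi> (y + t *\<^sub>R \<nu>)) \<longlongrightarrow> y) (at 0)" using projection_id[OF assms(1)] by simp
  have "((\<lambda>t. norm ((y + t *\<^sub>R \<nu> - \<pi> (y + t *\<^sub>R \<nu>)) /\<^sub>R t) * (norm (z - \<pi> (y + t *\<^sub>R \<nu>)))\<^sup>2 / (2 * \<delta>) -
      ((y + t *\<^sub>R \<nu> - \<pi> (y + t *\<^sub>R \<nu>)) /\<^sub>R t) \<bullet> (z - \<pi> (y + t *\<^sub>R \<nu>))) \<longlongrightarrow>
      norm \<nu> * (norm (z - y))\<^sup>2 / (2 * \<delta>) - \<nu> \<bullet> (z - y)) (at 0)"
    by (intro tendsto_intros L1 L2) (use \<delta> in auto)
  then have "((\<lambda>t. norm ((y + t *\<^sub>R \<nu> - \<pi> (y + t *\<^sub>R \<nu>)) /\<^sub>R t) * (norm (z - \<pi> (y + t *\<^sub>R \<nu>)))\<^sup>2 / (2 * \<delta>) -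
      ((y + t *\<^sub>R \<nu> - \<pi> (y + t *\<^sub>R \<nu>)) /\<^sub>R t) \<bullet> (z - \<pi> (y + t *\<^sub>R \<nu>))) \<longlongrightarrow>
      norm \<nu> * (norm (z - y))\<^sup>2 / (2 * \<delta>) - \<nu> \<bullet> (z - y)) (at_right 0)"
    by (rule tendsto_within_subset) simp
  moreover have "\<forall>\<^sub>F t in at_right 0. 0 \<le> norm ((y + t *\<^sub>R \<nu> - \<pi> (y + t *\<^sub>R \<nu>)) /\<^sub>R t) * (norm (z - \<pi> (y + t *\<^sub>R \<nu>)))\<^sup>2 / (2 * \<delta>) -
      ((y + t *\<^sub>R \<nu> - \<pi> (y + t *\<^sub>R \<nu>)) /\<^sub>R t) \<bullet> (z - \<pi> (y + t *\<^sub>R \<nu>))"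
  proof -
    have "\<forall>\<^sub>F t in at_right 0. y + t *\<^sub>R \<nu> \<in> T"
      by (rule filter_leD[OF at_le[OF subset_UNIV] eventually_line_in_T[OF yT]])
    moreover have "\<forall>\<^sub>F t in at_right (0::real). t > 0" by (simp add: eventually_at_filter)
    ultimately show ?thesis
    proof eventually_elim
      case (elim t)
      let ?x = "y + t *\<^sub>R \<nu>"
      have "(?x - \<pi> ?x) \<bullet> (z - \<pi> ?x) / t \<le> (norm (?x - \<pi> ?x) * (norm (z - \<pi> ?x))\<^sup>2 / (2 * \<delta>)) / t"
        using elim by (intro divide_right_mono projection_reach_inequality[OF _ assms(2)]) auto
      moreover have "((?x - \<pi> ?x) /\<^sub>R t) \<bullet> (z - \<pi> ?x) = (?x - \<pi> ?x) \<bullet> (z - \<pi> ?x) / t"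
        by (simp only: inner_scaleR_left divide_inverse mult.commute)
      moreover have "norm ((?x - \<pi> ?x) /\<^sub>R t) * (norm (z - \<pi> ?x))\<^sup>2 / (2 * \<delta>) = (norm (?x - \<pi> ?x) * (norm (z - \<pi> ?x))\<^sup>2 / (2 * \<delta>)) / t"
        using elim by (simp only: norm_scaleR divide_inverse) simp
      ultimately show ?case by linarith
    qed
  qed
  ultimately have "0 \<le> norm \<nu> * (norm (z - y))\<^sup>2 / (2 * \<delta>) - \<nu> \<bullet> (z - y)"
    by (intro tendsto_lowerbound) auto
  then show ?thesis by simp
qed

section \<open>The second derivative of the projection along the set\<close>

text \<open>Identities between D and inner products that hold on N can be differentiated along such curves.
  They yield the algebra of \<open>Hess \<pi>\<close> in tangent directions.\<close>

lemma tangent_curve: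
  assumes "y \<in> N" "D y v = v"
  obtains \<gamma> where "\<gamma> 0 = y" "\<And>t. \<gamma> t \<in> N" "(\<gamma> has_vector_derivative v) (at 0)"
    "\<And>a. ((\<lambda>t. D (\<gamma> t) a) has_vector_derivative Hess \<pi> y v a) (at 0)"
proof
  let ?g = "\<lambda>t. \<pi> (y + t *\<^sub>R v)"
  have yT: "y \<in> T" by (rule N_subset_T[OF assms(1)])
  show g0: "?g 0 = y" by (simp add: projection_id[OF assms(1)])
  show "?g t \<in> N" for t by (rule projection_in)
  show g': "(?g has_vector_derivative v) (at 0)"
    using projection_along_curve(1)[OF line_derivative[of y v 0 UNIV]] yT assms(2) by simp
  show "((\<lambda>t. D (?g t) a) has_vector_derivative Hess \<pi> y v a) (at 0)" for a
    using projection_along_curve(2)[OF g', of a] g0 yT by (simp add: projection_id[OF assms(1)])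
qed

lemma has_vector_derivative_inner_eq:
  fixes f g h k :: "real \<Rightarrow> real^'p"
  assumes "\<And>t. f t \<bullet> g t = h t \<bullet> k t"
    "(f has_vector_derivative f') (at 0)" "(g has_vector_derivative g') (at 0)"
    "(h has_vector_derivative h') (at 0)" "(k has_vector_derivative k') (at 0)"
  shows "f 0 \<bullet> g' + f' \<bullet> g 0 = h 0 \<bullet> k' + h' \<bullet> k 0"
proof -
  have "((\<lambda>t. f t \<bullet> g t) has_vector_derivative f 0 \<bullet> g' + f' \<bullet> g 0) (at 0)"
    by (rule bounded_bilinear.has_vector_derivative[OF bounded_bilinear_inner assms(2,3)])
  moreover have "((\<lambda>t. f t \<bullet> g t) has_vector_derivative h 0 \<bullet> k' + h' \<bullet> k 0) (at 0)"
    unfolding assms(1) by (rule bounded_bilinear.has_vector_derivative[OF bounded_bilinear_inner assms(4,5)])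
  ultimately show ?thesis by (rule vector_derivative_unique_at)
qed

text \<open>Differentiate \<open>D a \<bullet> b = a \<bullet> D b\<close>.\<close>

lemma Hess_tangent_symmetric:
  assumes "y \<in> N" "D y v = v" shows "Hess \<pi> y v a \<bullet> b = a \<bullet> Hess \<pi> y v b"
proof -
  obtain \<gamma> where \<gamma>: "\<gamma> 0 = y" "\<And>t. \<gamma> t \<in> N" "(\<gamma> has_vector_derivative v) (at 0)"
    "\<And>a. ((\<lambda>t. D (\<gamma> t) a) has_vector_derivative Hess \<pi> y v a) (at 0)"
    by (rule tangent_curve[OF assms], rule that)
  have "D (\<gamma> 0) a \<bullet> 0 + Hess \<pi> y v a \<bullet> b = a \<bullet> Hess \<pi> y v b + 0 \<bullet> D (\<gamma> 0) b"
    by (rule has_vector_derivative_inner_eq[OF D_symmetric[OF \<gamma>(2)] \<gamma>(4) has_vector_derivative_const has_vector_derivative_const \<gamma>(4)])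
  then show ?thesis by simp
qed

text \<open>Differentiate \<open>D a \<bullet> D b = D a \<bullet> b\<close>.\<close>

lemma Hess_tangent_product:
  assumes "y \<in> N" "D y v = v" shows "D y a \<bullet> Hess \<pi> y v b + Hess \<pi> y v a \<bullet> D y b = Hess \<pi> y v a \<bullet> b"
proof -
  obtain \<gamma> where \<gamma>: "\<gamma> 0 = y" "\<And>t. \<gamma> t \<in> N" "(\<gamma> has_vector_derivative v) (at 0)"
    "\<And>a. ((\<lambda>t. D (\<gamma> t) a) has_vector_derivative Hess \<pi> y v a) (at 0)"
    by (rule tangent_curve[OF assms], rule that)
  have "D (\<gamma> 0) a \<bullet> Hess \<pi> y v b + Hess \<pi> y v a \<bullet> D (\<gamma> 0) b = D (\<gamma> 0) a \<bullet> 0 + Hess \<pi> y v a \<bullet> b"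
    by (rule has_vector_derivative_inner_eq[OF D_inner_D[OF \<gamma>(2)] \<gamma>(4) \<gamma>(4) \<gamma>(4) has_vector_derivative_const])
  then show ?thesis by (simp add: \<gamma>(1))
qed

lemma Hess_tangent_is_normal:
  assumes y: "y \<in> N" and v: "D y v = v" and a: "D y a = a" shows "D y (Hess \<pi> y v a) = 0"
proof -
  have "D y (Hess \<pi> y v a) \<bullet> c = 0" for c
  proof -
    have "D y (Hess \<pi> y v a) \<bullet> c = Hess \<pi> y v a \<bullet> D y c" by (rule D_symmetric[OF y])
    moreover have "a \<bullet> Hess \<pi> y v (D y c) + Hess \<pi> y v a \<bullet> D y c = Hess \<pi> y v a \<bullet> D y c"
      using Hess_tangent_product[OF y v, of a "D y c"] a by (simp add: D_idem[OF y])
    ultimately show ?thesis using Hess_tangent_symmetric[OF y v, of a "D y c"] by simp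
  qed
  then show ?thesis by (metis inner_eq_zero_iff)
qed

lemma Hess_normal_is_tangent:
  assumes y: "y \<in> N" and v: "D y v = v" and a: "D y a = 0" shows "D y (Hess \<pi> y v a) = Hess \<pi> y v a"
proof -
  have "D y (Hess \<pi> y v a) \<bullet> c = Hess \<pi> y v a \<bullet> c" for c
    using Hess_tangent_product[OF y v, of a c] a by (simp add: D_symmetric[OF y])
  then show ?thesis by (metis vector_eq_rdot)
qed

text \<open>Let \<open>\<gamma>\<close> be a curve in N with velocity v at y, and \<open>n = \<nu> - D (\<gamma> t) \<nu>\<close> the normal part of \<open>\<nu>\<close> at
  \<open>\<gamma> t\<close>. Add the reach inequalities for \<open>\<nu>\<close> at y and for n at \<open>\<gamma> t\<close>, each with the other point: the left
  sides combine to \<open>D (\<gamma> t) \<nu> \<bullet> (\<gamma> t - y)\<close>, which is \<open>t\<^sup>2 (Hess \<pi> y v \<nu> \<bullet> v)\<close> to leading order.\<close>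

lemma Hess_quadratic_bound:
  assumes y: "y \<in> N" and v: "D y v = v" and \<nu>: "D y \<nu> = 0"
  shows "\<nu> \<bullet> Hess \<pi> y v v \<le> norm \<nu> * (norm v)\<^sup>2 / \<delta>"
proof -
  obtain \<gamma> where \<gamma>: "\<gamma> 0 = y" "\<And>t. \<gamma> t \<in> N" "(\<gamma> has_vector_derivative v) (at 0)" 
    "\<And>a. ((\<lambda>t. D (\<gamma> t) a) has_vector_derivative Hess \<pi> y v a) (at 0)"
    by (rule tangent_curve[OF y v], rule that)
  have L1: "((\<lambda>t. (\<gamma> t - y) /\<^sub>R t) \<longlongrightarrow> v) (at 0)" using difference_quotient_at_0[OF \<gamma>(3)] \<gamma>(1) by simp
  have L2: "((\<lambda>t. D (\<gamma> t) \<nu> /\<^sub>R t) \<longlongrightarrow> Hess \<pi> y v \<nu>) (at 0)"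
    using difference_quotient_at_0[OF \<gamma>(4)[of \<nu>]] \<gamma>(1) \<nu> by simp
  have L3: "((\<lambda>t. D (\<gamma> t) \<nu>) \<longlongrightarrow> 0) (at 0)"
    using has_vector_derivative_continuous[OF \<gamma>(4)[of \<nu>]] \<gamma>(1) \<nu> by (simp add: isCont_def)
  have "((\<lambda>t. (norm \<nu> + norm (\<nu> - D (\<gamma> t) \<nu>)) * (norm ((\<gamma> t - y) /\<^sub>R t))\<^sup>2 / (2 * \<delta>) - (D (\<gamma> t) \<nu> /\<^sub>R t) \<bullet> ((\<gamma> t - y) /\<^sub>R t)) \<longlongrightarrow>
    (norm \<nu> + norm (\<nu> - 0)) * (norm v)\<^sup>2 / (2 * \<delta>) - Hess \<pi> y v \<nu> \<bullet> v) (at 0)"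
    by (intro tendsto_intros L1 L2 L3) (use \<delta> in auto)
  moreover have "\<forall>\<^sub>F t in at 0. 0 \<le> (norm \<nu> + norm (\<nu> - D (\<gamma> t) \<nu>)) * (norm ((\<gamma> t - y) /\<^sub>R t))\<^sup>2 / (2 * \<delta>) - (D (\<gamma> t) \<nu> /\<^sub>R t) \<bullet> ((\<gamma> t - y) /\<^sub>R t)"
    unfolding eventually_at_filter
  proof (intro always_eventually allI impI)
    fix t :: real assume t: "t \<noteq> 0"
    define n where "n = \<nu> - D (\<gamma> t) \<nu>"
    have nT: "D (\<gamma> t) n = 0"
      unfolding n_def linear_diff[OF linear_D[OF N_subset_T[OF \<gamma>(2)]]] by (simp add: D_idem[OF \<gamma>(2)])
    have 1: "\<nu> \<bullet> (\<gamma> t - y) \<le> norm \<nu> * (norm (\<gamma> t - y))\<^sup>2 / (2 * \<delta>)"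
      by (rule normal_reach_inequality[OF y \<gamma>(2) \<nu>])
    have 2: "n \<bullet> (y - \<gamma> t) \<le> norm n * (norm (\<gamma> t - y))\<^sup>2 / (2 * \<delta>)"
      using normal_reach_inequality[OF \<gamma>(2) y nT] by (simp add: norm_minus_commute)
    have "D (\<gamma> t) \<nu> \<bullet> (\<gamma> t - y) = \<nu> \<bullet> (\<gamma> t - y) + n \<bullet> (y - \<gamma> t)"
      by (simp add: n_def inner_diff_left inner_diff_right)
    also have "\<dots> \<le> (norm \<nu> + norm n) * (norm (\<gamma> t - y))\<^sup>2 / (2 * \<delta>)"
      using 1 2 by (simp add: distrib_right add_divide_distrib)
    finally have "(D (\<gamma> t) \<nu> \<bullet> (\<gamma> t - y)) / t\<^sup>2 \<le> ((norm \<nu> + norm n) * (norm (\<gamma> t - y))\<^sup>2 / (2 * \<delta>)) / t\<^sup>2"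
      by (rule divide_right_mono) simp
    moreover have "(D (\<gamma> t) \<nu> /\<^sub>R t) \<bullet> ((\<gamma> t - y) /\<^sub>R t) = (D (\<gamma> t) \<nu> \<bullet> (\<gamma> t - y)) / t\<^sup>2"
      by (simp only: inner_scaleR_left inner_scaleR_right divide_inverse power2_eq_square) simp
    moreover have "(norm \<nu> + norm n) * (norm ((\<gamma> t - y) /\<^sub>R t))\<^sup>2 / (2 * \<delta>) = ((norm \<nu> + norm n) * (norm (\<gamma> t - y))\<^sup>2 / (2 * \<delta>)) / t\<^sup>2"
      by (simp only: norm_scaleR power_mult_distrib divide_inverse) (simp add: power_inverse)
    ultimately show "0 \<le> (norm \<nu> + norm (\<nu> - D (\<gamma> t) \<nu>)) * (norm ((\<gamma> t - y) /\<^sub>R t))\<^sup>2 / (2 * \<delta>) - (D (\<gamma> t) \<nu> /\<^sub>R t) \<bullet> ((\<gamma> t - y) /\<^sub>R t)"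
      by (simp only: n_def)
  qed
  ultimately have "0 \<le> (norm \<nu> + norm (\<nu> - 0)) * (norm v)\<^sup>2 / (2 * \<delta>) - Hess \<pi> y v \<nu> \<bullet> v"
    by (intro tendsto_lowerbound) auto
  moreover have "(norm \<nu> + norm (\<nu> - 0)) * (norm v)\<^sup>2 / (2 * \<delta>) = norm \<nu> * (norm v)\<^sup>2 / \<delta>" using \<delta> by (simp add: field_simps)
  ultimately show ?thesis using Hess_tangent_symmetric[OF y v, of \<nu> v] by simp
qed

lemma Hess_commute: "y \<in> N \<Longrightarrow> Hess \<pi> y v w = Hess \<pi> y w v"
  using Hess_symmetric[OF open_T N_subset_T projection_C2] .

lemma Hess_expand:
  assumes "y \<in> N" shows "(\<Sum>b\<in>Basis. (a \<bullet> b) *\<^sub>R Hess \<pi> y v b) = Hess \<pi> y v a"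
proof -
  note lin = linear_Hess[OF N_subset_T[OF assms]]
  have "Hess \<pi> y a v = Hess \<pi> y (\<Sum>b\<in>Basis. (a \<bullet> b) *\<^sub>R b) v" by (simp only: euclidean_representation)
  then have "Hess \<pi> y a v = (\<Sum>b\<in>Basis. (a \<bullet> b) *\<^sub>R Hess \<pi> y b v)" by (simp only: linear_sum[OF lin] linear_scale[OF lin])
  then show ?thesis by (simp only: Hess_commute[OF assms, of v])
qed

text \<open>Polarization of the quadratic bound, using symmetry of the second derivative.\<close>

lemma Hess_bilinear_bound:
  assumes y: "y \<in> N" and v: "D y v = v" and w: "D y w = w" and \<nu>: "D y \<nu> = 0"
  shows "\<nu> \<bullet> Hess \<pi> y v w \<le> norm \<nu> * norm v * norm w / \<delta>"
proof -
  have yT: "y \<in> T" by (rule N_subset_T[OF y])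
  note linD = linear_D[OF yT]
  note lH = linear_Hess[OF yT]
  have add: "Hess \<pi> y (a + b) c = Hess \<pi> y a c + Hess \<pi> y b c" for a b c using linear_add[OF lH] .
  have add2: "Hess \<pi> y c (a + b) = Hess \<pi> y c a + Hess \<pi> y c b" for a b c
    using add[of a b c] by (simp add: Hess_commute[OF y, of c])
  have unit: "\<nu> \<bullet> Hess \<pi> y a b \<le> norm \<nu> * ((norm a)\<^sup>2 + (norm b)\<^sup>2) / (2 * \<delta>)" if a: "D y a = a" and b: "D y b = b" for a b
  proof -
    have 1: "\<nu> \<bullet> Hess \<pi> y (a + b) (a + b) \<le> norm \<nu> * (norm (a + b))\<^sup>2 / \<delta>"
      by (rule Hess_quadratic_bound[OF y _ \<nu>]) (simp add: linear_add[OF linD] a b)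
    have mb: "D y (- b) = - b" using linear_neg[OF linD, of b] b by simp
    have m\<nu>: "D y (- \<nu>) = 0" using linear_neg[OF linD, of \<nu>] \<nu> by simp
    have 2: "(- \<nu>) \<bullet> Hess \<pi> y (a + - b) (a + - b) \<le> norm (- \<nu>) * (norm (a + - b))\<^sup>2 / \<delta>"
      by (rule Hess_quadratic_bound[OF y _ m\<nu>]) (simp only: linear_add[OF linD] a mb)
    have neg: "Hess \<pi> y (- b) c = - Hess \<pi> y b c" for c using linear_neg[OF lH] .
    have neg2: "Hess \<pi> y c (- b) = - Hess \<pi> y c b" for c using neg[of c] by (simp add: Hess_commute[OF y, of c])
    have "4 * (\<nu> \<bullet> Hess \<pi> y a b) = \<nu> \<bullet> Hess \<pi> y (a + b) (a + b) + (- \<nu>) \<bullet> Hess \<pi> y (a + - b) (a + - b)"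
      unfolding add add2 neg neg2 Hess_commute[OF y, of b a]
      by (simp only: inner_add_right inner_minus_left inner_minus_right)
    also have "\<dots> \<le> norm \<nu> * (norm (a + b))\<^sup>2 / \<delta> + norm \<nu> * (norm (a + - b))\<^sup>2 / \<delta>" using 1 2 by simp
    also have "\<dots> = norm \<nu> * ((norm (a + b))\<^sup>2 + (norm (a + - b))\<^sup>2) / \<delta>" by (simp add: add_divide_distrib distrib_left)
    also have "(norm (a + b))\<^sup>2 + (norm (a + - b))\<^sup>2 = 2 * ((norm a)\<^sup>2 + (norm b)\<^sup>2)"
      unfolding power2_norm_eq_inner by (simp add: inner_add_left inner_add_right inner_diff_left inner_diff_right inner_commute)
    finally show ?thesis using \<delta> by (simp add: field_simps)
  qed
  show ?thesis
  proof (cases "v = 0 \<or> w = 0")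
    case True
    have "Hess \<pi> y 0 c = 0" "Hess \<pi> y c 0 = 0" for c using linear_0[OF lH] by (simp_all add: Hess_commute[OF y, of c])
    then show ?thesis using True by auto
  next
    case False
    define a b where "a = v /\<^sub>R norm v" and "b = w /\<^sub>R norm w"
    have n: "norm a = 1" "norm b = 1" using False by (auto simp: a_def b_def)
    have vw: "v = norm v *\<^sub>R a" "w = norm w *\<^sub>R b" using False by (auto simp: a_def b_def)
    have "\<nu> \<bullet> Hess \<pi> y a b \<le> norm \<nu> * ((norm a)\<^sup>2 + (norm b)\<^sup>2) / (2 * \<delta>)"
      by (rule unit) (simp_all add: a_def b_def linear_scale[OF linD] v w)
    also have "\<dots> = norm \<nu> / \<delta>" using \<delta> by (simp add: n)
    finally have "(norm v * norm w) * (\<nu> \<bullet> Hess \<pi> y a b) \<le> (norm v * norm w) * (norm \<nu> / \<delta>)"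
      by (intro mult_left_mono) auto
    moreover have "Hess \<pi> y v w = (norm v * norm w) *\<^sub>R Hess \<pi> y a b"
    proof -
      have "Hess \<pi> y v w = norm v *\<^sub>R Hess \<pi> y w a"
        by (subst vw(1)) (simp only: Hess_scaleR[OF yT] Hess_commute[OF y, of a w])
      also have "\<dots> = norm v *\<^sub>R norm w *\<^sub>R Hess \<pi> y b a"
        by (subst vw(2)) (simp only: Hess_scaleR[OF yT])
      finally show ?thesis by (simp add: Hess_commute[OF y, of b a])
    qed
    ultimately show ?thesis by (simp add: algebra_simps)
  qed
qed

text \<open>Split a into tangent and normal part. The first contributes a normal vector and the second a
  tangent vector; by symmetry of \<open>Hess \<pi> y v\<close> both are controlled by the bilinear bound.\<close>

lemma norm_Hess_tangent_le:
  assumes y: "y \<in> N" and v: "D y v = v"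
  shows "norm (Hess \<pi> y v a) \<le> (2 / \<delta>) * norm v * norm a"
proof -
  have yT: "y \<in> T" by (rule N_subset_T[OF y])
  note linD = linear_D[OF yT]
  have tt: "norm (Hess \<pi> y v w) \<le> norm v * norm w / \<delta>" if w: "D y w = w" for w
  proof -
    let ?h = "Hess \<pi> y v w"
    have le: "norm ?h * norm ?h \<le> norm ?h * (norm v * norm w / \<delta>)"
      using Hess_bilinear_bound[OF y v w Hess_tangent_is_normal[OF y v w]]
      by (simp add: power2_norm_eq_inner[symmetric] power2_eq_square)
    show ?thesis
    proof (cases "?h = 0")
      case True then show ?thesis using \<delta> by simp
    next
      case False then show ?thesis by (intro mult_left_le_imp_le[OF le]) simp
    qed
  qed
  have tn: "norm (Hess \<pi> y v n) \<le> norm v * norm n / \<delta>" if n: "D y n = 0" for n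
  proof -
    let ?h = "Hess \<pi> y v n"
    have "norm ?h * norm ?h = n \<bullet> Hess \<pi> y v ?h"
      using Hess_tangent_symmetric[OF y v, of n ?h] by (simp add: power2_norm_eq_inner[symmetric] power2_eq_square)
    also have "\<dots> \<le> norm n * norm v * norm ?h / \<delta>"
      by (rule Hess_bilinear_bound[OF y v Hess_normal_is_tangent[OF y v n] n])
    finally have le: "norm ?h * norm ?h \<le> norm ?h * (norm v * norm n / \<delta>)" by (simp add: algebra_simps)
    show ?thesis
    proof (cases "?h = 0")
      case True then show ?thesis using \<delta> by simp
    next
      case False then show ?thesis by (intro mult_left_le_imp_le[OF le]) simp
    qed
  qed
  have "Hess \<pi> y v a = Hess \<pi> y v (D y a) + Hess \<pi> y v (a - D y a)"
    using linear_add[OF linear_Hess[OF yT], of "D y a" "a - D y a" v] by (simp add: Hess_commute[OF y, of v])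
  then have "norm (Hess \<pi> y v a) \<le> norm (Hess \<pi> y v (D y a)) + norm (Hess \<pi> y v (a - D y a))"
    by (metis norm_triangle_ineq)
  also have "\<dots> \<le> norm v * norm (D y a) / \<delta> + norm v * norm (a - D y a) / \<delta>"
    by (intro add_mono tt tn) (simp_all add: D_idem[OF y] linear_diff[OF linD])
  also have "\<dots> \<le> norm v * norm a / \<delta> + norm v * norm a / \<delta>"
  proof -
    have "(norm (a - D y a))\<^sup>2 \<le> (norm a)\<^sup>2"
      using D_orthogonal[OF y, of a a] unfolding power2_norm_eq_inner
      by (simp add: inner_diff_left inner_diff_right inner_commute)
    then have "norm (a - D y a) \<le> norm a" by (rule power2_le_imp_le) simp
    then show ?thesis using norm_D_on_N[OF y, of a] \<delta> by (intro add_mono divide_right_mono mult_left_mono) auto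
  qed
  finally show ?thesis using \<delta> by (simp add: field_simps)
qed

text \<open>Distant points are handled by the bound 1 for D. Nearby points are joined by the projection of the
  segment between them, which lies in the tube of radius \<open>\<delta> / 2\<close>, where \<open>\<pi>\<close> has Lipschitz constant 2.
  Its velocity is tangent to N, so the bound for \<open>Hess \<pi>\<close> in tangent directions applies along the path.\<close>

lemma D_lipschitz_on_N:
  assumes y: "y \<in> N" and z: "z \<in> N"
  shows "norm (D y a - D z a) \<le> (4 / \<delta> * norm a) * norm (y - z)"
proof (cases "norm (y - z) < \<delta>")
  case False
  have "norm (D y a - D z a) \<le> norm a + norm a"
    using norm_triangle_ineq4[of "D y a" "D z a"] norm_D_on_N[OF y, of a] norm_D_on_N[OF z, of a] by linarith
  also have "\<dots> \<le> (4 / \<delta> * norm a) * \<delta>" using \<delta> by simp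
  also have "\<dots> \<le> (4 / \<delta> * norm a) * norm (y - z)" using False \<delta> by (intro mult_left_mono) auto
  finally show ?thesis .
next
  case True
  let ?x = "\<lambda>t. z + t *\<^sub>R (y - z)"
  have near: "infdist (?x t) N \<le> norm (y - z) / 2" if "t \<in> {0..1}" for t
  proof (cases "t \<le> 1/2")
    case True
    have "infdist (?x t) N \<le> dist (?x t) z" by (rule infdist_le[OF z])
    also have "\<dots> = t * norm (y - z)" using that by (simp add: dist_norm)
    also have "\<dots> \<le> 1/2 * norm (y - z)" using True by (intro mult_right_mono) auto
    finally show ?thesis by simp
  next
    case False
    have "infdist (?x t) N \<le> dist (?x t) y" by (rule infdist_le[OF y])
    also have "?x t - y = - ((1 - t) *\<^sub>R (y - z))" by (simp add: algebra_simps)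
    then have "dist (?x t) y = (1 - t) * norm (y - z)" using that by (simp only: dist_norm norm_minus_cancel norm_scaleR) simp
    also have "\<dots> \<le> 1/2 * norm (y - z)" using False by (intro mult_right_mono) auto
    finally show ?thesis by simp
  qed
  have lt: "infdist (?x t) N < \<delta> / 2" "?x t \<in> T" if "t \<in> {0..1}" for t
    using near[OF that] True infdist_nonneg[of "?x t" N] by (auto simp: tubular_nbhd_def)
  have "norm (D (\<pi> (?x 1)) a - D (\<pi> (?x 0)) a) \<le> (4 / \<delta> * norm a * norm (y - z)) * norm (1 - 0 :: real)"
  proof (rule differentiable_bound[where S="{0..1}" and f'="\<lambda>t r. r *\<^sub>R Hess \<pi> (\<pi> (?x t)) (D (?x t) (y - z)) a"])
    fix t :: real assume t: "t \<in> {0..1}"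
    have "((\<lambda>t. \<pi> (?x t)) has_vector_derivative D (?x t) (y - z)) (at t within {0..1})"
      by (rule projection_along_curve(1)[where \<gamma>="?x", OF line_derivative lt(2)[OF t]])
    from projection_along_curve(2)[OF this N_subset_T[OF projection_in], of a]
    show "((\<lambda>t. D (\<pi> (?x t)) a) has_derivative (\<lambda>r. r *\<^sub>R Hess \<pi> (\<pi> (?x t)) (D (?x t) (y - z)) a)) (at t within {0..1})"
      by (simp add: has_vector_derivative_def)
    show "onorm (\<lambda>r. r *\<^sub>R Hess \<pi> (\<pi> (?x t)) (D (?x t) (y - z)) a) \<le> 4 / \<delta> * norm a * norm (y - z)"
    proof (rule onorm_le)
      fix r :: real
      have "norm (D (?x t) (y - z)) \<le> norm (y - z) / (1 - (\<delta> / 2) / \<delta>)"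
        using lt(1)[OF t] \<delta> by (intro norm_D_le) auto
      then have b: "norm (D (?x t) (y - z)) \<le> 2 * norm (y - z)" using \<delta> by simp
      have "norm (Hess \<pi> (\<pi> (?x t)) (D (?x t) (y - z)) a) \<le> (2 / \<delta>) * norm (D (?x t) (y - z)) * norm a"
        by (rule norm_Hess_tangent_le[OF projection_in D_projection_D[OF lt(2)[OF t]]])
      also have "\<dots> \<le> (2 / \<delta>) * (2 * norm (y - z)) * norm a"
        using b \<delta> by (intro mult_right_mono mult_left_mono) auto
      finally have "norm (Hess \<pi> (\<pi> (?x t)) (D (?x t) (y - z)) a) \<le> 4 / \<delta> * norm a * norm (y - z)"
        by (simp add: algebra_simps)
      from mult_left_mono[OF this, of "\<bar>r\<bar>"] show "norm (r *\<^sub>R Hess \<pi> (\<pi> (?x t)) (D (?x t) (y - z)) a) \<le> 4 / \<delta> * norm a * norm (y - z) * norm r"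
        by (simp only: norm_scaleR real_norm_def mult.commute[of _ "\<bar>r\<bar>"] abs_ge_zero simp_thms)
    qed
  qed auto
  then show ?thesis by (simp add: projection_id y z)
qed

section \<open>Tangent spaces and the second fundamental form\<close>

text \<open>A curve in N is fixed by \<open>\<pi>\<close>, so its velocity is fixed by D. Conversely the projection of the line
  through y in direction v is a curve in N with velocity \<open>D y v\<close>.\<close>

lemma tangent_space_eq:
  assumes y: "y \<in> N" shows "tangent_space N y = {v. D y v = v}"
proof (intro set_eqI iffI)
  fix v assume "v \<in> tangent_space N y"
  then obtain \<epsilon> and \<gamma> :: "real \<Rightarrow> real^'p" where \<gamma>: "\<epsilon> > 0" "\<gamma> ` {-\<epsilon><..<\<epsilon>} \<subseteq> N" "\<gamma> 0 = y" "(\<gamma> has_vector_derivative v) (at 0)"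
    unfolding tangent_space_def by blast
  have "((\<lambda>t. \<pi> (\<gamma> t)) has_vector_derivative D y v) (at 0)"
    using projection_along_curve(1)[OF \<gamma>(4)] \<gamma>(3) N_subset_T[OF y] by simp
  moreover have "\<pi> (\<gamma> t) = \<gamma> t" if "t \<in> {-\<epsilon><..<\<epsilon>}" for t using that \<gamma>(2) by (intro projection_id) blast
  ultimately have "(\<gamma> has_vector_derivative D y v) (at 0)"
    using \<gamma>(1) by (elim has_vector_derivative_transform_within_open[where S="{-\<epsilon><..<\<epsilon>}"]) auto
  then show "v \<in> {v. D y v = v}" using \<gamma>(4) vector_derivative_unique_at by blast
next
  fix v assume "v \<in> {v. D y v = v}"
  then have v: "D y v = v" by simp
  define \<epsilon> where "\<epsilon> = \<delta> / (norm v + 1)"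
  have no: "norm v + 1 > 0" by (simp add: add_nonneg_pos)
  have inT: "y + t *\<^sub>R v \<in> T" if "t \<in> {-\<epsilon><..<\<epsilon>}" for t
  proof (rule in_T_near[OF y])
    have "\<bar>t\<bar> * norm v \<le> \<bar>t\<bar> * (norm v + 1)" by (intro mult_left_mono) auto
    also have "\<dots> < \<epsilon> * (norm v + 1)" using that no by (intro mult_strict_right_mono) auto
    also have "\<dots> = \<delta>" using no by (simp add: \<epsilon>_def)
    finally show "norm (t *\<^sub>R v) < \<delta>" by simp
  qed
  let ?g = "\<lambda>t. \<pi> (y + t *\<^sub>R v)"
  have "Ck_on (Suc 0) ?g {-\<epsilon><..<\<epsilon>}"
  proof (rule Ck_on_SucI[where f'="\<lambda>t r. r *\<^sub>R D (y + t *\<^sub>R v) v"])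
    show "(?g has_derivative (\<lambda>r. r *\<^sub>R D (y + t *\<^sub>R v) v)) (at t)" if "t \<in> {-\<epsilon><..<\<epsilon>}" for t
      using projection_along_curve(1)[where \<gamma>="\<lambda>t. y + t *\<^sub>R v", OF line_derivative[where S=UNIV] inT[OF that]]
      by (simp add: has_vector_derivative_def)
    have "continuous_on {-\<epsilon><..<\<epsilon>} (\<lambda>t. D (y + t *\<^sub>R v) v)"
      by (rule continuous_on_compose2[OF D_continuous]) (use inT in \<open>auto intro!: continuous_intros\<close>)
    then show "Ck_on 0 (\<lambda>t. r *\<^sub>R D (y + t *\<^sub>R v) v) {-\<epsilon><..<\<epsilon>}" for r :: real
      by (simp add: continuous_on_scaleR)
  qed simp
  moreover have "(?g has_vector_derivative v) (at 0)"
    using projection_along_curve(1)[OF line_derivative[of y v 0 UNIV]] N_subset_T[OF y] v by simp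
  moreover have "\<epsilon> > 0" using \<delta> no by (simp add: \<epsilon>_def)
  ultimately show "v \<in> tangent_space N y"
    unfolding tangent_space_def using projection_in projection_id[OF y]
    by (intro CollectI exI[of _ \<epsilon>] conjI exI[of _ ?g]) auto
qed

lemma tangential_part_eq: 
  assumes y: "y \<in> N" shows "tangential_part N y v = D y v"
  unfolding tangential_part_def tangent_space_eq[OF y] mem_Collect_eq Ball_Collect
proof (rule the_equality)
  show "D y (D y v) = D y v \<and> {w. D y w = w} \<subseteq> {w. (v - D y v) \<bullet> w = 0}"
    using D_idem[OF y] D_orthogonal[OF y, of v] by (metis (mono_tags, lifting) mem_Collect_eq subsetI)
  fix t assume t: "D y t = t \<and> {w. D y w = w} \<subseteq> {w. (v - t) \<bullet> w = 0}"
  let ?d = "D y v - t"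
  have "D y ?d = ?d" using t by (simp add: linear_diff[OF linear_D[OF N_subset_T[OF y]]] D_idem[OF y])
  then have "(v - t) \<bullet> ?d = 0" "(v - D y v) \<bullet> ?d = 0"
    using t D_orthogonal[OF y, of v ?d] by auto
  then have "?d \<bullet> ?d = 0" by (simp add: inner_diff_left)
  then show "t = D y v" by simp
qed

text \<open>The field \<open>z \<mapsto> D z w\<close> is an admissible extension of w, with derivative \<open>Hess \<pi> y v w\<close>, which is normal.
  For an arbitrary extension W, differentiate \<open>W \<bullet> (b - D b) = 0\<close> along a curve in N with velocity v: the
  normal part of the derivative of W is \<open>Hess \<pi> y v w\<close> for each W, so the value is well defined.\<close>

lemma second_fundamental_form_eq:
  assumes y: "y \<in> N" and v: "D y v = v" and w: "D y w = w"
  shows "second_fundamental_form N y v w = - Hess \<pi> y v w"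
  unfolding second_fundamental_form_def normal_part_def tangential_part_eq[OF y]
proof (rule the_equality)
  have "- Hess \<pi> y v w = - (frechet_derivative (\<lambda>z. D z w) (at y) v - D y (frechet_derivative (\<lambda>z. D z w) (at y) v))"
    using Hess_tangent_is_normal[OF y v w] by (simp add: Hess_def)
  then show "\<exists>U W. open U \<and> y \<in> U \<and> Ck_on 1 W U \<and> (\<forall>z\<in>N \<inter> U. W z \<in> tangent_space N z) \<and> W y = w \<and>
       - Hess \<pi> y v w = - (frechet_derivative W (at y) v - D y (frechet_derivative W (at y) v))"
    using open_T N_subset_T[OF y] D_C1 w
    by (intro exI[of _ T] exI[of _ "\<lambda>z. D z w"] conjI) (auto simp: tangent_space_eq D_idem)
  fix a assume "\<exists>U W. open U \<and> y \<in> U \<and> Ck_on 1 W U \<and> (\<forall>z\<in>N \<inter> U. W z \<in> tangent_space N z) \<and> W y = w \<and>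
       a = - (frechet_derivative W (at y) v - D y (frechet_derivative W (at y) v))"
  then obtain U W where UW: "open U" "y \<in> U" "Ck_on 1 W U" "\<And>z. z \<in> N \<Longrightarrow> z \<in> U \<Longrightarrow> D z (W z) = W z" "W y = w"
    and a: "a = - (frechet_derivative W (at y) v - D y (frechet_derivative W (at y) v))"
    by (auto simp: tangent_space_eq)
  let ?d = "frechet_derivative W (at y) v"
  obtain \<gamma> where \<gamma>: "\<gamma> 0 = y" "\<And>t. \<gamma> t \<in> N" "(\<gamma> has_vector_derivative v) (at 0)"
    "\<And>a. ((\<lambda>t. D (\<gamma> t) a) has_vector_derivative Hess \<pi> y v a) (at 0)"
    by (rule tangent_curve[OF y v], rule that)
  have Wd: "(W has_derivative frechet_derivative W (at y)) (at y)"
    using Ck_on_has_derivative[of 0 W U y] UW(2,3) by simp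
  have W\<gamma>: "((\<lambda>t. W (\<gamma> t)) has_vector_derivative ?d) (at 0)"
    using has_derivative_compose[OF \<gamma>(3)[unfolded has_vector_derivative_def], of W "frechet_derivative W (at y)"] Wd \<gamma>(1)
    unfolding has_vector_derivative_def by (simp add: linear_scale[OF has_derivative_linear[OF Wd]])
  have "(?d - D y ?d) \<bullet> b = Hess \<pi> y v w \<bullet> b" for b
  proof -
    have "((\<lambda>t. W (\<gamma> t) \<bullet> (b - D (\<gamma> t) b)) has_vector_derivative W (\<gamma> 0) \<bullet> (0 - Hess \<pi> y v b) + ?d \<bullet> (b - D (\<gamma> 0) b)) (at 0)"
      by (intro bounded_bilinear.has_vector_derivative[OF bounded_bilinear_inner] W\<gamma> has_vector_derivative_diff has_vector_derivative_const \<gamma>(4))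
    moreover have "((\<lambda>t. W (\<gamma> t) \<bullet> (b - D (\<gamma> t) b)) has_vector_derivative 0) (at 0)"
    proof -
      have "((\<lambda>t. \<gamma> t) \<longlongrightarrow> \<gamma> 0) (at 0)"
        using has_vector_derivative_continuous[OF \<gamma>(3)] by (simp add: isCont_def)
      then have "\<forall>\<^sub>F t in at 0. \<gamma> t \<in> U" using topological_tendstoD[OF _ UW(1)] UW(2) \<gamma>(1) by simp
      then have "\<forall>\<^sub>F t in nhds 0. \<gamma> t \<in> U" using UW(2) \<gamma>(1) by (auto simp: eventually_at_filter elim: eventually_mono)
      then obtain S where S: "open S" "0 \<in> S" "\<And>t. t \<in> S \<Longrightarrow> \<gamma> t \<in> U" unfolding eventually_nhds by blast
      show ?thesis
      proof (rule has_vector_derivative_transform_within_open[OF has_vector_derivative_const[of 0] S(1,2)])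
        fix t assume "t \<in> S"
        then have "D (\<gamma> t) (W (\<gamma> t)) = W (\<gamma> t)" using UW(4) \<gamma>(2) S(3) by blast
        then show "0 = W (\<gamma> t) \<bullet> (b - D (\<gamma> t) b)"
          using D_symmetric[OF \<gamma>(2), of t "W (\<gamma> t)" b] by (simp add: inner_diff_right)
      qed
    qed
    ultimately have "W (\<gamma> 0) \<bullet> (0 - Hess \<pi> y v b) + ?d \<bullet> (b - D (\<gamma> 0) b) = 0"
      by (rule vector_derivative_unique_at)
    then have "?d \<bullet> b - ?d \<bullet> D y b = w \<bullet> Hess \<pi> y v b" by (simp add: \<gamma>(1) UW(5) inner_diff_right)
    then show ?thesis
      using D_symmetric[OF y, of ?d b] Hess_tangent_symmetric[OF y v, of w b] by (simp add: inner_diff_left)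
  qed
  then have "?d - D y ?d = Hess \<pi> y v w" by (metis vector_eq_rdot)
  then show "a = - Hess \<pi> y v w" by (simp add: a)
qed

end

section \<open>The weak form of the tangential equation\<close>

text \<open>The function is the pointwise limit of its restrictions to a compact exhaustion.\<close>

lemma locally_integrable_imp_measurable:
  fixes u :: "real^'n \<Rightarrow> 'b::euclidean_space"
  assumes "open \<Omega>" "u locally_integrable_on \<Omega>"
  shows "u \<in> borel_measurable (lebesgue_on \<Omega>)"
proof -
  obtain C where C: "\<And>n::nat. compact (C n)" "\<And>n. C n \<subseteq> \<Omega>" "\<And>n. C n \<subseteq> interior (C (Suc n))" "(\<Union>n. C n) = \<Omega>"
    using open_Union_compact_subsets[OF assms(1)] by (metis (no_types))
  have mono: "C m \<subseteq> C n" if "m \<le> n" for m n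
    using C(3) interior_subset by (intro lift_Suc_mono_le[OF _ that]) blast
  have "(\<lambda>x. indicator \<Omega> x *\<^sub>R u x) \<in> borel_measurable lebesgue"
  proof (rule borel_measurable_LIMSEQ_metric)
    show "(\<lambda>x. indicator (C n) x *\<^sub>R u x) \<in> borel_measurable lebesgue" for n
      using assms(2) C(1,2) by (auto simp: locally_integrable_on_indicator dest: borel_measurable_integrable)
    show "(\<lambda>n. indicator (C n) x *\<^sub>R u x) \<longlonglongrightarrow> indicator \<Omega> x *\<^sub>R u x" for x
    proof (cases "x \<in> \<Omega>")
      case True
      then obtain m where "x \<in> C m" using C(4) by blast
      then have "indicator (C n) x *\<^sub>R u x = indicator \<Omega> x *\<^sub>R u x" if "m \<le> n" for n
        using mono[OF that] True by auto
      then show ?thesis by (intro tendsto_eventually eventually_sequentiallyI)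
    next
      case False
      then have "x \<notin> C n" for n using C(2) by blast
      then show ?thesis using False by simp
    qed
  qed
  then show ?thesis
    using sets_lebesgue_open[OF assms(1)] by (simp add: borel_measurable_restrict_space_iff)
qed

lemma has_weak_partial_measurable:
  assumes "open \<Omega>" "has_weak_partial \<Omega> i u g"
  shows "u \<in> borel_measurable (lebesgue_on \<Omega>)" "g \<in> borel_measurable (lebesgue_on \<Omega>)"
  using assms by (auto simp: has_weak_partial_def intro: locally_integrable_imp_measurable)

lemma has_weak_partial_zero: "open \<Omega> \<Longrightarrow> has_weak_partial \<Omega> i (\<lambda>x. 0) (\<lambda>x. 0)"
  by (simp add: has_weak_partial_def locally_integrable_on_def)

lemma has_weak_partial_sum:
  assumes "open \<Omega>" "finite I" "\<And>b. b \<in> I \<Longrightarrow> has_weak_partial \<Omega> i (u b) (g b)"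
  shows "has_weak_partial \<Omega> i (\<lambda>x. \<Sum>b\<in>I. u b x) (\<lambda>x. \<Sum>b\<in>I. g b x)"
  using assms(2,3)
  by (induction rule: finite_induct) (simp_all add: has_weak_partial_zero[OF assms(1)] has_weak_partial_add[OF assms(1)])

lemma AE_lebesgue_on_open:
  "open \<Omega> \<Longrightarrow> (AE x in lebesgue_on \<Omega>. P x) \<longleftrightarrow> (AE x in lebesgue. x \<in> \<Omega> \<longrightarrow> P x)"
  by (simp add: AE_restrict_space_iff sets_lebesgue_open)

lemma partial_deriv_inner:
  assumes "\<zeta> \<in> test_functions \<Omega>" shows "partial_deriv i (\<lambda>x. \<zeta> x \<bullet> b) x = partial_deriv i \<zeta> x \<bullet> b"
  using partial_deriv_eqI[OF has_derivative_inner_left[OF test_functions_has_derivative[OF assms]], of i]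
  by (simp add: partial_deriv_def)

locale sobolev_into_tube = nearest_point_tube N \<delta> for N :: "(real^'p) set" and \<delta> +
  fixes \<Omega> :: "(real^'n) set" and u :: "real^'n \<Rightarrow> real^'p"
  assumes open_\<Omega>: "open \<Omega>" and u_W12: "u \<in> W12_into \<Omega> N"
begin

abbreviation "g i \<equiv> weak_partial \<Omega> i u"

lemma u_weak_partial: "has_weak_partial \<Omega> i u (g i)"
  using u_W12 has_weak_partial_weak_partial unfolding W12_into_def W12_def by blast

lemma u_in_N: "AE x in lebesgue. x \<in> \<Omega> \<longrightarrow> u x \<in> N"
  using u_W12 unfolding W12_into_def by (simp add: AE_lebesgue_on_open[OF open_\<Omega>])

lemma g_measurable: "g i \<in> borel_measurable (lebesgue_on \<Omega>)"
  using has_weak_partial_measurable[OF open_\<Omega> u_weak_partial] by blast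

lemma g_square_integrable: "integrable (lebesgue_on \<Omega>) (\<lambda>x. (norm (g i x))\<^sup>2)"
proof -
  obtain h where h: "has_weak_partial \<Omega> i u h" "h square_integrable_on \<Omega>"
    using u_W12 unfolding W12_into_def W12_def by blast
  have ae: "AE x in lebesgue_on \<Omega>. (norm (h x))\<^sup>2 = (norm (g i x))\<^sup>2"
    using weak_partial_AE_eq[OF open_\<Omega> h(1)] unfolding AE_lebesgue_on_open[OF open_\<Omega>] by eventually_elim auto
  have m: "(\<lambda>x. (norm (f x))\<^sup>2) \<in> borel_measurable (lebesgue_on \<Omega>)" if "f \<in> borel_measurable (lebesgue_on \<Omega>)" for f :: "real^'n \<Rightarrow> real^'p"
    using that by measurable
  show ?thesis
    using h(2) integrable_cong_AE[OF m m[OF g_measurable] ae] unfolding square_integrable_on_def by blast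
qed

text \<open>Chain rule for \<open>\<pi> u = u\<close>. On N the projection is the identity, so it is Lipschitz there with
  constant 1, and uniqueness of weak derivatives applies.\<close>

lemma g_tangent: "AE x in lebesgue. x \<in> \<Omega> \<longrightarrow> D (u x) (g i x) = g i x"
proof -
  have "has_weak_partial \<Omega> i (\<lambda>x. \<pi> (u x)) (\<lambda>x. D (u x) (g i x))"
    by (rule has_weak_partial_chain[OF open_\<Omega> u_weak_partial closed_N u_in_N, where L=1])
      (use projection_derivative[OF N_subset_T] in \<open>auto simp: projection_id differentiable_def\<close>)
  then have "has_weak_partial \<Omega> i u (\<lambda>x. D (u x) (g i x))"
  proof (rule has_weak_partial_AE_cong[OF open_\<Omega>])
    show "AE x in lebesgue. x \<in> \<Omega> \<longrightarrow> \<pi> (u x) = u x"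
      using u_in_N by eventually_elim (simp add: projection_id)
  qed simp
  from has_weak_partial_unique[OF open_\<Omega> this u_weak_partial] show ?thesis .
qed

definition test_partial :: "(real^'n \<Rightarrow> real^'p) \<Rightarrow> 'n \<Rightarrow> real^'n \<Rightarrow> real^'p" where
  "test_partial \<zeta> i x = Hess \<pi> (u x) (g i x) (\<zeta> x) + D (u x) (partial_deriv i \<zeta> x)"

text \<open>Expand \<open>\<zeta>\<close> in the standard basis: the coefficients are smooth and \<open>D u b\<close> is covered by the chain rule,
  because D is Lipschitz on N.\<close>

lemma tangential_test_weak_partial:
  assumes \<zeta>: "\<zeta> \<in> test_functions \<Omega>'"
  shows "has_weak_partial \<Omega> i (\<lambda>x. D (u x) (\<zeta> x)) (test_partial \<zeta> i)"
proof -
  have Db: "has_weak_partial \<Omega> i (\<lambda>x. D (u x) b) (\<lambda>x. Hess \<pi> (u x) (g i x) b)" for b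
    unfolding Hess_def
    by (rule has_weak_partial_chain[OF open_\<Omega> u_weak_partial closed_N u_in_N, where F="\<lambda>y. D y b", OF D_lipschitz_on_N])
      (use D_derivative[OF N_subset_T] in \<open>auto simp: differentiable_def\<close>)
  have sm: "Ck_on k (\<lambda>x. \<zeta> x \<bullet> b) UNIV" for k b
    by (rule test_functions_smooth[OF test_functions_linear[OF bounded_linear_inner_left \<zeta>]])
  have "has_weak_partial \<Omega> i (\<lambda>x. \<Sum>b\<in>Basis. (\<zeta> x \<bullet> b) *\<^sub>R D (u x) b)
     (\<lambda>x. \<Sum>b\<in>Basis. (\<zeta> x \<bullet> b) *\<^sub>R Hess \<pi> (u x) (g i x) b + partial_deriv i (\<lambda>x. \<zeta> x \<bullet> b) x *\<^sub>R D (u x) b)"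
    by (intro has_weak_partial_sum[OF open_\<Omega>] has_weak_partial_smooth_scaleR[OF open_\<Omega> Db sm]) auto
  then show ?thesis
  proof (rule has_weak_partial_AE_cong[OF open_\<Omega>])
    show "AE x in lebesgue. x \<in> \<Omega> \<longrightarrow> (\<Sum>b\<in>Basis. (\<zeta> x \<bullet> b) *\<^sub>R D (u x) b) = D (u x) (\<zeta> x)"
      using u_in_N by eventually_elim (simp add: D_expand N_subset_T)
    show "AE x in lebesgue. x \<in> \<Omega> \<longrightarrow> (\<Sum>b\<in>Basis. (\<zeta> x \<bullet> b) *\<^sub>R Hess \<pi> (u x) (g i x) b + partial_deriv i (\<lambda>x. \<zeta> x \<bullet> b) x *\<^sub>R D (u x) b) = test_partial \<zeta> i x"
      using u_in_N by eventually_elim (simp add: partial_deriv_inner[OF \<zeta>] sum.distrib D_expand N_subset_T Hess_expand test_partial_def)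
  qed
qed

definition Hess_term :: "real^'n \<Rightarrow> real^'p" where
  "Hess_term x = (\<Sum>i\<in>UNIV. Hess \<pi> (u x) (g i x) (g i x))"

definition first_variation :: "(real^'n \<Rightarrow> real^'p) \<Rightarrow> real^'n \<Rightarrow> real" where
  "first_variation \<zeta> x = (\<Sum>i\<in>UNIV. g i x \<bullet> partial_deriv i \<zeta> x) + Hess_term x \<bullet> \<zeta> x"

text \<open>The algebraic core of both equivalences: symmetry of \<open>D u\<close> and of \<open>Hess \<pi> u (\<partial>\<^sub>i u)\<close>, applied to the
  tangent vector \<open>\<partial>\<^sub>i u\<close>. Tangency is repeated in the conclusion since it holds off the same null set.\<close>

lemma inner_test_partial:
  "AE x in lebesgue. x \<in> \<Omega> \<longrightarrow> (\<forall>i. D (u x) (g i x) = g i x) \<and> (\<Sum>i\<in>UNIV. g i x \<bullet> test_partial \<zeta> i x) = first_variation \<zeta> x"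
proof -
  have "AE x in lebesgue. \<forall>i. x \<in> \<Omega> \<longrightarrow> D (u x) (g i x) = g i x"
    unfolding AE_all_countable using g_tangent by blast
  with u_in_N show ?thesis
  proof eventually_elim
    case (elim x)
    show ?case
    proof
      assume x: "x \<in> \<Omega>"
      then have y: "u x \<in> N" and t: "\<And>i. D (u x) (g i x) = g i x" using elim by auto
      have "g i x \<bullet> test_partial \<zeta> i x = g i x \<bullet> partial_deriv i \<zeta> x + Hess \<pi> (u x) (g i x) (g i x) \<bullet> \<zeta> x" for i
        using Hess_tangent_symmetric[OF y t, of i "\<zeta> x" "g i x"] D_symmetric[OF y, of "g i x" "partial_deriv i \<zeta> x"] t[of i]
        by (simp add: test_partial_def inner_add_right inner_commute)
      then show "(\<forall>i. D (u x) (g i x) = g i x) \<and> (\<Sum>i\<in>UNIV. g i x \<bullet> test_partial \<zeta> i x) = first_variation \<zeta> x"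
        using t by (simp add: first_variation_def Hess_term_def sum.distrib inner_sum_left)
    qed
  qed
qed

lemma gradient_term_integrable:
  assumes \<zeta>: "\<zeta> \<in> test_functions \<Omega>"
  shows "integrable lebesgue (\<lambda>x. \<Sum>i\<in>UNIV. g i x \<bullet> partial_deriv i \<zeta> x)"
proof (rule Bochner_Integration.integrable_sum)
  fix i
  have "(g i) locally_integrable_on \<Omega>" using u_weak_partial[of i] by (simp add: has_weak_partial_def)
  from integrable_bilinear_test[OF bounded_bilinear_inner test_functions_partial_deriv[OF \<zeta>] this]
  show "integrable lebesgue (\<lambda>x. g i x \<bullet> partial_deriv i \<zeta> x)" by (simp add: inner_commute)
qed

lemma outside_support:
  assumes \<zeta>: "\<zeta> \<in> test_functions \<Omega>'" and x: "x \<notin> \<Omega>'"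
  shows "\<zeta> x = 0" "partial_deriv i \<zeta> x = 0"
  using \<zeta> test_functions_partial_deriv[OF \<zeta>, of i] x unfolding test_functions_def by blast+

lemma gradient_term_integral:
  assumes \<zeta>: "\<zeta> \<in> test_functions \<Omega>"
  shows "integrable (lebesgue_on \<Omega>) (\<lambda>x. \<Sum>i\<in>UNIV. g i x \<bullet> partial_deriv i \<zeta> x)"
    "(LINT x|lebesgue_on \<Omega>. (\<Sum>i\<in>UNIV. g i x \<bullet> partial_deriv i \<zeta> x)) = (LINT x|lebesgue. (\<Sum>i\<in>UNIV. g i x \<bullet> partial_deriv i \<zeta> x))"
proof -
  have "(\<Sum>i\<in>UNIV. g i x \<bullet> partial_deriv i \<zeta> x) = 0" if "x \<notin> \<Omega>" for x
    using outside_support(2)[OF \<zeta> that] by simp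
  note eq = integral_lebesgue_on_eq[OF sets_lebesgue_open[OF open_\<Omega>] this]
  show "integrable (lebesgue_on \<Omega>) (\<lambda>x. \<Sum>i\<in>UNIV. g i x \<bullet> partial_deriv i \<zeta> x)"
    "(LINT x|lebesgue_on \<Omega>. (\<Sum>i\<in>UNIV. g i x \<bullet> partial_deriv i \<zeta> x)) = (LINT x|lebesgue. (\<Sum>i\<in>UNIV. g i x \<bullet> partial_deriv i \<zeta> x))"
    using eq gradient_term_integrable[OF \<zeta>] by simp_all
qed

lemma tangential_integrand_AE:
  assumes \<zeta>: "\<zeta> \<in> test_functions \<Omega>"
  shows "AE x in lebesgue_on \<Omega>. (\<Sum>i\<in>UNIV. g i x \<bullet> weak_partial \<Omega> i (\<lambda>x. D (u x) (\<zeta> x)) x) = first_variation \<zeta> x"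
proof -
  have "AE x in lebesgue. \<forall>i. x \<in> \<Omega> \<longrightarrow> weak_partial \<Omega> i (\<lambda>x. D (u x) (\<zeta> x)) x = test_partial \<zeta> i x"
    unfolding AE_all_countable using weak_partial_AE_eq[OF open_\<Omega> tangential_test_weak_partial[OF \<zeta>]] by blast
  with inner_test_partial[of \<zeta>] show ?thesis
    unfolding AE_lebesgue_on_open[OF open_\<Omega>] by eventually_elim auto
qed

text \<open>The bound on \<open>Hess \<pi>\<close> makes the quadratic expression in \<open>\<partial>\<^sub>i u\<close> integrable. Its measurability is read off
  the preceding identity, where all other terms are built from weak derivatives and test functions.\<close>

lemma Hess_term_integrable:
  assumes \<zeta>: "\<zeta> \<in> test_functions \<Omega>"
  shows "integrable (lebesgue_on \<Omega>) (\<lambda>x. Hess_term x \<bullet> \<zeta> x)"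
proof -
  obtain B where B: "B > 0" "\<And>x. norm (\<zeta> x) \<le> B" using test_functions_bounded[OF \<zeta>] by metis
  show ?thesis
  proof (rule Bochner_Integration.integrable_bound)
    show "integrable (lebesgue_on \<Omega>) (\<lambda>x. (2 / \<delta> * B) * (\<Sum>i\<in>UNIV. (norm (g i x))\<^sup>2))"
      by (intro integrable_mult_right Bochner_Integration.integrable_sum g_square_integrable)
    have tm: "test_partial \<zeta> i \<in> borel_measurable (lebesgue_on \<Omega>)" for i
      using has_weak_partial_measurable[OF open_\<Omega> tangential_test_weak_partial[OF \<zeta>]] by blast
    have m: "(\<lambda>x. (\<Sum>i\<in>UNIV. g i x \<bullet> test_partial \<zeta> i x) - (\<Sum>i\<in>UNIV. g i x \<bullet> partial_deriv i \<zeta> x)) \<in> borel_measurable (lebesgue_on \<Omega>)"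
      by (intro borel_measurable_diff borel_measurable_sum borel_measurable_inner g_measurable tm
          borel_measurable_integrable[OF gradient_term_integral(1)[OF \<zeta>]])
    have "AE x in lebesgue. indicator \<Omega> x *\<^sub>R ((\<Sum>i\<in>UNIV. g i x \<bullet> test_partial \<zeta> i x) - (\<Sum>i\<in>UNIV. g i x \<bullet> partial_deriv i \<zeta> x))
       = indicator \<Omega> x *\<^sub>R (Hess_term x \<bullet> \<zeta> x)"
      using inner_test_partial[of \<zeta>] by eventually_elim (auto simp: first_variation_def indicator_def)
    from borel_measurable_AE[OF _ this] m
    show "(\<lambda>x. Hess_term x \<bullet> \<zeta> x) \<in> borel_measurable (lebesgue_on \<Omega>)"
      by (simp add: borel_measurable_restrict_space_iff sets_lebesgue_open open_\<Omega>)
    show "AE x in lebesgue_on \<Omega>. norm (Hess_term x \<bullet> \<zeta> x) \<le> norm ((2 / \<delta> * B) * (\<Sum>i\<in>UNIV. (norm (g i x))\<^sup>2))"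
      unfolding AE_lebesgue_on_open[OF open_\<Omega>] using u_in_N inner_test_partial[of \<zeta>]
    proof eventually_elim
      case (elim x)
      show ?case
      proof
        assume x: "x \<in> \<Omega>"
        have H: "norm (Hess \<pi> (u x) (g i x) (g i x)) \<le> (2 / \<delta>) * (norm (g i x))\<^sup>2" for i
          using norm_Hess_tangent_le[of "u x" "g i x" "g i x"] elim x by (simp add: power2_eq_square mult.assoc)
        have "norm (Hess_term x \<bullet> \<zeta> x) \<le> norm (Hess_term x) * norm (\<zeta> x)" by (simp add: Cauchy_Schwarz_ineq2)
        also have "\<dots> \<le> (\<Sum>i\<in>UNIV. (2 / \<delta>) * (norm (g i x))\<^sup>2) * B"
          unfolding Hess_term_def by (intro mult_mono sum_norm_le H B(2) sum_nonneg) (use \<delta> in auto)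
        also have "\<dots> = (2 / \<delta> * B) * (\<Sum>i\<in>UNIV. (norm (g i x))\<^sup>2)" by (simp add: sum_distrib_left mult_ac)
        finally show "norm (Hess_term x \<bullet> \<zeta> x) \<le> norm ((2 / \<delta> * B) * (\<Sum>i\<in>UNIV. (norm (g i x))\<^sup>2))"
          using abs_ge_self order_trans unfolding real_norm_def by blast
      qed
    qed
  qed
qed

lemma first_variation_integral:
  assumes \<zeta>: "\<zeta> \<in> test_functions \<Omega>"
  shows "integrable (lebesgue_on \<Omega>) (first_variation \<zeta>)"
    and "(LINT x|lebesgue_on \<Omega>. first_variation \<zeta> x) = 
      (LINT x|lebesgue_on \<Omega>. (\<Sum>i\<in>UNIV. g i x \<bullet> partial_deriv i \<zeta> x)) + (LINT x|lebesgue_on \<Omega>. Hess_term x \<bullet> \<zeta> x)"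
  unfolding first_variation_def[abs_def] using gradient_term_integral(1)[OF \<zeta>] Hess_term_integrable[OF \<zeta>] by auto

lemma tangential_laplacian_zero_iff:
  "weak_tangential_laplacian_zero \<Omega> N u \<longleftrightarrow> (\<forall>\<zeta>\<in>test_functions \<Omega>. (LINT x|lebesgue_on \<Omega>. first_variation \<zeta> x) = 0)"
proof -
  have "((\<forall>i. \<exists>h. has_weak_partial \<Omega> i (\<lambda>x. D (u x) (\<zeta> x)) h) \<and>
       integrable (lebesgue_on \<Omega>) (\<lambda>x. \<Sum>i\<in>UNIV. g i x \<bullet> weak_partial \<Omega> i (\<lambda>x. D (u x) (\<zeta> x)) x) \<and>
       (LINT x|lebesgue_on \<Omega>. (\<Sum>i\<in>UNIV. g i x \<bullet> weak_partial \<Omega> i (\<lambda>x. D (u x) (\<zeta> x)) x)) = 0) \<longleftrightarrow>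
      (LINT x|lebesgue_on \<Omega>. first_variation \<zeta> x) = 0" if \<zeta>: "\<zeta> \<in> test_functions \<Omega>" for \<zeta>
  proof -
    note t = tangential_test_weak_partial[OF \<zeta>]
    have m: "(\<lambda>x. \<Sum>i\<in>UNIV. g i x \<bullet> weak_partial \<Omega> i (\<lambda>x. D (u x) (\<zeta> x)) x) \<in> borel_measurable (lebesgue_on \<Omega>)"
      using has_weak_partial_measurable(2)[OF open_\<Omega> has_weak_partial_weak_partial[OF t]]
      by (intro borel_measurable_sum borel_measurable_inner g_measurable) auto
    note mf = borel_measurable_integrable[OF first_variation_integral(1)[OF \<zeta>]]
    show ?thesis
      using t integrable_cong_AE[OF m mf tangential_integrand_AE[OF \<zeta>]] integral_cong_AE[OF m mf tangential_integrand_AE[OF \<zeta>]]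
        first_variation_integral(1)[OF \<zeta>] by auto
  qed
  then show ?thesis unfolding weak_tangential_laplacian_zero_def Let_def by (intro ball_cong) auto
qed

lemma tangential_iff_Hess:
  "weak_tangential_laplacian_zero \<Omega> N u \<longleftrightarrow> weak_laplacian_eq \<Omega> u Hess_term"
proof -
  have "(LINT x|lebesgue_on \<Omega>. first_variation \<zeta> x) = 0 \<longleftrightarrow>
     integrable (lebesgue_on \<Omega>) (\<lambda>x. \<Sum>i\<in>UNIV. g i x \<bullet> partial_deriv i \<zeta> x) \<and>
     integrable (lebesgue_on \<Omega>) (\<lambda>x. Hess_term x \<bullet> \<zeta> x) \<and>
     - (LINT x|lebesgue_on \<Omega>. (\<Sum>i\<in>UNIV. g i x \<bullet> partial_deriv i \<zeta> x)) = (LINT x|lebesgue_on \<Omega>. Hess_term x \<bullet> \<zeta> x)"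
    if "\<zeta> \<in> test_functions \<Omega>" for \<zeta>
    using gradient_term_integral(1)[OF that] Hess_term_integrable[OF that] first_variation_integral(2)[OF that] by auto
  then show ?thesis unfolding tangential_laplacian_zero_iff weak_laplacian_eq_def by (intro ball_cong) auto
qed

lemma sff_term_AE:
  "AE x in lebesgue_on \<Omega>. - (\<Sum>i\<in>UNIV. second_fundamental_form N (u x) (g i x) (g i x)) = Hess_term x"
  unfolding AE_lebesgue_on_open[OF open_\<Omega>] using u_in_N inner_test_partial[of "\<lambda>_. 0"]
proof eventually_elim
  case (elim x)
  then show ?case by (auto simp: second_fundamental_form_eq Hess_term_def sum_negf)
qed

end

lemma weak_laplacian_eq_AE_cong:
  assumes \<Omega>: "open \<Omega>" and FG: "AE x in lebesgue_on \<Omega>. F x = G x" and F: "weak_laplacian_eq \<Omega> u F"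
  shows "weak_laplacian_eq \<Omega> u G"
  unfolding weak_laplacian_eq_def
proof (intro ballI)
  fix \<zeta> :: "real^'a \<Rightarrow> real^'b" assume "\<zeta> \<in> test_functions \<Omega>"
  note L = F[unfolded weak_laplacian_eq_def, rule_format, OF this]
  have S: "\<Omega> \<inter> space lebesgue \<in> sets lebesgue" using sets_lebesgue_open[OF \<Omega>] by simp
  have "integrable lebesgue (\<lambda>x. indicator \<Omega> x *\<^sub>R (F x \<bullet> \<zeta> x))"
    using L by (simp add: integrable_restrict_space[OF S])
  moreover have "AE x in lebesgue. indicator \<Omega> x *\<^sub>R (F x \<bullet> \<zeta> x) = indicator \<Omega> x *\<^sub>R (G x \<bullet> \<zeta> x)"
    using FG unfolding AE_lebesgue_on_open[OF \<Omega>] by eventually_elim (auto simp: indicator_def)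
  ultimately have "integrable lebesgue (\<lambda>x. indicator \<Omega> x *\<^sub>R (G x \<bullet> \<zeta> x))"
    "(LINT x|lebesgue. indicator \<Omega> x *\<^sub>R (G x \<bullet> \<zeta> x)) = (LINT x|lebesgue. indicator \<Omega> x *\<^sub>R (F x \<bullet> \<zeta> x))"
    by (rule integrable_lebesgue_AE_cong)+
  then show "integrable (lebesgue_on \<Omega>) (\<lambda>x. \<Sum>i\<in>UNIV. weak_partial \<Omega> i u x \<bullet> partial_deriv i \<zeta> x) \<and>
        integrable (lebesgue_on \<Omega>) (\<lambda>x. G x \<bullet> \<zeta> x) \<and>
        - (LINT x|lebesgue_on \<Omega>. (\<Sum>i\<in>UNIV. weak_partial \<Omega> i u x \<bullet> partial_deriv i \<zeta> x)) =
          (LINT x|lebesgue_on \<Omega>. G x \<bullet> \<zeta> x)"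
    using L by (simp add: integrable_restrict_space[OF S] integral_restrict_space[OF S])
qed

section \<open>Outer variations\<close>

lemma inverse_square_le:
  fixes t :: real
  assumes "0 \<le> t" "t \<le> 1/2" shows "1 / (1 - t)\<^sup>2 \<le> 1 + 6 * t"
proof -
  have "(1 + 6 * t) * (1 - t)\<^sup>2 - 1 = t * ((1/2 - t) * (8 - 6 * t))"
    by (simp add: power2_eq_square algebra_simps)
  also have "\<dots> \<ge> 0" using assms by (intro mult_nonneg_nonneg) auto
  finally show ?thesis using assms by (simp add: field_simps)
qed

text \<open>A majorant, independent of s, for difference quotients of squares. Here g and m stand for the norms
  of the gradients of u and \<open>\<zeta>\<close>, and \<open>1 / (1 - s c)\<close> for the Lipschitz constant of the projection at distance
  proportional to s from the set.\<close>

lemma energy_density_quotient_bound: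
  fixes a g m c s :: real
  assumes s: "0 < s" "s \<le> 1" "s * c \<le> 1/2" and c: "0 \<le> c" and a: "0 \<le> a" "a \<le> (g + s * m) / (1 - s * c)" and g: "0 \<le> g" "0 \<le> m"
  shows "(a\<^sup>2 - g\<^sup>2) / s \<le> (1 + 12 * c) * (g\<^sup>2 + 2 * m\<^sup>2)"
proof -
  have sc: "0 \<le> s * c" using s c by simp
  have "a\<^sup>2 \<le> ((g + s * m) / (1 - s * c))\<^sup>2" using a by (intro power_mono)
  also have "\<dots> = (g + s * m)\<^sup>2 * (1 / (1 - s * c)\<^sup>2)" by (simp add: power_divide)
  also have "\<dots> \<le> (g + s * m)\<^sup>2 * (1 + 6 * (s * c))"
    by (intro mult_left_mono inverse_square_le) (use s sc in auto)
  finally have 1: "a\<^sup>2 \<le> (g + s * m)\<^sup>2 * (1 + 6 * (s * c))" .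
  have 2: "(g + s * m)\<^sup>2 \<le> g\<^sup>2 + s * (g\<^sup>2 + 2 * m\<^sup>2)"
  proof -
    have "2 * (g * m) \<le> g\<^sup>2 + m\<^sup>2" using sum_squares_bound[of g m] by simp
    then have "s * (2 * (g * m)) \<le> s * (g\<^sup>2 + m\<^sup>2)" using s by (intro mult_left_mono) auto
    moreover have "s * (s * m\<^sup>2) \<le> s * (1 * m\<^sup>2)" using s by (intro mult_left_mono mult_right_mono) auto
    ultimately show ?thesis by (simp add: power2_eq_square algebra_simps)
  qed
  note 1
  also have "(g + s * m)\<^sup>2 * (1 + 6 * (s * c)) \<le> (g\<^sup>2 + s * (g\<^sup>2 + 2 * m\<^sup>2)) * (1 + 6 * (s * c))"
    using 2 sc by (intro mult_right_mono) auto
  also have "(g\<^sup>2 + s * (g\<^sup>2 + 2 * m\<^sup>2)) * (1 + 6 * (s * c)) =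
     g\<^sup>2 + s * (g\<^sup>2 + 2 * m\<^sup>2) + 6 * (s * c) * (g\<^sup>2 + s * (g\<^sup>2 + 2 * m\<^sup>2))" by (simp add: algebra_simps)
  also have "\<dots> \<le> g\<^sup>2 + s * (g\<^sup>2 + 2 * m\<^sup>2) + 6 * (s * c) * ((g\<^sup>2 + 2 * m\<^sup>2) + 1 * (g\<^sup>2 + 2 * m\<^sup>2))"
    using s sc by (intro add_left_mono mult_left_mono add_mono mult_right_mono) auto
  finally have "a\<^sup>2 - g\<^sup>2 \<le> s * ((1 + 12 * c) * (g\<^sup>2 + 2 * m\<^sup>2))"
    using sc by (simp add: algebra_simps)
  then show ?thesis using s by (simp add: field_simps)
qed

context sobolev_into_tube
begin

lemma first_variation_add:
  assumes "\<zeta> \<in> test_functions \<Omega>'" "\<eta> \<in> test_functions \<Omega>'"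
  shows "first_variation (\<lambda>x. \<zeta> x + \<eta> x) x = first_variation \<zeta> x + first_variation \<eta> x"
proof -
  have "partial_deriv i (\<lambda>x. \<zeta> x + \<eta> x) x = partial_deriv i \<zeta> x + partial_deriv i \<eta> x" for i
    using partial_deriv_eqI[OF has_derivative_add[OF assms[THEN test_functions_has_derivative]], of i]
    by (simp add: partial_deriv_def)
  then show ?thesis by (simp add: first_variation_def inner_add_right sum.distrib)
qed

lemma first_variation_minus:
  assumes "\<zeta> \<in> test_functions \<Omega>'"
  shows "first_variation (\<lambda>x. - \<zeta> x) x = - first_variation \<zeta> x"
proof -
  have "partial_deriv i (\<lambda>x. - \<zeta> x) x = - partial_deriv i \<zeta> x" for i
    using partial_deriv_eqI[OF has_derivative_minus[OF test_functions_has_derivative[OF assms]], of i]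
    by (simp add: partial_deriv_def)
  then show ?thesis by (simp add: first_variation_def sum_negf)
qed

lemma outer_variation_weak_partial:
  assumes B: "open B" "B \<subseteq> \<Omega>" and \<zeta>: "\<zeta> \<in> test_functions B" and M: "\<And>x. norm (\<zeta> x) \<le> M" and s: "\<bar>s\<bar> * M \<le> \<delta> / 2"
  shows "has_weak_partial B i (\<lambda>x. \<pi> (u x + s *\<^sub>R \<zeta> x)) (\<lambda>x. D (u x + s *\<^sub>R \<zeta> x) (g i x + s *\<^sub>R partial_deriv i \<zeta> x))"
proof -
  have s\<zeta>: "(\<lambda>x. s *\<^sub>R \<zeta> x) \<in> test_functions B" by (rule test_functions_linear[OF bounded_linear_scaleR_right \<zeta>])
  have ps: "partial_deriv i (\<lambda>x. s *\<^sub>R \<zeta> x) x = s *\<^sub>R partial_deriv i \<zeta> x" for x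
    using partial_deriv_eqI[OF has_derivative_scaleR_right[OF test_functions_has_derivative[OF \<zeta>]], of i]
    by (simp add: partial_deriv_def)
  have w: "has_weak_partial B i (\<lambda>x. u x + s *\<^sub>R \<zeta> x) (\<lambda>x. g i x + partial_deriv i (\<lambda>x. s *\<^sub>R \<zeta> x) x)"
    by (rule has_weak_partial_add[OF B(1) has_weak_partial_subset[OF u_weak_partial open_\<Omega> B] 
        has_weak_partial_smooth[OF B(1) test_functions_smooth[OF s\<zeta>]]])
  show ?thesis
  proof (rule has_weak_partial_chain[OF B(1) w[unfolded ps], where C="{y. infdist y N \<le> \<delta> / 2}" and L=2])
    show "closed {y. infdist y N \<le> \<delta> / 2}" by (intro closed_Collect_le continuous_intros)
    show "AE x in lebesgue. x \<in> B \<longrightarrow> u x + s *\<^sub>R \<zeta> x \<in> {y. infdist y N \<le> \<delta> / 2}"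
      using u_in_N
    proof eventually_elim
      case (elim x)
      show ?case
      proof
        assume "x \<in> B"
        then have "u x \<in> N" using elim B(2) by blast
        then have "infdist (u x + s *\<^sub>R \<zeta> x) N \<le> \<bar>s\<bar> * norm (\<zeta> x)"
          using infdist_le[of "u x" N "u x + s *\<^sub>R \<zeta> x"] by (simp add: dist_norm)
        also have "\<dots> \<le> \<bar>s\<bar> * M" using M by (intro mult_left_mono) auto
        finally show "u x + s *\<^sub>R \<zeta> x \<in> {y. infdist y N \<le> \<delta> / 2}" using s by simp
      qed
    qed
    show "norm (\<pi> y - \<pi> z) \<le> 2 * norm (y - z)" if "y \<in> {y. infdist y N \<le> \<delta> / 2}" "z \<in> {y. infdist y N \<le> \<delta> / 2}" for y z
      using projection_lipschitz[of y "\<delta> / 2" z] that \<delta> by simp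
    show "\<pi> differentiable (at y)" if "y \<in> {y. infdist y N \<le> \<delta> / 2}" for y
      using projection_derivative[of y] that \<delta> by (auto simp: tubular_nbhd_def differentiable_def)
  qed
qed

text \<open>The derivative of \<open>s \<mapsto> D (y + s z) (v + s w)\<close> at 0 is \<open>Hess \<pi> y z v + D y w\<close>. Its inner product with
  the tangent vector v simplifies by the symmetries on N.\<close>

lemma outer_density_limit:
  assumes y: "y \<in> N" and v: "D y v = v" and s: "s \<longlonglongrightarrow> 0" "\<And>k. s k \<noteq> 0"
  shows "(\<lambda>k. ((norm (D (y + s k *\<^sub>R z) (v + s k *\<^sub>R w)))\<^sup>2 - (norm v)\<^sup>2) / (2 * s k)) \<longlonglongrightarrow> v \<bullet> w + Hess \<pi> y v v \<bullet> z"
proof -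
  have yT: "y \<in> T" by (rule N_subset_T[OF y])
  note l = line_derivative[of y z 0 UNIV]
  have f1: "((\<lambda>t. \<Sum>b\<in>Basis. ((v + t *\<^sub>R w) \<bullet> b) *\<^sub>R D (y + t *\<^sub>R z) b) has_vector_derivative
     (\<Sum>b\<in>Basis. ((v + 0 *\<^sub>R w) \<bullet> b) *\<^sub>R Hess \<pi> y z b + (w \<bullet> b) *\<^sub>R D (y + 0 *\<^sub>R z) b)) (at 0)"
  proof (intro has_vector_derivative_sum bounded_bilinear.has_vector_derivative[OF bounded_bilinear_scaleR])
    show "((\<lambda>t. (v + t *\<^sub>R w) \<bullet> b) has_vector_derivative w \<bullet> b) (at 0)" for b
      by (rule bounded_linear.has_vector_derivative[OF bounded_linear_inner_left line_derivative])
    show "((\<lambda>t. D (y + t *\<^sub>R z) b) has_vector_derivative Hess \<pi> y z b) (at 0)" for b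
      using projection_along_curve(2)[OF l, of b] yT by simp
  qed
  define f where "f t = (\<Sum>b\<in>Basis. ((v + t *\<^sub>R w) \<bullet> b) *\<^sub>R D (y + t *\<^sub>R z) b)" for t
  define d where "d = Hess \<pi> y z v + D y w"
  have f': "(f has_vector_derivative d) (at 0)"
    using f1 by (simp add: f_def[abs_def] d_def sum.distrib Hess_expand[OF y] D_expand[OF yT])
  have f0: "f 0 = v" using D_expand[OF yT] v by (simp add: f_def)
  have "((\<lambda>t. f t \<bullet> f t) has_vector_derivative f 0 \<bullet> d + d \<bullet> f 0) (at 0)"
    by (rule bounded_bilinear.has_vector_derivative[OF bounded_bilinear_inner f' f'])
  from difference_quotient_at_0[OF this]
  have "((\<lambda>t. (f t \<bullet> f t - v \<bullet> v) /\<^sub>R t) \<longlongrightarrow> 2 * (v \<bullet> d)) (at 0)" by (simp add: f0 inner_commute)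
  note f2 = this
  have fs: "filterlim s (at 0) sequentially" using s by (intro filterlim_atI) auto
  have "(\<lambda>k. (f (s k) \<bullet> f (s k) - v \<bullet> v) /\<^sub>R s k) \<longlonglongrightarrow> 2 * (v \<bullet> d)" by (rule filterlim_compose[OF f2 fs])
  then have "(\<lambda>k. ((f (s k) \<bullet> f (s k) - v \<bullet> v) /\<^sub>R s k) / 2) \<longlonglongrightarrow> 2 * (v \<bullet> d) / 2" by (intro tendsto_divide tendsto_const) auto
  then have "(\<lambda>k. (f (s k) \<bullet> f (s k) - v \<bullet> v) / (2 * s k)) \<longlonglongrightarrow> v \<bullet> d" by (simp add: field_simps)
  moreover have "\<forall>\<^sub>F k in sequentially. (f (s k) \<bullet> f (s k) - v \<bullet> v) / (2 * s k) = ((norm (D (y + s k *\<^sub>R z) (v + s k *\<^sub>R w)))\<^sup>2 - (norm v)\<^sup>2) / (2 * s k)"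
  proof -
    have "\<forall>\<^sub>F k in sequentially. y + s k *\<^sub>R z \<in> T"
      by (rule eventually_compose_filterlim[OF eventually_line_in_T[OF yT] fs])
    then show ?thesis
      by eventually_elim (simp add: f_def D_expand power2_norm_eq_inner)
  qed
  ultimately have "(\<lambda>k. ((norm (D (y + s k *\<^sub>R z) (v + s k *\<^sub>R w)))\<^sup>2 - (norm v)\<^sup>2) / (2 * s k)) \<longlonglongrightarrow> v \<bullet> d"
    by (rule Lim_transform_eventually)
  moreover have "v \<bullet> d = v \<bullet> w + Hess \<pi> y v v \<bullet> z"
    using Hess_tangent_symmetric[OF y v, of z v] D_symmetric[OF y, of v w] v
    by (simp add: d_def inner_add_right inner_commute Hess_commute[OF y, of z])
  ultimately show ?thesis by simp
qed

text \<open>For positive s the difference quotients q of the energy density converge to the first variation and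
  have the integrable upper bound Q. Their integrals tend to the derivative of the energy, which is
  zero. By the reverse Fatou lemma the integral of the limit is at least zero.\<close>

lemma first_variation_ball_nonneg:
  assumes crit: "outer_critical \<Omega> N u" and B: "0 < \<rho>" "cball c \<rho> \<subseteq> \<Omega>" and \<zeta>: "\<zeta> \<in> test_functions (ball c \<rho>)"
  shows "0 \<le> (LINT x|lebesgue_on \<Omega>. first_variation \<zeta> x)"
proof -
  let ?B = "ball c \<rho>"
  let ?M = "lebesgue_on ?B"
  have oB: "open ?B" and sub: "?B \<subseteq> \<Omega>" using B(2) by auto
  have \<zeta>\<Omega>: "\<zeta> \<in> test_functions \<Omega>" by (rule test_functions_mono[OF \<zeta> sub])
  have Bs: "?B \<inter> space lebesgue \<in> sets lebesgue" using sets_lebesgue_open[OF oB] by simp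
  have \<Omega>s: "\<Omega> \<inter> space lebesgue \<in> sets lebesgue" using sets_lebesgue_open[OF open_\<Omega>] by simp
  define v where "v s x = \<pi> (u x + s *\<^sub>R \<zeta> x)" for s x
  define E where "E s = dirichlet_energy ?B (v s)" for s
  have E': "(E has_real_derivative 0) (at 0)"
    using crit B \<zeta> unfolding outer_critical_def E_def v_def by blast
  obtain b0 where b0: "b0 > 0" "\<And>x. norm (\<zeta> x) \<le> b0" using test_functions_bounded[OF \<zeta>] by metis
  have "\<exists>m. \<forall>x. norm (partial_deriv i \<zeta> x) \<le> m" for i
    using test_functions_bounded[OF test_functions_partial_deriv[OF \<zeta>]] by metis
  then obtain m where m: "\<And>i x. norm (partial_deriv i \<zeta> x) \<le> m i" by metis
  have m0: "0 \<le> m i" for i using norm_ge_zero m order_trans by blast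
  \<comment> \<open>b exceeds the supremum of \<open>\<zeta>\<close> strictly, since the bound on D at a point needs a radius larger than
    the distance of the point from N.\<close>
  define b where "b = b0 + 1"
  define cc where "cc = b / \<delta>"
  have cc: "cc > 0" using b0 \<delta> by (simp add: cc_def b_def)
  \<comment> \<open>The steps keep \<open>u + s \<zeta>\<close> within distance \<open>\<delta> / 2\<close> of N and tend to zero through positive values.\<close>
  define s where "s k = min 1 (1 / (2 * cc)) * inverse (real (Suc k))" for k
  have s: "0 < s k" "s k \<le> 1" "s k * cc \<le> 1/2" for k
  proof -
    have i: "inverse (real (Suc k)) \<le> 1" by (simp add: inverse_le_1_iff)
    have "min 1 (1 / (2 * cc)) > 0" using cc by simp
    then show "0 < s k" by (simp add: s_def)
    have le: "s k \<le> min 1 (1 / (2 * cc))" using mult_left_mono[OF i, of "min 1 (1 / (2 * cc))"] cc by (simp add: s_def)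
    then show "s k \<le> 1" by simp
    have "s k \<le> 1 / (2 * cc)" using le by simp
    then show "s k * cc \<le> 1/2" using cc by (simp add: field_simps)
  qed
  have s0: "s \<longlonglongrightarrow> 0" unfolding s_def by (rule tendsto_mult_right_zero[OF LIMSEQ_inverse_real_of_nat])
  have sb: "s k * b \<le> \<delta> / 2" for k using s(3)[of k] \<delta> by (simp add: cc_def field_simps)
  define a where "a k i x = D (u x + s k *\<^sub>R \<zeta> x) (g i x + s k *\<^sub>R partial_deriv i \<zeta> x)" for k i x
  have wv: "has_weak_partial ?B i (v (s k)) (a k i)" for k i
    unfolding v_def a_def
  proof (rule outer_variation_weak_partial[OF oB sub \<zeta>])
    show "norm (\<zeta> x) \<le> b" for x using b0(2)[of x] by (simp add: b_def)
    show "\<bar>s k\<bar> * b \<le> \<delta> / 2" using sb[of k] s(1)[of k] by simp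
  qed
  have wv0: "has_weak_partial ?B i (v 0) (g i)" for i
  proof (rule has_weak_partial_AE_cong[OF oB has_weak_partial_subset[OF u_weak_partial open_\<Omega> oB sub]])
    show "AE x in lebesgue. x \<in> ?B \<longrightarrow> u x = v 0 x"
      using u_in_N by eventually_elim (use sub in \<open>auto simp: v_def projection_id\<close>)
  qed simp
  have energy: "(LINT x|?M. (\<Sum>i\<in>UNIV. (norm (h i x))\<^sup>2)) = 2 * dirichlet_energy ?B f" if "\<And>i. has_weak_partial ?B i f (h i)"
    for f :: "real^'n \<Rightarrow> real^'p" and h
  proof -
    have "AE x in lebesgue. \<forall>i. x \<in> ?B \<longrightarrow> weak_partial ?B i f x = h i x"
      unfolding AE_all_countable using weak_partial_AE_eq[OF oB that] by blast
    then have "AE x in ?M. (\<Sum>i\<in>UNIV. (norm (h i x))\<^sup>2) = (\<Sum>i\<in>UNIV. (norm (weak_partial ?B i f x))\<^sup>2)"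
      unfolding AE_lebesgue_on_open[OF oB] by eventually_elim auto
    moreover have "(\<lambda>x. (\<Sum>i\<in>UNIV. (norm (h' i x))\<^sup>2)) \<in> borel_measurable ?M" if "\<And>i. has_weak_partial ?B i f (h' i)" for h' :: "'n \<Rightarrow> real^'n \<Rightarrow> real^'p"
      using has_weak_partial_measurable(2)[OF oB that] by measurable
    note mm = this
    ultimately show ?thesis
      unfolding dirichlet_energy_def
      using integral_cong_AE[OF mm[OF that] mm[OF has_weak_partial_weak_partial[OF that]]] by simp
  qed
  have am: "a k i \<in> borel_measurable ?M" for k i using has_weak_partial_measurable(2)[OF oB wv] .
  have gm: "g i \<in> borel_measurable ?M" for i using has_weak_partial_measurable(2)[OF oB wv0] .
  have gi: "integrable ?M (\<lambda>x. (norm (g i x))\<^sup>2)" for i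
  proof -
    have "integrable lebesgue (\<lambda>x. indicator \<Omega> x *\<^sub>R (norm (g i x))\<^sup>2)"
      using g_square_integrable[of i] by (simp add: integrable_restrict_space[OF \<Omega>s])
    from integrable_mult_indicator[OF sets_lebesgue_open[OF oB] this]
    have "integrable lebesgue (\<lambda>x. indicator ?B x *\<^sub>R indicator \<Omega> x *\<^sub>R (norm (g i x))\<^sup>2)" .
    moreover have "(\<lambda>x. indicator ?B x *\<^sub>R indicator \<Omega> x *\<^sub>R (norm (g i x))\<^sup>2) = (\<lambda>x. indicator ?B x *\<^sub>R (norm (g i x))\<^sup>2)"
      using sub by (auto simp: indicator_def fun_eq_iff)
    ultimately show ?thesis unfolding integrable_restrict_space[OF Bs] by simp
  qed
  have finB: "integrable ?M (\<lambda>x. r :: real)" for r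
  proof -
    have "emeasure lebesgue ?B < \<infinity>" using lmeasurable_ball[of c \<rho>] by (auto simp: fmeasurable_def)
    then have "integrable lebesgue (\<lambda>x. indicator ?B x *\<^sub>R r)"
      by (intro integrable_scaleR_left integrable_real_indicator sets_lebesgue_open[OF oB])
    then show ?thesis by (simp add: integrable_restrict_space[OF Bs])
  qed
  define q where "q k x = (\<Sum>i\<in>UNIV. ((norm (a k i x))\<^sup>2 - (norm (g i x))\<^sup>2) / (2 * s k))" for k x
  define Q where "Q x = (\<Sum>i\<in>UNIV. (1 + 12 * cc) * ((norm (g i x))\<^sup>2 + 2 * (m i)\<^sup>2))" for x
  have Qi: "integrable ?M Q"
    unfolding Q_def by (intro Bochner_Integration.integrable_sum integrable_mult_right Bochner_Integration.integrable_add gi finB)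
  have pw: "AE x in ?M. (\<forall>k i. ((norm (a k i x))\<^sup>2 - (norm (g i x))\<^sup>2) / s k \<le> (1 + 12 * cc) * ((norm (g i x))\<^sup>2 + 2 * (m i)\<^sup>2)) \<and>
     (\<lambda>k. q k x) \<longlonglongrightarrow> first_variation \<zeta> x"
    unfolding AE_lebesgue_on_open[OF oB] using u_in_N inner_test_partial[of \<zeta>]
  proof eventually_elim
    case (elim x)
    show ?case
    proof
      assume "x \<in> ?B"
      then have y: "u x \<in> N" and t: "\<And>i. D (u x) (g i x) = g i x" using elim sub by auto
      have "((norm (a k i x))\<^sup>2 - (norm (g i x))\<^sup>2) / s k \<le> (1 + 12 * cc) * ((norm (g i x))\<^sup>2 + 2 * (m i)\<^sup>2)" for k i
      proof (rule energy_density_quotient_bound[OF s])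
        have "infdist (u x + s k *\<^sub>R \<zeta> x) N \<le> s k * norm (\<zeta> x)"
          using infdist_le[OF y, of "u x + s k *\<^sub>R \<zeta> x"] s(1)[of k] by (simp add: dist_norm)
        also have "\<dots> < s k * b" using b0(2)[of x] s(1)[of k] by (intro mult_strict_left_mono) (auto simp: b_def)
        finally have "norm (a k i x) \<le> norm (g i x + s k *\<^sub>R partial_deriv i \<zeta> x) / (1 - s k * b / \<delta>)"
          unfolding a_def using sb[of k] \<delta> by (intro norm_D_le) auto
        also have "\<dots> \<le> (norm (g i x) + s k * m i) / (1 - s k * b / \<delta>)"
        proof (rule divide_right_mono)
          have "norm (s k *\<^sub>R partial_deriv i \<zeta> x) \<le> s k * m i" using s(1)[of k] m[of i x] by simp
          then show "norm (g i x + s k *\<^sub>R partial_deriv i \<zeta> x) \<le> norm (g i x) + s k * m i"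
            using norm_triangle_ineq[of "g i x" "s k *\<^sub>R partial_deriv i \<zeta> x"] by linarith
          have "s k * b / \<delta> = s k * cc" by (simp add: cc_def)
          then show "0 \<le> 1 - s k * b / \<delta>" using s(3)[of k] by linarith
        qed
        finally show "norm (a k i x) \<le> (norm (g i x) + s k * m i) / (1 - s k * cc)" by (simp add: cc_def)
      qed (use cc m0 in auto)
      moreover have "(\<lambda>k. q k x) \<longlonglongrightarrow> first_variation \<zeta> x"
      proof -
        have "(\<lambda>k. q k x) \<longlonglongrightarrow> (\<Sum>i\<in>UNIV. g i x \<bullet> partial_deriv i \<zeta> x + Hess \<pi> (u x) (g i x) (g i x) \<bullet> \<zeta> x)"
          unfolding q_def a_def
        proof (intro tendsto_sum outer_density_limit[OF y t s0])
          show "s k \<noteq> 0" for k using s(1)[of k] by simp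
        qed
        then show ?thesis by (simp add: first_variation_def Hess_term_def sum.distrib inner_sum_left)
      qed
      ultimately show "(\<forall>k i. ((norm (a k i x))\<^sup>2 - (norm (g i x))\<^sup>2) / s k \<le> (1 + 12 * cc) * ((norm (g i x))\<^sup>2 + 2 * (m i)\<^sup>2)) \<and>
        (\<lambda>k. q k x) \<longlonglongrightarrow> first_variation \<zeta> x" by blast
    qed
  qed
  have ai: "integrable ?M (\<lambda>x. (norm (a k i x))\<^sup>2)" for k i
  proof (rule Bochner_Integration.integrable_bound)
    show "integrable ?M (\<lambda>x. (norm (g i x))\<^sup>2 + s k * ((1 + 12 * cc) * ((norm (g i x))\<^sup>2 + 2 * (m i)\<^sup>2)))"
      by (intro Bochner_Integration.integrable_add integrable_mult_right gi finB)
    show "(\<lambda>x. (norm (a k i x))\<^sup>2) \<in> borel_measurable ?M" using am by measurable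
    show "AE x in ?M. norm ((norm (a k i x))\<^sup>2) \<le> norm ((norm (g i x))\<^sup>2 + s k * ((1 + 12 * cc) * ((norm (g i x))\<^sup>2 + 2 * (m i)\<^sup>2)))"
      using pw
    proof eventually_elim
      case (elim x)
      then have "((norm (a k i x))\<^sup>2 - (norm (g i x))\<^sup>2) / s k \<le> (1 + 12 * cc) * ((norm (g i x))\<^sup>2 + 2 * (m i)\<^sup>2)" by blast
      then have "(norm (a k i x))\<^sup>2 \<le> (norm (g i x))\<^sup>2 + s k * ((1 + 12 * cc) * ((norm (g i x))\<^sup>2 + 2 * (m i)\<^sup>2))"
        using s(1)[of k] by (simp add: pos_divide_le_eq mult.commute)
      then show ?case by simp
    qed
  qed
  have qi: "integrable ?M (q k)" for k
    unfolding q_def by (intro Bochner_Integration.integrable_sum integrable_divide_zero Bochner_Integration.integrable_diff ai gi)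
  have qint: "(LINT x|?M. q k x) = (E (s k) - E 0) / s k" for k
  proof -
    have "q k x = ((\<Sum>i\<in>UNIV. (norm (a k i x))\<^sup>2) - (\<Sum>i\<in>UNIV. (norm (g i x))\<^sup>2)) / (2 * s k)" for x
      by (simp add: q_def sum_subtractf sum_divide_distrib[symmetric])
    then have "(LINT x|?M. q k x) = ((LINT x|?M. (\<Sum>i\<in>UNIV. (norm (a k i x))\<^sup>2)) - (LINT x|?M. (\<Sum>i\<in>UNIV. (norm (g i x))\<^sup>2))) / (2 * s k)"
      using ai gi by (simp add: Bochner_Integration.integrable_sum)
    also have "\<dots> = (2 * E (s k) - 2 * E 0) / (2 * s k)"
      unfolding E_def using energy[OF wv] energy[OF wv0] by simp
    finally show ?thesis using s(1)[of k] by (simp add: field_simps)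
  qed
  have qlim: "(\<lambda>k. LINT x|?M. q k x) \<longlonglongrightarrow> 0"
  proof -
    have "((\<lambda>h. (E (0 + h) - E 0) / h) \<longlongrightarrow> 0) (at 0)" using E' by (simp add: DERIV_def)
    moreover have "filterlim s (at 0) sequentially" using s0 s(1) by (intro filterlim_atI) (auto simp: less_imp_neq[THEN not_sym])
    ultimately show ?thesis unfolding qint using filterlim_compose by fastforce
  qed
  have fvM: "integrable ?M (first_variation \<zeta>)" "(LINT x|?M. first_variation \<zeta> x) = (LINT x|lebesgue_on \<Omega>. first_variation \<zeta> x)"
  proof -
    have off: "first_variation \<zeta> x = 0" if "x \<notin> ?B" for x
      using outside_support[OF \<zeta> that] by (simp add: first_variation_def)
    have off\<Omega>: "first_variation \<zeta> x = 0" if "x \<notin> \<Omega>" for x using off[of x] that sub by blast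
    note eqB = integral_lebesgue_on_eq[OF sets_lebesgue_open[OF oB], of "first_variation \<zeta>", OF off]
    note eq\<Omega> = integral_lebesgue_on_eq[OF sets_lebesgue_open[OF open_\<Omega>], of "first_variation \<zeta>", OF off\<Omega>]
    show "integrable ?M (first_variation \<zeta>)" "(LINT x|?M. first_variation \<zeta> x) = (LINT x|lebesgue_on \<Omega>. first_variation \<zeta> x)"
      using eqB eq\<Omega> first_variation_integral(1)[OF \<zeta>\<Omega>] by simp_all
  qed
  \<comment> \<open>Truncating q from below gives a two-sided majorant. The limit is unaffected because the truncation
    level lies below the first variation, and the integrals only increase.\<close>
  define r where "r k x = max (q k x) (- Q x - \<bar>first_variation \<zeta> x\<bar>)" for k x
  have Q0: "0 \<le> Q x" for x unfolding Q_def using cc by (intro sum_nonneg mult_nonneg_nonneg) auto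
  have ri: "integrable ?M (r k)" for k
    unfolding r_def using fvM(1) Qi qi by (intro integrable_max Bochner_Integration.integrable_diff Bochner_Integration.integrable_minus integrable_abs)
  have "(\<lambda>k. LINT x|?M. r k x) \<longlonglongrightarrow> (LINT x|?M. first_variation \<zeta> x)"
  proof (rule integral_dominated_convergence)
    show "integrable ?M (\<lambda>x. Q x + \<bar>first_variation \<zeta> x\<bar>)" using fvM(1) Qi by auto
    show "first_variation \<zeta> \<in> borel_measurable ?M" using fvM(1) by (rule borel_measurable_integrable)
    show "r k \<in> borel_measurable ?M" for k using ri by (rule borel_measurable_integrable)
    show "AE x in ?M. (\<lambda>k. r k x) \<longlonglongrightarrow> first_variation \<zeta> x"
      using pw
    proof eventually_elim
      case (elim x)
      then have "(\<lambda>k. r k x) \<longlonglongrightarrow> max (first_variation \<zeta> x) (- Q x - \<bar>first_variation \<zeta> x\<bar>)"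
        unfolding r_def by (intro tendsto_max tendsto_const) blast
      moreover have "max (first_variation \<zeta> x) (- Q x - \<bar>first_variation \<zeta> x\<bar>) = first_variation \<zeta> x" using Q0[of x] by linarith
      ultimately show ?case by simp
    qed
    show "AE x in ?M. norm (r k x) \<le> Q x + \<bar>first_variation \<zeta> x\<bar>" for k
      using pw
    proof eventually_elim
      case (elim x)
      have "q k x \<le> Q x"
        unfolding q_def Q_def
      proof (rule sum_mono)
        fix i
        let ?d = "(1 + 12 * cc) * ((norm (g i x))\<^sup>2 + 2 * (m i)\<^sup>2)"
        have "((norm (a k i x))\<^sup>2 - (norm (g i x))\<^sup>2) / s k \<le> ?d" using elim by blast
        moreover have "0 \<le> ?d" using cc by simp
        moreover have "((norm (a k i x))\<^sup>2 - (norm (g i x))\<^sup>2) / (2 * s k) = ((norm (a k i x))\<^sup>2 - (norm (g i x))\<^sup>2) / s k / 2" by simp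
        ultimately show "((norm (a k i x))\<^sup>2 - (norm (g i x))\<^sup>2) / (2 * s k) \<le> ?d" by linarith
      qed
      then show ?case using Q0[of x] by (auto simp: r_def)
    qed
  qed
  moreover have "(LINT x|?M. q k x) \<le> (LINT x|?M. r k x)" for k
    by (rule integral_mono[OF qi ri]) (simp add: r_def)
  ultimately have "0 \<le> (LINT x|?M. first_variation \<zeta> x)"
    by (intro LIMSEQ_le[OF qlim]) auto
  then show ?thesis by (simp add: fvM(2))
qed

lemma first_variation_ball_zero:
  assumes crit: "outer_critical \<Omega> N u" and B: "0 < \<rho>" "cball c \<rho> \<subseteq> \<Omega>" and \<zeta>: "\<zeta> \<in> test_functions (ball c \<rho>)"
  shows "(LINT x|lebesgue_on \<Omega>. first_variation \<zeta> x) = 0"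
proof -
  have m: "(\<lambda>x. - \<zeta> x) \<in> test_functions (ball c \<rho>)"
    using test_functions_linear[OF bounded_linear_minus[OF bounded_linear_ident] \<zeta>] by simp
  have "(LINT x|lebesgue_on \<Omega>. first_variation (\<lambda>x. - \<zeta> x) x) = - (LINT x|lebesgue_on \<Omega>. first_variation \<zeta> x)"
    by (simp add: first_variation_minus[OF \<zeta>])
  then show ?thesis
    using first_variation_ball_nonneg[OF crit B \<zeta>] first_variation_ball_nonneg[OF crit B m] by simp
qed

text \<open>Induction on the number of balls that cover the support. A cut-off function \<open>\<beta>\<close> that is 1 on one
  ball splits \<open>\<zeta>\<close> into \<open>\<beta> \<zeta>\<close>, supported in a slightly larger ball, and \<open>(1 - \<beta>) \<zeta>\<close>, which vanishes outside
  the remaining balls.\<close>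

lemma first_variation_zero_of_balls:
  assumes balls: "\<And>c \<rho> \<zeta>. 0 < \<rho> \<Longrightarrow> cball c \<rho> \<subseteq> \<Omega> \<Longrightarrow> \<zeta> \<in> test_functions (ball c \<rho>) \<Longrightarrow> (LINT x|lebesgue_on \<Omega>. first_variation \<zeta> x) = 0"
    and F: "finite F" "\<And>c. c \<in> F \<Longrightarrow> 0 < r c \<and> cball c (2 * r c) \<subseteq> \<Omega>"
    and \<zeta>: "\<zeta> \<in> test_functions \<Omega>" "\<And>x. x \<notin> (\<Union>c\<in>F. ball c (r c)) \<Longrightarrow> \<zeta> x = 0"
  shows "(LINT x|lebesgue_on \<Omega>. first_variation \<zeta> x) = 0"
  using F \<zeta>
proof (induction F arbitrary: \<zeta> rule: finite_induct)
  case empty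
  then have z: "\<zeta> = (\<lambda>x. 0)" by auto
  have "first_variation \<zeta> x = 0" for x
    using first_variation_add[OF empty.prems(2) empty.prems(2), of x] unfolding z by simp
  then show ?case by simp
next
  case (insert c F)
  have r: "0 < r c" "cball c (2 * r c) \<subseteq> \<Omega>" using insert.prems(1) by auto
  obtain \<beta> :: "real^'n \<Rightarrow> real" where \<beta>: "\<And>k. Ck_on k \<beta> UNIV" "\<And>x. x \<in> cball c (r c) \<Longrightarrow> \<beta> x = 1"
    "\<And>x. x \<notin> ball c (3/2 * r c) \<Longrightarrow> \<beta> x = 0"
    using smooth_cutoff[of "r c" "3/2 * r c" c] r(1) by auto
  have sm: "Ck_on k (\<lambda>x. 1 + (-1) * \<beta> x) UNIV" for k
    by (rule Ck_on_add[OF open_UNIV Ck_on_const[OF open_UNIV] Ck_on_mult[OF open_UNIV Ck_on_const[OF open_UNIV] \<beta>(1)]])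
  have sz: "Ck_on k (\<lambda>x. \<beta> x *\<^sub>R \<zeta> x) UNIV" for k
    by (rule test_functions_smooth[OF test_functions_smooth_scaleR[OF \<beta>(1) insert.prems(2)]])
  have t1: "(\<lambda>x. \<beta> x *\<^sub>R \<zeta> x) \<in> test_functions (ball c (2 * r c))"
  proof (rule test_functionsI[OF sz])
    show "compact (cball c (3/2 * r c))" by simp
    show "cball c (3/2 * r c) \<subseteq> ball c (2 * r c)" using r(1) by auto
    show "\<beta> x *\<^sub>R \<zeta> x = 0" if "x \<notin> cball c (3/2 * r c)" for x
      using \<beta>(3)[of x] that by auto
  qed
  have t1\<Omega>: "(\<lambda>x. \<beta> x *\<^sub>R \<zeta> x) \<in> test_functions \<Omega>"
    by (rule test_functions_mono[OF t1 order_trans[OF ball_subset_cball r(2)]])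
  have t2: "(\<lambda>x. (1 + (-1) * \<beta> x) *\<^sub>R \<zeta> x) \<in> test_functions \<Omega>"
    by (rule test_functions_smooth_scaleR[OF sm insert.prems(2)])
  have z1: "(LINT x|lebesgue_on \<Omega>. first_variation (\<lambda>x. \<beta> x *\<^sub>R \<zeta> x) x) = 0"
    by (rule balls[OF _ r(2) t1]) (use r(1) in simp)
  have z2: "(LINT x|lebesgue_on \<Omega>. first_variation (\<lambda>x. (1 + (-1) * \<beta> x) *\<^sub>R \<zeta> x) x) = 0"
  proof (rule insert.IH[OF _ t2])
    show "0 < r d \<and> cball d (2 * r d) \<subseteq> \<Omega>" if "d \<in> F" for d using insert.prems(1) that by blast
    show "(1 + (-1) * \<beta> x) *\<^sub>R \<zeta> x = 0" if "x \<notin> (\<Union>c\<in>F. ball c (r c))" for x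
      using \<beta>(2)[of x] insert.prems(3)[of x] that by (cases "x \<in> ball c (r c)") auto
  qed
  have "(\<lambda>x. \<beta> x *\<^sub>R \<zeta> x + (1 + (-1) * \<beta> x) *\<^sub>R \<zeta> x) = \<zeta>" by (auto simp: fun_eq_iff algebra_simps)
  then have "first_variation \<zeta> x = first_variation (\<lambda>x. \<beta> x *\<^sub>R \<zeta> x) x + first_variation (\<lambda>x. (1 + (-1) * \<beta> x) *\<^sub>R \<zeta> x) x" for x
    using first_variation_add[OF t1\<Omega> t2, of x] by metis
  then have "(LINT x|lebesgue_on \<Omega>. first_variation \<zeta> x) = (LINT x|lebesgue_on \<Omega>. first_variation (\<lambda>x. \<beta> x *\<^sub>R \<zeta> x) x)
     + (LINT x|lebesgue_on \<Omega>. first_variation (\<lambda>x. (1 + (-1) * \<beta> x) *\<^sub>R \<zeta> x) x)"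
    using first_variation_integral(1)[OF t1\<Omega>] first_variation_integral(1)[OF t2] by simp
  then show ?case using z1 z2 by simp
qed

lemma outer_critical_imp_tangential_zero:
  assumes crit: "outer_critical \<Omega> N u" shows "weak_tangential_laplacian_zero \<Omega> N u"
  unfolding tangential_laplacian_zero_iff
proof
  fix \<zeta> :: "real^'n \<Rightarrow> real^'p" assume \<zeta>: "\<zeta> \<in> test_functions \<Omega>"
  then obtain K where K: "compact K" "K \<subseteq> \<Omega>" "\<And>x. x \<notin> K \<Longrightarrow> \<zeta> x = 0" unfolding test_functions_def by blast
  have "\<exists>r>0. cball x (2 * r) \<subseteq> \<Omega>" if x: "x \<in> K" for x
  proof -
    obtain e where "e > 0" "cball x e \<subseteq> \<Omega>" using open_\<Omega> K(2) x by (meson open_contains_cball subsetD)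
    then show ?thesis by (intro exI[of _ "e/2"]) auto
  qed
  then obtain r where r: "\<And>x. x \<in> K \<Longrightarrow> r x > 0" "\<And>x. x \<in> K \<Longrightarrow> cball x (2 * r x) \<subseteq> \<Omega>" by metis
  have cover: "K \<subseteq> (\<Union>x\<in>K. ball x (r x))" using r(1) by force
  obtain F where F: "F \<subseteq> K" "finite F" "K \<subseteq> (\<Union>x\<in>F. ball x (r x))"
    using compactE_image[OF K(1) _ cover] by blast
  show "(LINT x|lebesgue_on \<Omega>. first_variation \<zeta> x) = 0"
  proof (rule first_variation_zero_of_balls[OF first_variation_ball_zero[OF crit] F(2) _ \<zeta>, where r=r])
    show "0 < r c \<and> cball c (2 * r c) \<subseteq> \<Omega>" if "c \<in> F" for c using r F(1) that by blast
    show "\<zeta> x = 0" if "x \<notin> (\<Union>c\<in>F. ball c (r c))" for x using K(3) F(3) that by blast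
  qed
qed

end

theorem proposition1:
  fixes \<Omega> :: "(real^'n) set" and N :: "(real^'p) set"
    and k :: nat and \<delta> :: real and u :: "real^'n \<Rightarrow> real^'p"
  assumes "open \<Omega>"
    and "k \<ge> 3" and "Ck_submanifold k N"
    and "\<delta> > 0" and "Ck_nearest_point_projection (k - 1) N \<delta>"
    and "u \<in> W12_into \<Omega> N"
  shows "(outer_critical \<Omega> N u \<longrightarrow> weak_tangential_laplacian_zero \<Omega> N u) \<and>
    (weak_tangential_laplacian_zero \<Omega> N u \<longleftrightarrow>
       weak_laplacian_eq \<Omega> u
         (\<lambda>x. \<Sum>i\<in>UNIV. Hess (closest_point N) (u x) (weak_partial \<Omega> i u x) (weak_partial \<Omega> i u x))) \<and>
    (weak_tangential_laplacian_zero \<Omega> N u \<longleftrightarrow>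
       weak_laplacian_eq \<Omega> u
         (\<lambda>x. - (\<Sum>i\<in>UNIV. second_fundamental_form N (u x) (weak_partial \<Omega> i u x) (weak_partial \<Omega> i u x))))"
proof -
  interpret sobolev_into_tube N \<delta> \<Omega> u
  proof
    show "\<delta> > 0" "open \<Omega>" "u \<in> W12_into \<Omega> N" by fact+
    show "\<exists>!y. y \<in> N \<and> dist x y = infdist x N" if "x \<in> tubular_nbhd N \<delta>" for x
      using assms(5) that unfolding Ck_nearest_point_projection_def by blast
    show "Ck_on 2 (closest_point N) (tubular_nbhd N \<delta>)"
      using assms(2,5) unfolding Ck_nearest_point_projection_def by (auto intro: Ck_on_le[of "k - 1"])
  qed
  have "weak_laplacian_eq \<Omega> u Hess_term \<longleftrightarrow> weak_laplacian_eq \<Omega> u (\<lambda>x. - (\<Sum>i\<in>UNIV. second_fundamental_form N (u x) (g i x) (g i x)))"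
    using weak_laplacian_eq_AE_cong[OF assms(1) sff_term_AE] weak_laplacian_eq_AE_cong[OF assms(1), of Hess_term] sff_term_AE
    by (metis (mono_tags, lifting) AE_cong)
  then show ?thesis
    using outer_critical_imp_tangential_zero tangential_iff_Hess unfolding Hess_term_def[abs_def] by blast
qed

end
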